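(* Let $\mathcal{C}$ be a class of graphs closed under taking induced subgraphs. Then the following statements are equivalent: 1. First-order logic (FO) and guarded second-order logic (GSO) have the same expressive power on $\mathcal{C}$. 2. $\mathcal{C}$ has bounded tree depth.
   Context: Graphs are undirected and simple, viewed as logical structures over the vocabulary $\{E\}$ with $E$ binary (the symmetric, irreflexive edge relation), whose universe is the vertex set. An induced subgraph is obtained by deleting vertices together with exactly the edges incident with them. **Tree depth.** Let $G=(V,E)$ be a graph with connected components $(G_i)_{i\in I}$; $G[U]$ denotes the subgraph induced on $U\subseteq V$. The tree depth $\mathrm{td}(G)$ is defined recursively by $$\mathrm{td}(G)=\begin{cases}1 & \text{if } |V|=1,\\ 1+\min_{x\in V}\mathrm{td}(G[V\setminus\{x\}]) & \text{if } |V|>1 \text{ and } |I|=1,\\ \max_{i\in I}\mathrm{td}(G_i) & \text{otherwise.}\end{cases}$$ A class $\mathcal{C}$ of graphs has bounded tree depth if there is $d\in\mathbb{N}$ such that $\mathrm{td}(G)\le d$ for every $G\in\mathcal{C}$. **Logics.** FO is first-order logic with equality. GSO has the same syntax as full second-order logic (relation variables of arbitrary arity), but its semantics allows only guarded relations as values of second-order variables: the Gaifman graph of a relation $R\subseteq S^r$ on a set $S$ is the undirected graph with vertex set $S$ in which two distinct $u,v$ are adjacent iff both occur in a common tuple of $R$; the Gaifman graph of a structure is the union of the Gaifman graphs of its relations; and $R$ is guarded in a structure with universe $S$ if the Gaifman graph of $R$ is a subgraph of the Gaifman graph of the structure. **Expressive power.** For logics $L_1,L_2$ and a class $\mathcal{C}$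 of structures, $L_1\leqq_{\mathcal{C}}L_2$ means that for every $L_1$-sentence $\varphi_1$ there is an $L_2$-sentence $\varphi_2$ such that exactly the same members of $\mathcal{C}$ satisfy $\varphi_1$ and $\varphi_2$. $L_1$ and $L_2$ have the same expressive power on $\mathcal{C}$ if $L_1\leqq_{\mathcal{C}}L_2$ and $L_2\leqq_{\mathcal{C}}L_1$. *)

theory Defs
  imports "Graph_Theory.Digraph_Component" "HOL-Library.Extended_Nat"
begin

section \<open>Graphs\<close>

text \<open>
  Graphs may be infinite. The universe of a logical structure is nonempty, so the graph
  without vertices is excluded.
\<close>

definition simple_graph :: "'a pair_pre_digraph \<Rightarrow> bool" where
  "simple_graph G \<longleftrightarrow> pair_bidirected_digraph G \<and> pverts G \<noteq> {}"

definition induced :: "'a pair_pre_digraph \<Rightarrow> 'a set \<Rightarrow> 'a pair_pre_digraph" where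
  "induced G U = \<lparr>pverts = U, parcs = parcs G \<inter> U \<times> U\<rparr>"

lemma with_proj_induced: "with_proj (induced G U) = with_proj G \<restriction> U"
  by (auto simp: induced_def with_proj_def induce_subgraph_def)

definition closed_under_induced_subgraphs :: "'a pair_pre_digraph set \<Rightarrow> bool" where
  "closed_under_induced_subgraphs \<C> \<longleftrightarrow>
     (\<forall>G\<in>\<C>. \<forall>U. U \<noteq> {} \<and> U \<subseteq> pverts G \<longrightarrow> induced G U \<in> \<C>)"

text \<open>For symmetric arcs the strongly connected components are the connected components.\<close>

definition components :: "'a pair_pre_digraph \<Rightarrow> 'a set set" where
  "components G = pre_digraph.sccs_verts (with_proj G)"


section \<open>Tree depth\<close>

text \<open>
  On infinite graphs the recursion for tree depth is not well-founded. Its right-hand side is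
  therefore read as a monotone operator on functions into \<^typ>\<open>enat\<close>, of which tree depth is
  the least fixed point. Lemma \<open>tree_depth_unique\<close> shows that nothing depends on the choice of
  the least one: all solutions of the recursion agree on graphs. As \<^term>\<open>card\<close> of an infinite
  set is 0, the tests for cardinality 1 are correct for infinite sets as well.
\<close>

definition tree_depth_step ::
    "('a pair_pre_digraph \<Rightarrow> enat) \<Rightarrow> 'a pair_pre_digraph \<Rightarrow> enat" where
  "tree_depth_step td G =
     (if card (pverts G) = 1 then 1
      else if card (components G) = 1 then 1 + (INF x\<in>pverts G. td (induced G (pverts G - {x})))
      else (SUP C\<in>components G. td (induced G C)))"

definition tree_depth :: "'a pair_pre_digraph \<Rightarrow> enat" where
  "tree_depth = lfp tree_depth_step"

lemma mono_tree_depth_step: "mono tree_depth_step"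
proof (rule monoI, rule le_funI)
  fix f g :: "'a pair_pre_digraph \<Rightarrow> enat" and G
  assume "f \<le> g"
  then have le: "f H \<le> g H" for H by (simp add: le_fun_def)
  show "tree_depth_step f G \<le> tree_depth_step g G"
    unfolding tree_depth_step_def by (auto intro!: add_left_mono INF_mono' SUP_mono' le)
qed

lemma tree_depth_unfold: "tree_depth = tree_depth_step tree_depth"
  unfolding tree_depth_def by (rule lfp_unfold[OF mono_tree_depth_step])

theorem tree_depth_rec:
  "tree_depth G =
     (if card (pverts G) = 1 then 1
      else if card (components G) = 1
        then 1 + (INF x\<in>pverts G. tree_depth (induced G (pverts G - {x})))
      else (SUP C\<in>components G. tree_depth (induced G C)))"
  by (subst tree_depth_unfold) (simp add: tree_depth_step_def)

lemma pair_wf_induced: "pair_wf_digraph (induced G U)"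
  by unfold_locales (auto simp: induced_def)

lemma card_components_component:
  assumes "pair_wf_digraph G" "C \<in> components G"
  shows "card (components (induced G C)) = 1"
proof -
  interpret G: wf_digraph "with_proj G" using assms(1) by (simp add: wf_digraph_wp_iff)
  interpret max_reachable_set "with_proj G" C
    using assms(2) by unfold_locales (simp add: components_def)
  interpret H: wf_digraph "with_proj G \<restriction> C" by (rule G.wellformed_induce_subgraph)
  have reach: "u \<rightarrow>\<^sup>*\<^bsub>with_proj G \<restriction> C\<^esub> v \<longleftrightarrow> u \<in> C \<and> v \<in> C" for u v
    using reachable_induced reach_in by (auto dest: H.reachable_in_verts)
  have "components (induced G C) = {C}"
    unfolding components_def with_proj_induced pre_digraph.sccs_verts_def reach
    using not_empty by auto
  then show ?thesis by simp
qed

lemma tree_depth_fixpoints_le: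
  assumes "pair_wf_digraph G" "f = tree_depth_step f" "g = tree_depth_step g" "f G \<le> enat n"
  shows "g G \<le> enat n"
  using assms(1,4)
proof (induction n arbitrary: G rule: less_induct)
  case (less n)
  have conn: "g H \<le> enat n"
    if wf: "pair_wf_digraph H" and le: "f H \<le> enat n" and c: "card (components H) = 1" for H
  proof (cases "card (pverts H) = 1")
    case True
    then have "f H = 1" "g H = 1"
      by (subst assms(2), use True in \<open>simp add: tree_depth_step_def\<close>)
        (subst assms(3), use True in \<open>simp add: tree_depth_step_def\<close>)
    then show ?thesis using le by simp
  next
    case False
    have fH: "f H = 1 + (INF x\<in>pverts H. f (induced H (pverts H - {x})))"
      by (subst assms(2)) (use False c in \<open>simp add: tree_depth_step_def\<close>)
    have gH: "g H = 1 + (INF x\<in>pverts H. g (induced H (pverts H - {x})))"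
      by (subst assms(3)) (use False c in \<open>simp add: tree_depth_step_def\<close>)
    obtain m where m: "n = Suc m"
      using le fH by (cases n) (auto simp: zero_enat_def[symmetric])
    have "(INF x\<in>pverts H. f (induced H (pverts H - {x}))) < enat n"
    proof (cases "INF x\<in>pverts H. f (induced H (pverts H - {x}))")
      case (enat k)
      then show ?thesis using le fH by (simp add: one_enat_def)
    next
      case infinity
      then show ?thesis using le fH by simp
    qed
    then obtain x where x: "x \<in> pverts H" "f (induced H (pverts H - {x})) < enat n"
      by (auto simp: INF_less_iff)
    then have "f (induced H (pverts H - {x})) \<le> enat m"
      by (cases "f (induced H (pverts H - {x}))") (auto simp: m)
    then have "g (induced H (pverts H - {x})) \<le> enat m"
      using less.IH pair_wf_induced m by blast
    then have "(INF x\<in>pverts H. g (induced H (pverts H - {x}))) \<le> enat m"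
      using x(1) by (meson INF_lower2)
    then have "g H \<le> 1 + enat m" unfolding gH by (rule add_left_mono)
    then show ?thesis by (simp add: m one_enat_def)
  qed
  show ?case
  proof (cases "card (pverts G) = 1 \<or> card (components G) = 1")
    case True
    then consider "card (pverts G) = 1" | "card (components G) = 1" by blast
    then show ?thesis
    proof cases
      case 1
      then have "f G = 1" "g G = 1"
        by (subst assms(2), use 1 in \<open>simp add: tree_depth_step_def\<close>)
          (subst assms(3), use 1 in \<open>simp add: tree_depth_step_def\<close>)
      then show ?thesis using less.prems by simp
    next
      case 2
      then show ?thesis using conn less.prems by blast
    qed
  next
    case False
    then have fG: "f G = (SUP C\<in>components G. f (induced G C))"
      and gG: "g G = (SUP C\<in>components G. g (induced G C))"
      by (subst assms(2), use False in \<open>simp add: tree_depth_step_def\<close>)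
        (subst assms(3), use False in \<open>simp add: tree_depth_step_def\<close>)
    show ?thesis unfolding gG
    proof (rule SUP_least)
      fix C assume C: "C \<in> components G"
      have "f (induced G C) \<le> enat n"
        using less.prems(2) C unfolding fG by (meson SUP_upper order_trans)
      then show "g (induced G C) \<le> enat n"
        by (rule conn[OF pair_wf_induced _ card_components_component[OF less.prems(1) C]])
    qed
  qed
qed

theorem tree_depth_unique:
  assumes "pair_wf_digraph G" "td = tree_depth_step td"
  shows "td G = tree_depth G"
proof (rule antisym)
  show "td G \<le> tree_depth G"
    using tree_depth_fixpoints_le[OF assms(1) tree_depth_unfold assms(2)]
    by (cases "tree_depth G") auto
  show "tree_depth G \<le> td G"
    using tree_depth_fixpoints_le[OF assms(1) assms(2) tree_depth_unfold]
    by (cases "td G") auto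
qed

definition bounded_tree_depth :: "'a pair_pre_digraph set \<Rightarrow> bool" where
  "bounded_tree_depth \<C> \<longleftrightarrow> (\<exists>d::nat. \<forall>G\<in>\<C>. tree_depth G \<le> enat d)"


section \<open>Guarded relations\<close>

text \<open>
  An $r$-ary relation on $S$ is a set of lists of length $r$ with entries in $S$.
\<close>

definition tuples :: "nat \<Rightarrow> 'a set \<Rightarrow> 'a list set" where
  "tuples r S = {t. length t = r \<and> set t \<subseteq> S}"

definition gaifman_rel :: "'a set \<Rightarrow> 'a list set \<Rightarrow> 'a pair_pre_digraph" where
  "gaifman_rel S R =
     \<lparr>pverts = S, parcs = {(u, v). u \<noteq> v \<and> (\<exists>t\<in>R. u \<in> set t \<and> v \<in> set t)}\<rparr>"

text \<open>The only relation of a graph, as a structure, is its edge relation.\<close>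

definition gaifman_graph :: "'a pair_pre_digraph \<Rightarrow> 'a pair_pre_digraph" where
  "gaifman_graph G = gaifman_rel (pverts G) {[u, v] |u v. (u, v) \<in> parcs G}"

definition guarded :: "'a pair_pre_digraph \<Rightarrow> 'a list set \<Rightarrow> bool" where
  "guarded G R \<longleftrightarrow>
     subgraph (with_proj (gaifman_rel (pverts G) R)) (with_proj (gaifman_graph G))"

lemma gaifman_graph_simple:
  assumes "simple_graph G"
  shows "gaifman_graph G = G"
proof -
  interpret pair_bidirected_digraph G using assms by (simp add: simple_graph_def)
  have "(v, u) \<in> parcs G" if "(u, v) \<in> parcs G" for u v
    using graph_symmetric that by simp
  moreover have "u \<noteq> v" if "(u, v) \<in> parcs G" for u v
    using pair_no_loops[OF that] by simp
  ultimately show ?thesis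
    by (cases G) (fastforce simp: gaifman_graph_def gaifman_rel_def)
qed


section \<open>First-order logic\<close>

text \<open>Element variables are natural numbers.\<close>

datatype fo =
    FOEq nat nat
  | FOEdge nat nat
  | FONot fo
  | FOAnd fo fo
  | FOEx nat fo

primrec fo_free :: "fo \<Rightarrow> nat set" where
  "fo_free (FOEq x y) = {x, y}"
| "fo_free (FOEdge x y) = {x, y}"
| "fo_free (FONot \<phi>) = fo_free \<phi>"
| "fo_free (FOAnd \<phi> \<psi>) = fo_free \<phi> \<union> fo_free \<psi>"
| "fo_free (FOEx x \<phi>) = fo_free \<phi> - {x}"

primrec fo_sat :: "'a pair_pre_digraph \<Rightarrow> (nat \<Rightarrow> 'a) \<Rightarrow> fo \<Rightarrow> bool" where
  "fo_sat G \<sigma> (FOEq x y) \<longleftrightarrow> \<sigma> x = \<sigma> y"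
| "fo_sat G \<sigma> (FOEdge x y) \<longleftrightarrow> (\<sigma> x, \<sigma> y) \<in> parcs G"
| "fo_sat G \<sigma> (FONot \<phi>) \<longleftrightarrow> \<not> fo_sat G \<sigma> \<phi>"
| "fo_sat G \<sigma> (FOAnd \<phi> \<psi>) \<longleftrightarrow> fo_sat G \<sigma> \<phi> \<and> fo_sat G \<sigma> \<psi>"
| "fo_sat G \<sigma> (FOEx x \<phi>) \<longleftrightarrow> (\<exists>a\<in>pverts G. fo_sat G (\<sigma>(x := a)) \<phi>)"

definition fo_models :: "'a pair_pre_digraph \<Rightarrow> fo \<Rightarrow> bool" where
  "fo_models G \<phi> \<longleftrightarrow> (\<forall>\<sigma>. range \<sigma> \<subseteq> pverts G \<longrightarrow> fo_sat G \<sigma> \<phi>)"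


section \<open>Guarded second-order logic\<close>

text \<open>
  A relation variable is a pair of an index and an arity. The atom \<open>SORel X xs\<close> applies the
  relation variable with index \<open>X\<close> and arity \<open>length xs\<close> to the element variables \<open>xs\<close>;
  \<open>SOExRel X r\<close> quantifies over the values of the relation variable \<open>(X, r)\<close>.
\<close>

datatype so =
    SOEq nat nat
  | SOEdge nat nat
  | SORel nat "nat list"
  | SONot so
  | SOAnd so so
  | SOEx nat so
  | SOExRel nat nat so

primrec so_free :: "so \<Rightarrow> nat set" where
  "so_free (SOEq x y) = {x, y}"
| "so_free (SOEdge x y) = {x, y}"
| "so_free (SORel X xs) = set xs"
| "so_free (SONot \<phi>) = so_free \<phi>"
| "so_free (SOAnd \<phi> \<psi>) = so_free \<phi> \<union> so_free \<psi>"
| "so_free (SOEx x \<phi>) = so_free \<phi> - {x}"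
| "so_free (SOExRel X r \<phi>) = so_free \<phi>"

primrec so_free_rel :: "so \<Rightarrow> (nat \<times> nat) set" where
  "so_free_rel (SOEq x y) = {}"
| "so_free_rel (SOEdge x y) = {}"
| "so_free_rel (SORel X xs) = {(X, length xs)}"
| "so_free_rel (SONot \<phi>) = so_free_rel \<phi>"
| "so_free_rel (SOAnd \<phi> \<psi>) = so_free_rel \<phi> \<union> so_free_rel \<psi>"
| "so_free_rel (SOEx x \<phi>) = so_free_rel \<phi>"
| "so_free_rel (SOExRel X r \<phi>) = so_free_rel \<phi> - {(X, r)}"

primrec gso_sat ::
    "'a pair_pre_digraph \<Rightarrow> (nat \<Rightarrow> 'a) \<Rightarrow> (nat \<times> nat \<Rightarrow> 'a list set) \<Rightarrow> so \<Rightarrow> bool" where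
  "gso_sat G \<sigma> \<rho> (SOEq x y) \<longleftrightarrow> \<sigma> x = \<sigma> y"
| "gso_sat G \<sigma> \<rho> (SOEdge x y) \<longleftrightarrow> (\<sigma> x, \<sigma> y) \<in> parcs G"
| "gso_sat G \<sigma> \<rho> (SORel X xs) \<longleftrightarrow> map \<sigma> xs \<in> \<rho> (X, length xs)"
| "gso_sat G \<sigma> \<rho> (SONot \<phi>) \<longleftrightarrow> \<not> gso_sat G \<sigma> \<rho> \<phi>"
| "gso_sat G \<sigma> \<rho> (SOAnd \<phi> \<psi>) \<longleftrightarrow> gso_sat G \<sigma> \<rho> \<phi> \<and> gso_sat G \<sigma> \<rho> \<psi>"
| "gso_sat G \<sigma> \<rho> (SOEx x \<phi>) \<longleftrightarrow> (\<exists>a\<in>pverts G. gso_sat G (\<sigma>(x := a)) \<rho> \<phi>)"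
| "gso_sat G \<sigma> \<rho> (SOExRel X r \<phi>) \<longleftrightarrow>
     (\<exists>R \<subseteq> tuples r (pverts G). guarded G R \<and> gso_sat G \<sigma> (\<rho>((X, r) := R)) \<phi>)"

definition gso_models :: "'a pair_pre_digraph \<Rightarrow> so \<Rightarrow> bool" where
  "gso_models G \<phi> \<longleftrightarrow> (\<forall>\<sigma> \<rho>. range \<sigma> \<subseteq> pverts G \<longrightarrow> gso_sat G \<sigma> \<rho> \<phi>)"


section \<open>Expressive power\<close>

text \<open>A logic consists of its sentences and its satisfaction relation.\<close>

type_synonym ('s, 'f) logic = "'f set \<times> ('s \<Rightarrow> 'f \<Rightarrow> bool)"

definition FO :: "('a pair_pre_digraph, fo) logic" where
  "FO = ({\<phi>. fo_free \<phi> = {}}, fo_models)"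

definition GSO :: "('a pair_pre_digraph, so) logic" where
  "GSO = ({\<phi>. so_free \<phi> = {} \<and> so_free_rel \<phi> = {}}, gso_models)"

definition at_most_expressive ::
    "'s set \<Rightarrow> ('s, 'f) logic \<Rightarrow> ('s, 'g) logic \<Rightarrow> bool" where
  "at_most_expressive \<C> L\<^sub>1 L\<^sub>2 \<longleftrightarrow>
     (\<forall>\<phi>\<^sub>1\<in>fst L\<^sub>1. \<exists>\<phi>\<^sub>2\<in>fst L\<^sub>2. {S\<in>\<C>. snd L\<^sub>1 S \<phi>\<^sub>1} = {S\<in>\<C>. snd L\<^sub>2 S \<phi>\<^sub>2})"

definition same_expressive_power ::
    "'s set \<Rightarrow> ('s, 'f) logic \<Rightarrow> ('s, 'g) logic \<Rightarrow> bool" where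
  "same_expressive_power \<C> L\<^sub>1 L\<^sub>2 \<longleftrightarrow>
     at_most_expressive \<C> L\<^sub>1 L\<^sub>2 \<and> at_most_expressive \<C> L\<^sub>2 L\<^sub>1"

end

theory Submission
  imports Defs "HOL-Library.Ramsey"
begin

text \<open>
  A graph of tree depth at most \<open>d\<close> has an elimination forest of depth at most \<open>d\<close>. Every clique
  lies on a branch of it, hence so does every guarded tuple, which is recorded in the label of its
  last vertex on the branch. If children are counted only up to a threshold, there are finitely
  many classes of labelled trees of bounded depth. A guarded relation or an element on one side is
  an expansion of the labels; if the trees agree for a large threshold, the expansion can be
  answered on the other side such that they still agree for a smaller one. So the class of an
  elimination forest with a large threshold determines which GSO-sentences of bounded quantifier
  rank hold. As paths are short, components are first-order definable, and thus so is the class of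
  an elimination forest in which every component uses a canonical one of its possible classes.

  If the tree depth is unbounded, there are arbitrarily long paths. Number the vertices of a long
  path and connect any two vertices \<open>i < j\<close> of it by a shortest path with increasing numbers in
  \<open>{i..j}\<close>, which is induced. If all these paths are short, Ramsey's theorem for sets of four
  vertices makes the adjacencies between the paths from \<open>x\<^sub>1\<close> to \<open>x\<^sub>2\<close> and from \<open>x\<^sub>3\<close> to \<open>x\<^sub>4\<close>
  uniform. Either some adjacency always occurs, which leads to a large clique or induced biclique, or
  none does, and then a shortest path through many consecutive ones is long. On induced paths,
  cliques and bicliques, first-order logic cannot separate \<open>2 k\<close> from \<open>2 k - 1\<close> vertices for large
  \<open>k\<close>, but GSO can, as exactly the former have a perfect matching.
\<close>

section \<open>Labelled trees up to a counting threshold\<close>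

text \<open>Similarity of forests splits over branches only because guarded tuples are cliques: a
  tuple spread over incomparable branches could not be stored in a single label. Each quantifier
  multiplies the number of classes of expanded trees, so every threshold must exceed a multiple of
  the next one; the thresholds are built backwards from the innermost quantifier.

  First-order logic cannot quantify over elimination forests, since a root has to be chosen in each
  of possibly infinitely many components. It can express, by quantifying over the root, which
  classes a single component admits, and these form a finite set. A fixed choice function on such
  sets lets all components commit at once. Graphs that share the resulting class have similar
  forests, although no particular forest is defined.

  In the converse direction the colour of four vertices records the positions of one adjacency
  between two short paths, or that there is none, so \<open>r * r + 1\<close> colours suffice. A
  perfect matching is a guarded relation, and it exists on every even pattern because consecutive
  vertices are adjacent in all three.\<close>

declare split_paired_All [simp del] split_paired_Ex [simp del]

section \<open>Cardinalities truncated at a threshold\<close>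

definition ccard :: "nat \<Rightarrow> 'b set \<Rightarrow> nat" where
  "ccard t A = (if finite A then min t (card A) else t)"

lemma ccard_le: "ccard t A \<le> t"
  by (simp add: ccard_def)

lemma ccard_mono: "A \<subseteq> B \<Longrightarrow> ccard t A \<le> ccard t B"
  by (auto simp: ccard_def card_mono min.coboundedI2 dest: finite_subset)

lemma ccard_pos_iff: "0 < t \<Longrightarrow> 0 < ccard t A \<longleftrightarrow> A \<noteq> {}"
  by (auto simp: ccard_def card_gt_0_iff)

lemma ccard_bij_betw: "bij_betw f A B \<Longrightarrow> ccard t A = ccard t B"
  by (auto simp: ccard_def bij_betw_same_card dest: bij_betw_finite)

lemma ccard_image: "inj_on f A \<Longrightarrow> ccard t (f ` A) = ccard t A"
  by (metis ccard_bij_betw inj_on_imp_bij_betw)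

lemma ccard_eq_max_iff: "ccard t A = t \<longleftrightarrow> infinite A \<or> t \<le> card A"
  by (auto simp: ccard_def)

lemma exists_subset_card: "infinite A \<or> n \<le> card A \<Longrightarrow> \<exists>S\<subseteq>A. finite S \<and> card S = n"
  using infinite_arbitrarily_large[of A n] obtain_subset_with_card_n[of n A] by blast

text \<open>If some fibre is saturated at \<open>t\<close>, both sets are. Otherwise corresponding
  fibres are finite and of equal size, and bijections between them glue together.\<close>

lemma ccard_fibres:
  assumes "\<And>k. ccard t {a \<in> A. f a = k} = ccard t {b \<in> B. g b = k}"
  shows "ccard t A = ccard t B"
proof (cases "\<exists>k. ccard t {a \<in> A. f a = k} = t")
  case True
  then obtain k where k: "ccard t {a \<in> A. f a = k} = t" by blast
  have "ccard t {a \<in> A. f a = k} \<le> ccard t A" "ccard t {b \<in> B. g b = k} \<le> ccard t B"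
    by (auto intro: ccard_mono)
  with k assms[of k] ccard_le[of t A] ccard_le[of t B] show ?thesis by simp
next
  case False
  have "\<exists>h. bij_betw h {a \<in> A. f a = k} {b \<in> B. g b = k}" for k
  proof -
    have "ccard t {a \<in> A. f a = k} \<noteq> t" using False by blast
    moreover from this have "ccard t {b \<in> B. g b = k} \<noteq> t" using assms[of k] by simp
    ultimately have "finite {a \<in> A. f a = k}" "finite {b \<in> B. g b = k}"
      "card {a \<in> A. f a = k} = card {b \<in> B. g b = k}"
      using assms[of k] by (auto simp: ccard_def split: if_splits)
    then show ?thesis by (rule finite_same_card_bij)
  qed
  then obtain h where h: "\<And>k. bij_betw (h k) {a \<in> A. f a = k} {b \<in> B. g b = k}" by metis
  have "bij_betw (\<lambda>a. h (f a) a) A B"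
  proof (rule bij_betwI')
    have hin: "h (f a) a \<in> B \<and> g (h (f a) a) = f a" if "a \<in> A" for a
      using bij_betwE[OF h[of "f a"]] that by auto
    fix x y assume "x \<in> A" "y \<in> A"
    then show "(h (f x) x = h (f y) y) = (x = y)"
      using hin[of x] hin[of y] bij_betw_imp_inj_on[OF h[of "f x"]]
      by (auto simp: inj_on_def)
    show "h (f x) x \<in> B" using hin \<open>x \<in> A\<close> by blast
  next
    fix y assume "y \<in> B"
    then have "y \<in> h (g y) ` {a \<in> A. f a = g y}"
      using h[of "g y"] by (auto simp: bij_betw_def)
    then show "\<exists>x\<in>A. y = h (f x) x" by (auto intro: bexI[rotated])
  qed
  then show ?thesis by (rule ccard_bij_betw)
qed

text \<open>Below the threshold \<open>A\<close> and \<open>B\<close> are equinumerous and a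
  bijection serves. Otherwise both are large: a sample of \<open>A\<close> with at most
  \<open>t'\<close> elements from each of at most \<open>K\<close> fibres has at most
  \<open>t\<close> elements, so it can be matched with a part of \<open>B\<close>, and the remainder
  of \<open>B\<close> is sent where it is not noticed.\<close>

lemma ccard_distribute:
  assumes eq: "ccard t A = ccard t B" and fin: "finite (e ` A)" and K: "card (e ` A) \<le> K"
    and t: "t' * K \<le> t" "0 < t" "0 < t'"
  shows "\<exists>h. h ` B \<subseteq> A \<and> (\<forall>x. ccard t' {a \<in> A. e a = x} = ccard t' {b \<in> B. e (h b) = x})"
proof (cases "ccard t A = t")
  case False
  then have "finite A" "finite B" "card B = card A"
    using eq by (auto simp: ccard_def split: if_splits)
  then obtain h where h: "bij_betw h B A" using finite_same_card_bij by blast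
  have bij: "bij_betw h {b \<in> B. e (h b) = x} {a \<in> A. e a = x}" for x
    using h by (auto simp: bij_betw_def inj_on_def)
  have "ccard t' {a \<in> A. e a = x} = ccard t' {b \<in> B. e (h b) = x}" for x
    by (rule ccard_bij_betw[OF bij, symmetric])
  moreover have "h ` B \<subseteq> A" using h by (simp add: bij_betw_def)
  ultimately show ?thesis by blast
next
  case True
  then have bigA: "infinite A \<or> t \<le> card A" and bigB: "infinite B \<or> t \<le> card B"
    using eq ccard_eq_max_iff[of t A] ccard_eq_max_iff[of t B] by auto
  define F where "F x = {a \<in> A. e a = x}" for x
  have "\<exists>S\<subseteq>F x. finite S \<and> card S = ccard t' (F x)" for x
  proof -
    have "infinite (F x) \<or> ccard t' (F x) \<le> card (F x)" by (auto simp: ccard_def)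
    then show ?thesis by (rule exists_subset_card)
  qed
  then obtain S where S: "\<And>x. S x \<subseteq> F x" "\<And>x. finite (S x)" "\<And>x. card (S x) = ccard t' (F x)"
    by metis
  define SS where "SS = (\<Union>x\<in>e ` A. S x)"
  have finSS: "finite SS" unfolding SS_def using fin S(2) by (rule finite_UN_I)
  have "card SS \<le> (\<Sum>x\<in>e ` A. card (S x))" unfolding SS_def by (rule card_UN_le[OF fin])
  also have "\<dots> \<le> (\<Sum>x\<in>e ` A. t')" by (rule sum_mono) (simp add: S(3) ccard_le)
  also have "\<dots> \<le> t" using order_trans[OF mult_le_mono2[OF K] t(1)] by (simp add: mult.commute)
  finally have cSS: "card SS \<le> t" .
  then have "infinite B \<or> card SS \<le> card B" using bigB by linarith
  then obtain D where D: "D \<subseteq> B" "finite D" "card D = card SS" using exists_subset_card by metis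
  then obtain p where p: "bij_betw p D SS" using finSS finite_same_card_bij by metis
  \<comment> \<open>Without a fibre of at least \<open>t'\<close> elements, \<open>A\<close> would
    have fewer than \<open>K * t'\<close> elements, hence fewer than \<open>t\<close>.\<close>
  have "\<exists>x0. ccard t' (F x0) = t'"
  proof (rule ccontr)
    assume no: "\<nexists>x0. ccard t' (F x0) = t'"
    then have F: "finite (F x)" "card (F x) < t'" for x
      by (auto simp: ccard_eq_max_iff not_le)
    have "A = (\<Union>x\<in>e ` A. F x)" by (auto simp: F_def)
    moreover have "finite (\<Union>x\<in>e ` A. F x)" by (rule finite_UN_I) (use fin F(1) in auto)
    ultimately have "finite A" by (rule ssubst)
    have "A \<noteq> {}" using bigA t(2) by auto
    then have ne: "e ` A \<noteq> {}" by simp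
    have "card A \<le> (\<Sum>x\<in>e ` A. card (F x))"
      using \<open>A = (\<Union>x\<in>e ` A. F x)\<close> card_UN_le[OF fin, of F] by simp
    also have "\<dots> < (\<Sum>x\<in>e ` A. t')" by (rule sum_strict_mono[OF fin ne]) (rule F(2))
    also have "\<dots> \<le> t" using order_trans[OF mult_le_mono2[OF K] t(1)] by (simp add: mult.commute)
    finally show False using bigA \<open>finite A\<close> by simp
  qed
  then obtain x0 where x0: "ccard t' (F x0) = t'" by blast
  have "S x0 \<noteq> {}" using S(3)[of x0] x0 t(3) by auto
  then obtain a0 where a0: "a0 \<in> S x0" by blast
  \<comment> \<open>All of \<open>B\<close> outside \<open>D\<close> goes to one element of the
    saturated fibre, where further elements do not change the truncated count.\<close>
  define h where "h b = (if b \<in> D then p b else a0)" for b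
  have pin: "p b \<in> SS" if "b \<in> D" for b using p that by (auto simp: bij_betw_def)
  have SSF: "SS \<subseteq> A" using S(1) by (auto simp: SS_def F_def)
  have hB: "h ` B \<subseteq> A" using pin SSF a0 S(1)[of x0] by (auto simp: h_def F_def)
  have bij: "ccard t {b \<in> D. e (p b) = x} = ccard t (S x)" for x t
  proof -
    have "S x = {a \<in> SS. e a = x}"
    proof (rule set_eqI)
      fix a
      have Sy: "a \<in> A \<and> e a = y" if "a \<in> S y" for y using S(1)[of y] that by (auto simp: F_def)
      show "a \<in> S x \<longleftrightarrow> a \<in> {a \<in> SS. e a = x}"
      proof
        assume "a \<in> S x"
        then show "a \<in> {a \<in> SS. e a = x}" using Sy[of x] by (auto simp: SS_def)
      next
        assume "a \<in> {a \<in> SS. e a = x}"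
        then obtain y where "a \<in> S y" "e a = x" by (auto simp: SS_def)
        then show "a \<in> S x" using Sy[of y] by simp
      qed
    qed
    moreover have "bij_betw p {b \<in> D. e (p b) = x} {a \<in> SS. e a = x}"
      using p by (auto simp: bij_betw_def inj_on_def)
    ultimately show ?thesis using ccard_bij_betw[of p] by simp
  qed
  have cS: "ccard t' (S x) = ccard t' (F x)" for x
    using S(2,3)[of x] ccard_le[of t' "F x"] by (simp add: ccard_def[of _ "S x"])
  have "ccard t' (F x) = ccard t' {b \<in> B. e (h b) = x}" for x
  proof (cases "x = x0")
    case True
    have "ccard t' {b \<in> D. e (p b) = x0} \<le> ccard t' {b \<in> B. e (h b) = x0}"
      using D(1) by (intro ccard_mono) (auto simp: h_def)
    then show ?thesis using bij[of t' x0] cS[of x0] x0 True ccard_le[of t' "{b \<in> B. e (h b) = x0}"] by simp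
  next
    case False
    have "e a0 = x0" using a0 S(1) by (auto simp: F_def)
    then have "{b \<in> B. e (h b) = x} = {b \<in> D. e (p b) = x}"
      using D(1) False by (auto simp: h_def split: if_splits)
    then show ?thesis using bij[of t' x] cS[of x] by simp
  qed
  then show ?thesis using hB by (auto simp: F_def)
qed

text \<open>
  A labelled tree is given by its set of branches and the labels of their last nodes; the labels
  are defined on all lists, but only those of branches matter.
\<close>

type_synonym ('a, 'l) ctree = "'a list set \<times> ('a list \<Rightarrow> 'l)"

section \<open>Similarity of labelled trees and its classes\<close>

definition kids :: "('a, 'l) ctree \<Rightarrow> 'a set" where
  "kids c = {u. [u] \<in> fst c}"

definition sub :: "('a, 'l) ctree \<Rightarrow> 'a \<Rightarrow> ('a, 'l) ctree" where
  "sub c u = ({s. u # s \<in> fst c}, \<lambda>s. snd c (u # s))"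

text \<open>The tree \<open>d\<close> ranges over all trees and stands for its class, so that no
  quotient is formed during the recursion. Only \<open>m\<close> levels below the root are
  inspected, which is everything if no branch is longer than \<open>m\<close>.\<close>

primrec sim :: "nat \<Rightarrow> nat \<Rightarrow> ('a, 'l) ctree \<Rightarrow> ('a, 'l) ctree \<Rightarrow> bool" where
  "sim t 0 c c' \<longleftrightarrow> snd c [] = snd c' []"
| "sim t (Suc m) c c' \<longleftrightarrow> snd c [] = snd c' [] \<and>
     (\<forall>d. ccard t {u \<in> kids c. sim t m d (sub c u)} = ccard t {u \<in> kids c'. sim t m d (sub c' u)})"

lemma sim_refl [simp]: "sim t m c c"
  by (cases m) auto

lemma sim_sym: "sim t m c c' \<Longrightarrow> sim t m c' c"
  by (cases m) auto

lemma sim_trans: "sim t m c c' \<Longrightarrow> sim t m c' c'' \<Longrightarrow> sim t m c c''"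
  by (cases m) auto

definition class_of :: "nat \<Rightarrow> nat \<Rightarrow> ('a, 'l) ctree \<Rightarrow> ('a, 'l) ctree set" where
  "class_of t m c = {d. sim t m c d}"

lemma class_of_eq_iff: "class_of t m c = class_of t m d \<longleftrightarrow> sim t m c d"
proof
  assume "class_of t m c = class_of t m d"
  then have "d \<in> class_of t m c" by (simp add: class_of_def)
  then show "sim t m c d" by (simp add: class_of_def)
next
  assume "sim t m c d"
  then show "class_of t m c = class_of t m d" by (auto simp: class_of_def intro: sim_trans sim_sym)
qed

lemma sim_Suc_class:
  "sim t (Suc m) c c' \<longleftrightarrow> snd c [] = snd c' [] \<and>
     (\<forall>k. ccard t {u \<in> kids c. class_of t m (sub c u) = k} = ccard t {u \<in> kids c'. class_of t m (sub c' u) = k})"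
proof -
  have eq: "{u \<in> kids c. sim t m d (sub c u)} = {u \<in> kids c. class_of t m (sub c u) = class_of t m d}"
    for c d :: "('a, 'b) ctree"
    by (auto simp: class_of_eq_iff intro: sim_sym)
  have "ccard t {u \<in> kids c. class_of t m (sub c u) = k} = ccard t {u \<in> kids c'. class_of t m (sub c' u) = k}"
    if all: "\<forall>d. ccard t {u \<in> kids c. sim t m d (sub c u)} = ccard t {u \<in> kids c'. sim t m d (sub c' u)}" for k
  proof (cases "\<exists>d. k = class_of t m d")
    case True
    then show ?thesis using all by (auto simp: eq)
  next
    case False
    then have "{u \<in> kids c. class_of t m (sub c u) = k} = {}" "{u \<in> kids c'. class_of t m (sub c' u) = k} = {}"
      by blast+
    then show ?thesis by (simp only:)
  qed
  then show ?thesis by (auto simp: eq)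
qed

definition ctrees :: "'l set \<Rightarrow> ('a, 'l) ctree set" where
  "ctrees F = {c. [] \<in> fst c \<and> (\<forall>s\<in>fst c. snd c s \<in> F)}"

lemma sub_ctrees: "c \<in> ctrees F \<Longrightarrow> u \<in> kids c \<Longrightarrow> sub c u \<in> ctrees F"
  by (auto simp: ctrees_def sub_def kids_def)

text \<open>A class is determined by the label of the root and the truncated numbers of children in
  each class of the previous level. There are finitely many of both.\<close>

lemma finite_classes:
  assumes "finite F"
  shows "finite (class_of t m ` ctrees F :: ('a, 'l) ctree set set)"
proof (induction m)
  case 0
  have "class_of t 0 c = (\<lambda>l. {d. l = snd d []}) (snd c [])" for c :: "('a, 'l) ctree"
    by (simp add: class_of_def)
  then have "class_of t 0 ` ctrees F \<subseteq> (\<lambda>l. {d :: ('a, 'l) ctree. l = snd d []}) ` F"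
    by (auto simp: ctrees_def)
  then show ?case using assms by (rule finite_surj[rotated])
next
  case (Suc m)
  let ?K = "class_of t m ` ctrees F :: ('a, 'l) ctree set set"
  \<comment> \<open>Restricting the counting function to the finite set \<open>?K\<close> puts it
    into a finite function space; outside \<open>?K\<close> all counts are zero for trees in
    \<open>ctrees F\<close>.\<close>
  define Q where "Q c = (snd c [], restrict (\<lambda>k. ccard t {u \<in> kids c. class_of t m (sub c u) = k}) ?K)"
    for c :: "('a, 'l) ctree"
  have "Q ` ctrees F \<subseteq> F \<times> (?K \<rightarrow>\<^sub>E {..t})"
    by (auto simp: Q_def ctrees_def ccard_le)
  moreover have "finite (F \<times> (?K \<rightarrow>\<^sub>E {..t}))"
    using assms Suc by (intro finite_cartesian_product finite_PiE) auto
  ultimately have fin: "finite (Q ` ctrees F)" by (rule finite_subset)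
  have "class_of t (Suc m) c = class_of t (Suc m) c'"
    if c: "c \<in> ctrees F" "c' \<in> ctrees F" and Q: "Q c = Q c'" for c c'
  proof -
    have "ccard t {u \<in> kids c. class_of t m (sub c u) = k} = ccard t {u \<in> kids c'. class_of t m (sub c' u) = k}" for k
    proof (cases "k \<in> ?K")
      case True
      have "snd (Q c) k = snd (Q c') k" using Q by simp
      then show ?thesis using True by (simp add: Q_def)
    next
      case False
      then have "{u \<in> kids c. class_of t m (sub c u) = k} = {}" "{u \<in> kids c'. class_of t m (sub c' u) = k} = {}"
        using sub_ctrees[OF c(1)] sub_ctrees[OF c(2)] False by blast+
      then show ?thesis by (simp only:)
    qed
    moreover have "snd c [] = snd c' []" using Q by (simp add: Q_def)
    ultimately show ?thesis unfolding class_of_eq_iff sim_Suc_class by blast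
  qed
  note class_of_Q = this
  define f where "f q = class_of t (Suc m) (SOME c. c \<in> ctrees F \<and> Q c = q)" for q
  have "class_of t (Suc m) c = f (Q c)" if "c \<in> ctrees F" for c
    unfolding f_def using someI[of "\<lambda>c'. c' \<in> ctrees F \<and> Q c' = Q c" c] that
    by (intro class_of_Q) auto
  then have "class_of t (Suc m) ` ctrees F \<subseteq> f ` Q ` ctrees F" by auto
  moreover have "finite (f ` Q ` ctrees F)" using fin by (rule finite_imageI)
  ultimately show ?case by (rule finite_subset)
qed

text \<open>
  Each child of the second tree copies the expansion of some similar child of the first. By
  \<open>ccard_distribute\<close> the copies can be chosen such that the expanded children are counted alike up to
  \<open>t'\<close>, provided that \<open>t\<close> exceeds \<open>t'\<close> times the number of classes of expanded children.
\<close>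

lemma sim_expand:
  fixes g :: "'l \<Rightarrow> 'x \<Rightarrow> 'k"
  assumes "finite FL" "finite FX" "0 < t'"
  shows "\<exists>t0. \<forall>t\<ge>t0. \<forall>T L T' L' X. (T, L) \<in> ctrees FL \<and> (T', L') \<in> ctrees FL \<and>
     (\<forall>s\<in>T. X s \<in> FX) \<and> sim t m (T, L) (T', L' :: 'a list \<Rightarrow> 'l) \<longrightarrow>
     (\<exists>X'. sim t' m (T, \<lambda>s. g (L s) (X s)) (T', \<lambda>s. g (L' s) (X' s)))"
proof (induction m)
  case 0
  show ?case
  proof (intro exI[of _ 0] allI impI, elim conjE)
    fix t T L T' L' and X :: "'a list \<Rightarrow> 'x"
    assume "sim t 0 (T, L) (T', L' :: 'a list \<Rightarrow> 'l)"
    then have "sim t' 0 (T, \<lambda>s. g (L s) (X s)) (T', \<lambda>s. g (L' s) (X s))" by simp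
    then show "\<exists>X'. sim t' 0 (T, \<lambda>s. g (L s) (X s)) (T', \<lambda>s. g (L' s) (X' s))"
      by (rule exI[of _ X])
  qed
next
  case (Suc m)
  then obtain t0 where IH: "\<forall>t\<ge>t0. \<forall>T L T' L' X. (T, L) \<in> ctrees FL \<and> (T', L') \<in> ctrees FL \<and>
     (\<forall>s\<in>T. X s \<in> FX) \<and> sim t m (T, L) (T', L' :: 'a list \<Rightarrow> 'l) \<longrightarrow>
     (\<exists>X'. sim t' m (T, \<lambda>s. g (L s) (X s)) (T', \<lambda>s. g (L' s) (X' s)))"
    by blast
  define FG where "FG = (\<lambda>(l, x). g l x) ` (FL \<times> FX)"
  let ?K = "class_of t' m ` ctrees FG :: ('a, 'k) ctree set set"
  have fFG: "finite FG" using assms by (simp add: FG_def)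
  have finK: "finite ?K" by (rule finite_classes[OF fFG])
  show ?case
  \<comment> \<open>\<open>t0\<close> serves the subtrees by induction, its successor makes the
    threshold positive, and the product is what \<open>ccard_distribute\<close> demands.\<close>
  proof (intro exI[of _ "max (Suc t0) (t' * card ?K)"] allI impI, elim conjE)
    fix t T L T' L' and X :: "'a list \<Rightarrow> 'x"
    assume t: "max (Suc t0) (t' * card ?K) \<le> t"
      and c: "(T, L) \<in> ctrees FL" and c': "(T', L') \<in> ctrees FL"
      and X: "\<forall>s\<in>T. X s \<in> FX" and sim: "sim t (Suc m) (T, L) (T', L' :: 'a list \<Rightarrow> 'l)"
    define d where "d = (T, \<lambda>s. g (L s) (X s))"
    have kd: "kids d = kids (T, L)" by (simp add: d_def kids_def)
    have d: "d \<in> ctrees FG" using c X by (auto simp: d_def ctrees_def FG_def)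
    let ?A = "\<lambda>k. {u \<in> kids (T, L). class_of t m (sub (T, L) u) = k}"
    let ?B = "\<lambda>k. {u \<in> kids (T', L'). class_of t m (sub (T', L') u) = k}"
    let ?e = "\<lambda>u. class_of t' m (sub d u)"
    have "\<exists>h. h ` ?B k \<subseteq> ?A k \<and> (\<forall>x. ccard t' {a \<in> ?A k. ?e a = x} = ccard t' {b \<in> ?B k. ?e (h b) = x})"
      for k
    proof (rule ccard_distribute)
      show "ccard t (?A k) = ccard t (?B k)" using sim unfolding sim_Suc_class by blast
      have sub: "?e ` ?A k \<subseteq> ?K" using sub_ctrees[OF d] kd by auto
      then show "finite (?e ` ?A k)" using finK finite_subset by blast
      show "card (?e ` ?A k) \<le> card ?K" using card_mono[OF finK sub] .
      show "t' * card ?K \<le> t" "0 < t" "0 < t'" using t assms(3) by auto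
    qed
    then have "\<exists>h. \<forall>k. h k ` ?B k \<subseteq> ?A k \<and>
        (\<forall>x. ccard t' {a \<in> ?A k. ?e a = x} = ccard t' {b \<in> ?B k. ?e (h k b) = x})"
      by (intro choice allI)
    then obtain h where h: "\<And>k. h k ` ?B k \<subseteq> ?A k"
      "\<And>k x. ccard t' {a \<in> ?A k. ?e a = x} = ccard t' {b \<in> ?B k. ?e (h k b) = x}"
      by blast
    \<comment> \<open>\<open>H u\<close> is the child of the first tree that the child
      \<open>u\<close> of the second one imitates; the two are similar before the expansion.\<close>
    define H where "H u = h (class_of t m (sub (T', L') u)) u" for u
    have H: "H u \<in> kids (T, L) \<and> sim t m (sub (T, L) (H u)) (sub (T', L') u)" if "u \<in> kids (T', L')" for u
    proof -
      have "H u \<in> ?A (class_of t m (sub (T', L') u))"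
        using h(1)[of "class_of t m (sub (T', L') u)"] that unfolding H_def by blast
      then show ?thesis by (auto simp: class_of_eq_iff)
    qed
    have "\<exists>Y. sim t' m (sub d (H u)) ({s. u # s \<in> T'}, \<lambda>s. g (L' (u # s)) (Y s))"
      if u: "u \<in> kids (T', L')" for u
    proof -
      have "sub (T, L) (H u) \<in> ctrees FL" "sub (T', L') u \<in> ctrees FL"
        using H[OF u] by (auto intro!: sub_ctrees[OF c] sub_ctrees[OF c'] u)
      moreover have "t0 \<le> t" and "\<forall>s\<in>{s. H u # s \<in> T}. X (H u # s) \<in> FX" using X t by auto
      moreover have "sim t m ({s. H u # s \<in> T}, \<lambda>s. L (H u # s)) ({s. u # s \<in> T'}, \<lambda>s. L' (u # s))"
        using H[OF u] by (simp add: sub_def)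
      ultimately have "\<exists>X'. sim t' m ({s. H u # s \<in> T}, \<lambda>s. g (L (H u # s)) (X (H u # s)))
          ({s. u # s \<in> T'}, \<lambda>s. g (L' (u # s)) (X' s))"
        by (intro IH[rule_format] conjI) (simp_all only: sub_def fst_conv snd_conv)
      then show ?thesis by (simp add: sub_def d_def)
    qed
    then have "\<exists>Y. \<forall>u\<in>kids (T', L').
        sim t' m (sub d (H u)) ({s. u # s \<in> T'}, \<lambda>s. g (L' (u # s)) (Y u s))"
      by (intro bchoice ballI)
    then obtain Y where Y: "\<And>u. u \<in> kids (T', L') \<Longrightarrow>
        sim t' m (sub d (H u)) ({s. u # s \<in> T'}, \<lambda>s. g (L' (u # s)) (Y u s))"
      by blast
    define X' where "X' s = (case s of [] \<Rightarrow> X [] | u # r \<Rightarrow> Y u r)" for s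
    define d' where "d' = (T', \<lambda>s. g (L' s) (X' s))"
    have kd': "kids d' = kids (T', L')" by (simp add: d'_def kids_def)
    have sub': "class_of t' m (sub d' u) = ?e (H u)" if "u \<in> kids (T', L')" for u
    proof -
      have "sub d' u = ({s. u # s \<in> T'}, \<lambda>s. g (L' (u # s)) (Y u s))"
        by (simp add: d'_def sub_def X'_def)
      then show ?thesis using Y[OF that] by (simp add: class_of_eq_iff sim_sym)
    qed
    have "sim t' (Suc m) d d'"
      unfolding sim_Suc_class
    proof (intro conjI allI)
      show "snd d [] = snd d' []" using sim by (simp add: d_def d'_def X'_def)
      fix k
      \<comment> \<open>Within each class \<open>x\<close> of unexpanded children,
        \<open>h x\<close> balances the classes after expansion; \<open>ccard_fibres\<close> adds up
        over all \<open>x\<close>.\<close>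
      have "ccard t' {u \<in> kids d. ?e u = k} = ccard t' {u \<in> kids (T', L'). ?e (H u) = k}"
      proof (rule ccard_fibres)
        fix x
        have "{a \<in> {u \<in> kids d. ?e u = k}. class_of t m (sub (T, L) a) = x} = {a \<in> ?A x. ?e a = k}"
          by (auto simp: kd)
        moreover have "{b \<in> {u \<in> kids (T', L'). ?e (H u) = k}. class_of t m (sub (T', L') b) = x}
            = {b \<in> ?B x. ?e (h x b) = k}" by (auto simp: H_def)
        ultimately show "ccard t' {a \<in> {u \<in> kids d. ?e u = k}. class_of t m (sub (T, L) a) = x} =
            ccard t' {b \<in> {u \<in> kids (T', L'). ?e (H u) = k}. class_of t m (sub (T', L') b) = x}"
          using h(2) by simp
      qed
      also have "{u \<in> kids (T', L'). ?e (H u) = k} = {u \<in> kids d'. class_of t' m (sub d' u) = k}"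
        using sub' by (auto simp: kd')
      finally show "ccard t' {u \<in> kids d. class_of t' m (sub d u) = k} = ccard t' {u \<in> kids d'. class_of t' m (sub d' u) = k}" .
    qed
    then show "\<exists>X'. sim t' (Suc m) (T, \<lambda>s. g (L s) (X s)) (T', \<lambda>s. g (L' s) (X' s))"
      by (auto simp: d_def d'_def)
  qed
qed

text \<open>A positive threshold tells an empty class of children from a nonempty one, so a branch
  can be followed downwards in the other tree, each step preserving the label.\<close>

lemma sim_branch:
  assumes "sim t m (T, L) (T', L')" "0 < t" "s' \<in> T'" "length s' \<le> m"
    and "\<And>s r. s @ r \<in> T \<Longrightarrow> s \<in> T" "\<And>s r. s @ r \<in> T' \<Longrightarrow> s \<in> T'" "[] \<in> T"
  shows "\<exists>s\<in>T. length s = length s' \<and> (\<forall>i\<le>length s. L (take i s) = L' (take i s'))"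
  using assms
proof (induction m arbitrary: T L T' L' s')
  case 0
  then show ?case by (intro bexI[of _ "[]"]) auto
next
  case (Suc m)
  show ?case
  proof (cases s')
    case Nil
    then show ?thesis using Suc.prems by (intro bexI[of _ "[]"]) auto
  next
    case (Cons u' r')
    have u': "u' \<in> kids (T', L')"
      using Suc.prems(3) Suc.prems(6)[of "[u']" r'] Cons by (simp add: kids_def)
    let ?d = "sub (T', L') u'"
    have "0 < ccard t {u \<in> kids (T', L'). sim t m ?d (sub (T', L') u)}"
      using u' Suc.prems(2) by (auto simp: ccard_pos_iff intro: sim_refl)
    then have "0 < ccard t {u \<in> kids (T, L). sim t m ?d (sub (T, L) u)}"
      using Suc.prems(1) by simp
    then obtain u where u: "u \<in> kids (T, L)" "sim t m ?d (sub (T, L) u)"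
      using Suc.prems(2) by (auto simp: ccard_pos_iff)
    have "\<exists>s\<in>{s. u # s \<in> T}. length s = length r' \<and> (\<forall>i\<le>length s. L (u # take i s) = L' (u' # take i r'))"
    proof (rule Suc.IH)
      show "sim t m ({s. u # s \<in> T}, \<lambda>s. L (u # s)) ({s. u' # s \<in> T'}, \<lambda>s. L' (u' # s))"
        using sim_sym[OF u(2)] by (simp add: sub_def)
      show "s \<in> {s. u # s \<in> T}" if "s @ r \<in> {s. u # s \<in> T}" for s r
        using Suc.prems(5)[of "u # s" r] that by simp
      show "s \<in> {s. u' # s \<in> T'}" if "s @ r \<in> {s. u' # s \<in> T'}" for s r
        using Suc.prems(6)[of "u' # s" r] that by simp
    qed (use Suc.prems Cons u in \<open>auto simp: kids_def\<close>)
    then obtain s where s: "u # s \<in> T" "length s = length r'"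
      "\<forall>i\<le>length s. L (u # take i s) = L' (u' # take i r')" by blast
    have "L (take i (u # s)) = L' (take i s')" if "i \<le> length (u # s)" for i
      using s(3) Suc.prems(1) that Cons by (cases i) auto
    then show ?thesis using s Cons by (intro bexI[of _ "u # s"]) auto
  qed
qed

text \<open>Label functions are total, but similarity reads them on branches only. Hence labels that
  are known merely on \<open>T\<close> may be exchanged.\<close>

lemma sim_cong:
  assumes "sim t m (T, L) c" "\<And>s. s \<in> T \<Longrightarrow> L s = L' s" "[] \<in> T" "\<And>s r. s @ r \<in> T \<Longrightarrow> s \<in> T"
  shows "sim t m (T, L') c"
  using assms
proof (induction m arbitrary: T L L' c)
  case (Suc m)
  have "sim t m d (sub (T, L) u) \<longleftrightarrow> sim t m d (sub (T, L') u)" if "u \<in> kids (T, L)" for u d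
  proof -
    have 1: "L (u # s) = L' (u # s)" if "u # s \<in> T" for s using Suc.prems(2) that by blast
    have 2: "[u] \<in> T" using that by (simp add: kids_def)
    have 3: "u # s \<in> T" if "u # s @ r \<in> T" for s r using Suc.prems(4)[of "u # s" r] that by simp
    have "sim t m ({s. u # s \<in> T}, \<lambda>s. L (u # s)) d \<longleftrightarrow> sim t m ({s. u # s \<in> T}, \<lambda>s. L' (u # s)) d"
      by (rule iffI; rule Suc.IH, assumption) (use 1 2 3 in auto)
    then show ?thesis using sim_sym unfolding sub_def fst_conv snd_conv by blast
  qed
  then have eq: "{u \<in> kids (T, L). sim t m d (sub (T, L) u)} = {u \<in> kids (T, L). sim t m d (sub (T, L') u)}" for d
    by (intro Collect_cong conj_cong refl)
  have "kids (T, L') = kids (T, L)" by (simp add: kids_def)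
  with eq have "{u \<in> kids (T, L). sim t m d (sub (T, L) u)} = {u \<in> kids (T, L'). sim t m d (sub (T, L') u)}" for d
    by simp
  then show ?case using Suc.prems by simp
qed simp

section \<open>Components, paths and tree depth\<close>

text \<open>A vertex \<open>u\<close> outside \<open>W\<close> gets the value \<open>{u}\<close>, so
  membership in \<open>W\<close> has to be treated separately later on.\<close>

definition component :: "'a rel \<Rightarrow> 'a set \<Rightarrow> 'a \<Rightarrow> 'a set" where
  "component E W u = {v. (u, v) \<in> (E \<inter> W \<times> W)\<^sup>*}"

definition comps :: "'a rel \<Rightarrow> 'a set \<Rightarrow> 'a set set" where
  "comps E W = component E W ` W"

lemma component_refl [simp]: "u \<in> component E W u"
  by (simp add: component_def)

lemma component_subset: "u \<in> W \<Longrightarrow> component E W u \<subseteq> W"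
proof
  fix v assume "u \<in> W" "v \<in> component E W u"
  from this(2) have "(u, v) \<in> (E \<inter> W \<times> W)\<^sup>*" by (simp add: component_def)
  then show "v \<in> W" by (induction rule: rtrancl_induct) (use \<open>u \<in> W\<close> in auto)
qed

lemma component_eq:
  assumes "sym E" "v \<in> component E W u"
  shows "component E W v = component E W u"
proof -
  have "sym ((E \<inter> W \<times> W)\<^sup>*)"
    using assms(1) by (intro sym_rtrancl) (auto simp: sym_def)
  then show ?thesis
    using assms(2) unfolding component_def by (auto dest: symD intro: rtrancl_trans)
qed

lemma component_arc: "sym E \<Longrightarrow> (x, y) \<in> E \<Longrightarrow> x \<in> W \<Longrightarrow> y \<in> W \<Longrightarrow> component E W y = component E W x"
  by (rule component_eq) (auto simp: component_def)

lemma component_mono: "W \<subseteq> W' \<Longrightarrow> component E W u \<subseteq> component E W' u"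
  unfolding component_def by (auto elim!: rev_subsetD[OF _ rtrancl_mono] )

lemma comps_eq:
  assumes "sym E" "C \<in> comps E W" "v \<in> C"
  shows "C = component E W v"
  using assms component_eq[OF assms(1)] unfolding comps_def by blast

lemma comps_subset: "C \<in> comps E W \<Longrightarrow> C \<subseteq> W"
  using component_subset by (fastforce simp: comps_def)

lemma component_restrict:
  assumes "v \<in> U" "U \<subseteq> W" and closed: "\<And>x y. x \<in> U \<Longrightarrow> y \<in> W \<Longrightarrow> (x, y) \<in> E \<Longrightarrow> y \<in> U"
  shows "component E U v = component E W v"
proof
  show "component E U v \<subseteq> component E W v" using assms(2) by (rule component_mono)
  show "component E W v \<subseteq> component E U v"
  proof
    fix w assume "w \<in> component E W v"
    then have "(v, w) \<in> (E \<inter> W \<times> W)\<^sup>*" by (simp add: component_def)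
    then have "(v, w) \<in> (E \<inter> U \<times> U)\<^sup>* \<and> w \<in> U"
    proof (induction rule: rtrancl_induct)
      case (step y z)
      then have "(y, z) \<in> E \<inter> U \<times> U" using closed by blast
      then show ?case using step by (auto intro: rtrancl_into_rtrancl)
    qed (simp add: assms(1))
    then show "w \<in> component E U v" by (simp add: component_def)
  qed
qed

text \<open>A component is closed under arcs into \<open>W\<close>. Hence deleting its root
  \<open>u\<close> and splitting the remainder gives the same parts whether done inside the
  component or in all of \<open>W\<close>; this makes the recursion for elimination forests
  local.\<close>

lemma component_component:
  assumes "u \<in> W"
  shows "v \<in> component E W u \<Longrightarrow> component E (component E W u) v = component E W v"
    and "v \<in> component E W u - {u} \<Longrightarrow> component E (component E W u - {u}) v = component E (W - {u}) v"
proof -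
  have closed: "y \<in> component E W u" if "x \<in> component E W u" "y \<in> W" "(x, y) \<in> E" for x y
  proof -
    have "x \<in> W" using component_subset[OF assms] that(1) by blast
    then show ?thesis using that by (auto simp: component_def intro: rtrancl_into_rtrancl)
  qed
  show "v \<in> component E W u \<Longrightarrow> component E (component E W u) v = component E W v"
    by (rule component_restrict) (use component_subset[OF assms] closed in auto)
  show "v \<in> component E W u - {u} \<Longrightarrow> component E (component E W u - {u}) v = component E (W - {u}) v"
    by (rule component_restrict) (use component_subset[OF assms] closed in auto)
qed

lemma comps_component:
  assumes "sym E" "C \<in> comps E W"
  shows "comps E C = {C}"
proof -
  obtain u where u: "u \<in> W" "C = component E W u" using assms(2) by (auto simp: comps_def)
  have "component E C v = C" if "v \<in> C" for v
    using component_component(1)[OF u(1)] component_eq[OF assms(1)] that unfolding u(2) by blast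
  moreover have "u \<in> C" using u(2) by simp
  ultimately show ?thesis by (auto simp: comps_def)
qed

lemma Union_comps: "\<Union> (comps E W) = W"
proof
  show "\<Union> (comps E W) \<subseteq> W" using comps_subset by blast
  show "W \<subseteq> \<Union> (comps E W)" using component_refl by (auto simp: comps_def)
qed

lemma card_comps:
  shows "card (comps E W) = 1 \<longleftrightarrow> comps E W = {W}" and "card W = 1 \<Longrightarrow> comps E W = {W}"
proof -
  show "card (comps E W) = 1 \<longleftrightarrow> comps E W = {W}"
    using Union_comps[of E W] by (auto simp: card_1_singleton_iff)
  assume "card W = 1"
  then obtain u where u: "W = {u}" by (auto simp: card_1_singleton_iff)
  have "component E W u = W" using component_subset[of u W E] component_refl[of u E W] u by blast
  then show "comps E W = {W}" using u by (simp add: comps_def)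
qed

lemma reachable_induced:
  "u \<rightarrow>\<^sup>*\<^bsub>with_proj (induced G W)\<^esub> v \<longleftrightarrow> u \<in> W \<and> v \<in> component (parcs G) W u"
proof -
  have "(u, v) \<in> rtrancl_on W (parcs G \<inter> W \<times> W) \<longleftrightarrow> u \<in> W \<and> (u, v) \<in> (parcs G \<inter> W \<times> W)\<^sup>*"
  proof
    assume "(u, v) \<in> rtrancl_on W (parcs G \<inter> W \<times> W)"
    then show "u \<in> W \<and> (u, v) \<in> (parcs G \<inter> W \<times> W)\<^sup>*"
      by (induction rule: rtrancl_on_induct) (auto intro: rtrancl_into_rtrancl)
  next
    assume uv: "u \<in> W \<and> (u, v) \<in> (parcs G \<inter> W \<times> W)\<^sup>*"
    then have "(u, v) \<in> (parcs G \<inter> W \<times> W)\<^sup>*" by simp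
    then show "(u, v) \<in> rtrancl_on W (parcs G \<inter> W \<times> W)"
      by (induction rule: rtrancl_induct) (use uv in \<open>auto intro: rtrancl_on_into_rtrancl_on\<close>)
  qed
  then show ?thesis by (simp add: reachable_def component_def induced_def)
qed

lemma components_induced:
  assumes "sym (parcs G)"
  shows "components (induced G W) = comps (parcs G) W"
proof -
  show ?thesis
    unfolding components_def pre_digraph.sccs_verts_def reachable_induced
  proof (intro set_eqI iffI)
    fix S
    assume S: "S \<in> {S. S \<noteq> {} \<and> (\<forall>u\<in>S. \<forall>v\<in>S. u \<in> W \<and> v \<in> component (parcs G) W u) \<and>
      (\<forall>u\<in>S. \<forall>v. v \<notin> S \<longrightarrow> \<not> (u \<in> W \<and> v \<in> component (parcs G) W u) \<or> \<not> (v \<in> W \<and> u \<in> component (parcs G) W v))}"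
    then obtain u where u: "u \<in> S" "u \<in> W" by blast
    have "S = component (parcs G) W u"
    proof
      show "S \<subseteq> component (parcs G) W u" using S u by blast
      show "component (parcs G) W u \<subseteq> S"
      proof
        fix v assume v: "v \<in> component (parcs G) W u"
        then have "v \<in> W" "u \<in> component (parcs G) W v"
          using component_subset[OF u(2)] component_eq[OF assms v] by auto
        then show "v \<in> S" using S u v by blast
      qed
    qed
    then show "S \<in> comps (parcs G) W" using u by (simp add: comps_def)
  next
    fix S assume S: "S \<in> comps (parcs G) W"
    then obtain u where u: "u \<in> W" "S = component (parcs G) W u" by (auto simp: comps_def)
    have "S \<subseteq> W" using S by (rule comps_subset)
    moreover have "component (parcs G) W v = S" if "v \<in> S" for v
      using comps_eq[OF assms S that] by simp
    moreover have "u \<in> S" using u(2) by simp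
    moreover from this have "S \<noteq> {}" by blast
    ultimately show "S \<in> {S. S \<noteq> {} \<and> (\<forall>u\<in>S. \<forall>v\<in>S. u \<in> W \<and> v \<in> component (parcs G) W u) \<and>
      (\<forall>u\<in>S. \<forall>v. v \<notin> S \<longrightarrow> \<not> (u \<in> W \<and> v \<in> component (parcs G) W u) \<or> \<not> (v \<in> W \<and> u \<in> component (parcs G) W v))}"
      by blast
  qed
qed

section \<open>From tree depth to recursive elimination\<close>

lemma induced_induced: "U \<subseteq> W \<Longrightarrow> induced (induced G W) U = induced G U"
  by (auto simp: induced_def)

lemma pverts_induced [simp]: "pverts (induced G U) = U"
  by (simp add: induced_def)

text \<open>For a connected \<open>C\<close> this is the existence of an elimination tree with at
  most \<open>m\<close> levels: the infimum and the suprema of tree depth become quantifiers. Level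
  0 is false because components are nonempty.\<close>

primrec elim_depth_le :: "'a rel \<Rightarrow> nat \<Rightarrow> 'a set \<Rightarrow> bool" where
  "elim_depth_le E 0 C \<longleftrightarrow> False"
| "elim_depth_le E (Suc m) C \<longleftrightarrow> (\<exists>u\<in>C. \<forall>D\<in>comps E (C - {u}). elim_depth_le E m D)"

text \<open>An infimum of extended naturals below a finite bound has a member below that bound,
  which is the vertex to delete; a supremum below the bound bounds every component.\<close>

lemma tree_depth_elim_depth_le:
  assumes sym: "sym (parcs G)" and "tree_depth (induced G W) \<le> enat m" "C \<in> comps (parcs G) W"
  shows "elim_depth_le (parcs G) m C"
  using assms(2,3)
proof (induction m arbitrary: W C rule: less_induct)
  case (less m)
  let ?E = "parcs G"
  note rec = tree_depth_rec[of "induced G U" for U, unfolded components_induced[OF sym] pverts_induced]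
  have conn: "elim_depth_le ?E m D" if D: "comps ?E D = {D}" "tree_depth (induced G D) \<le> enat m" for D
  proof -
    have ne: "D \<noteq> {}" using D(1) by (auto simp: comps_def)
    show ?thesis
    proof (cases "card D = 1")
      case True
      then obtain u where u: "D = {u}" by (auto simp: card_Suc_eq numeral_eq_Suc card_1_singleton_iff)
      have "tree_depth (induced G D) = 1" using rec[of D] True by simp
      then have "1 \<le> m" using D(2) by (simp add: one_enat_def)
      then obtain k where "m = Suc k" by (cases m) auto
      then show ?thesis using u by (simp add: comps_def)
    next
      case False
      have "tree_depth (induced G D) =
          1 + (INF x\<in>D. tree_depth (induced (induced G D) (D - {x})))"
        using rec[of D] False D(1) by simp
      also have "\<dots> = 1 + (INF x\<in>D. tree_depth (induced G (D - {x})))"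
        by (simp add: induced_induced)
      finally have td: "1 + (INF x\<in>D. tree_depth (induced G (D - {x}))) \<le> enat m" using D(2) by simp
      then obtain k where k: "m = Suc k"
        by (cases m) (auto simp: zero_enat_def[symmetric])
      have "(INF x\<in>D. tree_depth (induced G (D - {x}))) < enat m"
        using td by (cases "INF x\<in>D. tree_depth (induced G (D - {x}))") (auto simp: one_enat_def)
      then obtain x where x: "x \<in> D" "tree_depth (induced G (D - {x})) < enat m"
        by (auto simp: INF_less_iff)
      then have "tree_depth (induced G (D - {x})) \<le> enat k"
        by (cases "tree_depth (induced G (D - {x}))") (auto simp: k)
      then have "\<forall>C\<in>comps ?E (D - {x}). elim_depth_le ?E k C" using less.IH[of k] k by blast
      then show ?thesis using x k by auto
    qed
  qed
  show ?case
  proof (cases "comps ?E W = {W}")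
    case True
    then show ?thesis using conn less.prems by simp
  next
    case False
    have "card (comps ?E W) \<noteq> 1" "card W \<noteq> 1" using False card_comps(1)[of ?E W] card_comps(2)[of W ?E] by auto
    then have "tree_depth (induced G W) = (SUP D\<in>comps ?E W. tree_depth (induced (induced G W) D))"
      using rec[of W] by simp
    moreover have "tree_depth (induced (induced G W) C) \<le> (SUP D\<in>comps ?E W. tree_depth (induced (induced G W) D))"
      using less.prems(2) by (rule SUP_upper)
    ultimately have "tree_depth (induced G C) \<le> enat m"
      using less.prems(1) induced_induced[OF comps_subset[OF less.prems(2)]] by (metis order_trans)
    then show ?thesis using conn comps_component[OF sym less.prems(2)] by blast
  qed
qed

section \<open>Path lengths and tree depth\<close>

definition path :: "'a rel \<Rightarrow> 'a list \<Rightarrow> bool" where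
  "path E ps \<longleftrightarrow> distinct ps \<and> successively (\<lambda>x y. (x, y) \<in> E) ps"

lemma path_append:
  "path E (xs @ ys) \<Longrightarrow> path E xs \<and> path E ys"
  by (auto simp: path_def successively_append_iff)

lemma path_Cons: "path E (x # xs) \<longleftrightarrow> x \<notin> set xs \<and> path E xs \<and> (xs = [] \<or> (x, hd xs) \<in> E)"
  by (auto simp: path_def successively_Cons)

lemma path_subset_component:
  assumes "path E (x # ps)" "set (x # ps) \<subseteq> W"
  shows "set (x # ps) \<subseteq> component E W x"
  using assms
proof (induction ps arbitrary: x)
  case (Cons y ps)
  then have IH: "set (y # ps) \<subseteq> component E W y" by (auto simp: path_Cons)
  have "(x, y) \<in> E \<inter> W \<times> W" using Cons.prems by (auto simp: path_Cons)
  then have "component E W y \<subseteq> component E W x"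
    by (auto simp: component_def intro: converse_rtrancl_into_rtrancl)
  then show ?case using IH by auto
qed simp

text \<open>Deleting the root cuts a path into at most two paths, each inside one component, so the
  bound on the length goes from at most \<open>2 ^ m - 1\<close> to
  \<open>2 * (2 ^ m - 1) + 1\<close>.\<close>

lemma elim_depth_le_path_length:
  assumes "elim_depth_le E m C" "path E ps" "set ps \<subseteq> C"
  shows "length ps < 2 ^ m"
  using assms
proof (induction m arbitrary: C ps)
  case (Suc m)
  then obtain u where u: "u \<in> C" "\<forall>D\<in>comps E (C - {u}). elim_depth_le E m D" by auto
  have le: "length qs < 2 ^ m" if qs: "path E qs" "set qs \<subseteq> C - {u}" for qs
  proof (cases qs)
    case (Cons x xs)
    then have "set qs \<subseteq> component E (C - {u}) x" "component E (C - {u}) x \<in> comps E (C - {u})"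
      using path_subset_component[of E x xs "C - {u}"] qs by (auto simp: comps_def)
    then show ?thesis using Suc.IH u(2) qs(1) by blast
  qed simp
  show ?case
  proof (cases "u \<in> set ps")
    case True
    then obtain as bs where ps: "ps = as @ u # bs" by (meson split_list)
    have "path E as" "path E (u # bs)" using Suc.prems(2) path_append unfolding ps by blast+
    moreover have "u \<notin> set as" "u \<notin> set bs" using Suc.prems(2) by (auto simp: ps path_def)
    ultimately have "length as < 2 ^ m" "length bs < 2 ^ m"
      using Suc.prems(3) by (auto intro!: le simp: ps path_Cons)
    then show ?thesis by (simp add: ps)
  next
    case False
    then have "length ps < 2 ^ m" using Suc.prems by (intro le) auto
    then show ?thesis by simp
  qed
qed simp

lemma rtrancl_path:
  assumes "(u, v) \<in> (E \<inter> W \<times> W)\<^sup>*" "u \<in> W"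
  shows "\<exists>ps. path E ps \<and> ps \<noteq> [] \<and> hd ps = u \<and> last ps = v \<and> set ps \<subseteq> W"
  using assms(1)
proof (induction rule: rtrancl_induct)
  case base
  then show ?case using assms(2) by (intro exI[of _ "[u]"]) (simp add: path_def)
next
  case (step y z)
  then obtain ps where ps: "path E ps" "ps \<noteq> []" "hd ps = u" "last ps = y" "set ps \<subseteq> W" by blast
  show ?case
  proof (cases "z \<in> set ps")
    case True
    then obtain as bs where s: "ps = (as @ [z]) @ bs" by (metis append_Cons append_Nil append_assoc split_list)
    then have "path E (as @ [z])" using ps(1) path_append by blast
    moreover have "hd (as @ [z]) = u" using ps(3) s by (cases as) auto
    ultimately show ?thesis using ps(5) s by (intro exI[of _ "as @ [z]"]) auto
  next
    case False
    then have "path E (ps @ [z])"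
      using ps step(2) by (auto simp: path_def successively_append_iff)
    then show ?thesis using ps step(2) by (intro exI[of _ "ps @ [z]"]) auto
  qed
qed

lemma path_relpow:
  assumes "path E (u # ps)" "set (u # ps) \<subseteq> W" "length ps \<le> n"
  shows "(u, last (u # ps)) \<in> ((E \<inter> W \<times> W)\<^sup>=) ^^ n"
  using assms
proof (induction ps arbitrary: u n)
  case Nil
  have "(u, u) \<in> ((E \<inter> W \<times> W)\<^sup>=) ^^ n" by (induction n) auto
  then show ?case by simp
next
  case (Cons y ps)
  then obtain k where k: "n = Suc k" "length ps \<le> k" by (cases n) auto
  have "(y, last (y # ps)) \<in> ((E \<inter> W \<times> W)\<^sup>=) ^^ k"
    using Cons k by (intro Cons.IH) (auto simp: path_Cons)
  moreover have "(u, y) \<in> (E \<inter> W \<times> W)\<^sup>=" using Cons.prems by (auto simp: path_Cons)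
  ultimately have "(u, last (y # ps)) \<in> ((E \<inter> W \<times> W)\<^sup>=) ^^ n"
    unfolding k(1) by (rule relpow_Suc_I2[rotated])
  then show ?case by simp
qed

text \<open>Bounded path length turns the transitive closure into a fixed power, which first-order
  logic can express. The reflexive closure makes this power cover all shorter paths.\<close>

lemma component_bounded:
  assumes "\<And>ps. path E ps \<Longrightarrow> set ps \<subseteq> W \<Longrightarrow> length ps \<le> n" "u \<in> W"
  shows "component E W u = {v. (u, v) \<in> ((E \<inter> W \<times> W)\<^sup>=) ^^ n}"
proof (intro set_eqI iffI)
  fix v assume "v \<in> component E W u"
  then obtain ps where ps: "path E ps" "ps \<noteq> []" "hd ps = u" "last ps = v" "set ps \<subseteq> W"
    using rtrancl_path[of u v E W] assms(2) by (auto simp: component_def)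
  then obtain qs where "ps = u # qs" by (cases ps) auto
  then show "v \<in> {v. (u, v) \<in> ((E \<inter> W \<times> W)\<^sup>=) ^^ n}"
    using path_relpow[of E u qs W n] ps assms(1)[of ps] by simp
next
  fix v assume "v \<in> {v. (u, v) \<in> ((E \<inter> W \<times> W)\<^sup>=) ^^ n}"
  then have "(u, v) \<in> ((E \<inter> W \<times> W)\<^sup>=)\<^sup>*" using relpow_imp_rtrancl by blast
  then show "v \<in> component E W u" by (simp add: component_def)
qed

text \<open>A walk to \<open>x\<close> is cut just before its first visit to \<open>x\<close>. This
  finds a neighbour of \<open>x\<close> in the part where \<open>y\<close> remains once
  \<open>x\<close> is deleted.\<close>

lemma first_hit:
  assumes "(y, x) \<in> (E \<inter> W \<times> W)\<^sup>*" "y \<noteq> x" "y \<in> W"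
  shows "\<exists>z. (y, z) \<in> (E \<inter> (W - {x}) \<times> (W - {x}))\<^sup>* \<and> (z, x) \<in> E"
  using assms
proof (induction rule: converse_rtrancl_induct)
  case (step y z)
  show ?case
  proof (cases "z = x")
    case True
    then show ?thesis using step by blast
  next
    case False
    then obtain w where "(z, w) \<in> (E \<inter> (W - {x}) \<times> (W - {x}))\<^sup>*" "(w, x) \<in> E"
      using step by blast
    moreover have "(y, z) \<in> E \<inter> (W - {x}) \<times> (W - {x})" using step False by auto
    ultimately show ?thesis by (meson converse_rtrancl_into_rtrancl)
  qed
qed simp

lemma tree_depth_comps_le:
  assumes sym: "sym (parcs G)" and le: "\<And>D. D \<in> comps (parcs G) W \<Longrightarrow> tree_depth (induced G D) \<le> k"
    and ne: "W \<noteq> {}"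
  shows "tree_depth (induced G W) \<le> k"
proof (cases "comps (parcs G) W = {W}")
  case True
  then show ?thesis using le by simp
next
  case False
  then have "card (comps (parcs G) W) \<noteq> 1" "card W \<noteq> 1" using card_comps(1)[of "parcs G" W] card_comps(2)[of W "parcs G"] by auto
  then have "tree_depth (induced G W) = (SUP D\<in>comps (parcs G) W. tree_depth (induced (induced G W) D))"
    using tree_depth_rec[of "induced G W"] by (simp add: components_induced[OF sym])
  also have "\<dots> \<le> k"
    by (rule SUP_least) (simp add: induced_induced comps_subset le)
  finally show ?thesis .
qed

text \<open>This is depth-first search: after deletion of \<open>x\<close>, each remaining component
  contains a neighbour \<open>z\<close> of \<open>x\<close>. A path from \<open>z\<close> inside it
  can be prolonged by \<open>x\<close>, so the bound for paths starting in \<open>z\<close> is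
  smaller by one.\<close>

lemma tree_depth_path_le:
  assumes sym: "sym (parcs G)" and "x \<in> W"
    and "\<And>ps. path (parcs G) (x # ps) \<Longrightarrow> set ps \<subseteq> component (parcs G) W x \<Longrightarrow> length ps < n"
  shows "tree_depth (induced G (component (parcs G) W x)) \<le> enat n"
  using assms(2,3)
proof (induction n arbitrary: W x)
  case 0
  have "path (parcs G) [x]" by (simp add: path_def)
  then show ?case using 0(2)[of "[]"] by simp
next
  case (Suc n)
  let ?E = "parcs G" and ?C = "component (parcs G) W x"
  have C: "comps ?E ?C = {?C}"
    by (rule comps_component[OF sym, of _ W]) (use Suc.prems(1) in \<open>simp add: comps_def\<close>)
  have xC: "x \<in> ?C" by simp
  show ?case
  proof (cases "card ?C = 1")
    case True
    then show ?thesis by (subst tree_depth_rec) (simp add: one_enat_def)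
  next
    case False
    have td: "tree_depth (induced G (?C - {x})) \<le> enat n"
    proof (rule tree_depth_comps_le[OF sym])
      show "?C - {x} \<noteq> {}" proof
        assume "?C - {x} = {}"
        then have "?C = {x}" using xC by blast
        then show False using False by simp
      qed
    next
      fix D assume D: "D \<in> comps ?E (?C - {x})"
      then obtain y where y: "y \<in> ?C" "y \<noteq> x" "D = component ?E (?C - {x}) y" by (auto simp: comps_def)
      have "x \<in> component ?E ?C y" using component_component(1)[OF Suc.prems(1) y(1)] component_eq[OF sym y(1)] by simp
      then obtain z where z: "(y, z) \<in> (?E \<inter> (?C - {x}) \<times> (?C - {x}))\<^sup>*" "(z, x) \<in> ?E"
        using first_hit[of y x ?E ?C] y by (auto simp: component_def)
      have zD: "z \<in> D" using z(1) y(3) by (simp add: component_def)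
      then have z': "z \<in> ?C - {x}" using comps_subset[OF D] by blast
      have DD: "D = component ?E (?C - {x}) z" using comps_eq[OF sym D zD] .
      show "tree_depth (induced G D) \<le> enat n"
        unfolding DD
      proof (rule Suc.IH[OF z'])
        fix ps assume ps: "path ?E (z # ps)" "set ps \<subseteq> component ?E (?C - {x}) z"
        have sub: "set (z # ps) \<subseteq> ?C - {x}" using ps(2) z' component_subset[OF z', of ?E] by auto
        then have "path ?E (x # z # ps)" using ps(1) symD[OF sym z(2)] by (auto simp: path_Cons)
        then show "length ps < n" using Suc.prems(2)[of "z # ps"] sub by auto
      qed
    qed
    have eq: "tree_depth (induced G ?C) = 1 + (INF v\<in>?C. tree_depth (induced G (?C - {v})))"
      using tree_depth_rec[of "induced G ?C"] False C
      by (simp add: components_induced[OF sym] induced_induced)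
    have "(INF v\<in>?C. tree_depth (induced G (?C - {v}))) \<le> tree_depth (induced G (?C - {x}))"
      using xC by (rule INF_lower)
    then have "(INF v\<in>?C. tree_depth (induced G (?C - {v}))) \<le> enat n" using td by (rule order_trans)
    then have "tree_depth (induced G ?C) \<le> 1 + enat n" unfolding eq by (rule add_left_mono)
    then show ?thesis by (simp add: one_enat_def)
  qed
qed

section \<open>Elimination forests and guarded relations\<close>

text \<open>An elimination forest is given as its prefix-closed set of branches. The empty branch is
  a virtual root that joins the trees, every vertex is the end of exactly one branch, and adjacent
  vertices are comparable, that is, they lie on a common branch.\<close>

locale elimination =
  fixes G :: "'a pair_pre_digraph" and d :: nat and T :: "'a list set"
  assumes nil: "[] \<in> T"
    and prefix: "s @ r \<in> T \<Longrightarrow> s \<in> T"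
    and verts: "v \<in> pverts G \<longleftrightarrow> (\<exists>s. s @ [v] \<in> T)"
    and uniq: "s @ [v] \<in> T \<Longrightarrow> s' @ [v] \<in> T \<Longrightarrow> s = s'"
    and arc: "(u, v) \<in> parcs G \<Longrightarrow> \<exists>s\<in>T. u \<in> set s \<and> v \<in> set s"
    and depth: "s \<in> T \<Longrightarrow> length s \<le> d"
begin

lemma branch_prefix:
  assumes "s \<in> T" "v \<in> set s" "p @ [v] \<in> T"
  shows "\<exists>r. s = p @ v # r"
proof -
  obtain as bs where s: "s = as @ v # bs" using assms(2) by (meson split_list)
  then have "as @ [v] \<in> T" using prefix[of "as @ [v]" bs] assms(1) by simp
  then have "as = p" using uniq assms(3) by blast
  then show ?thesis using s by blast
qed

lemma set_branch: "s \<in> T \<Longrightarrow> set s \<subseteq> pverts G"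
proof
  fix v assume "s \<in> T" "v \<in> set s"
  then obtain as bs where "s = as @ v # bs" by (meson split_list)
  then have "as @ [v] \<in> T" using prefix[of "as @ [v]" bs] \<open>s \<in> T\<close> by simp
  then show "v \<in> pverts G" using verts by blast
qed

lemma distinct_branch: "s \<in> T \<Longrightarrow> distinct s"
proof (induction s rule: rev_induct)
  case (snoc v s)
  have "v \<notin> set s"
  proof
    assume "v \<in> set s"
    then obtain as bs where s: "s = as @ v # bs" by (meson split_list)
    then have "as @ [v] \<in> T" using prefix[of "as @ [v]" "bs @ [v]"] snoc.prems by simp
    then have "as = s" using uniq[OF _ snoc.prems] by blast
    then show False using s by simp
  qed
  then show ?case using snoc prefix by auto
qed simp

text \<open>Take a vertex \<open>v\<close> of the clique whose branch is longest. Every other member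
  \<open>u\<close> shares a branch with \<open>v\<close> and sits on it no later than
  \<open>v\<close>, hence on the branch ending in \<open>v\<close>.\<close>

lemma clique_branch:
  assumes "finite C" "C \<noteq> {}" "C \<subseteq> pverts G"
    and "\<And>u v. u \<in> C \<Longrightarrow> v \<in> C \<Longrightarrow> u \<noteq> v \<Longrightarrow> (u, v) \<in> parcs G"
  shows "\<exists>s\<in>T. C \<subseteq> set s"
proof -
  have "\<forall>v\<in>C. \<exists>s. s @ [v] \<in> T" using assms(3) verts by blast
  then obtain b where b: "\<And>v. v \<in> C \<Longrightarrow> b v @ [v] \<in> T" by metis
  obtain v where v: "v \<in> C" "\<And>u. u \<in> C \<Longrightarrow> length (b u) \<le> length (b v)"
  proof -
    let ?f = "\<lambda>v. length (b v)"
    have "Max (?f ` C) \<in> ?f ` C" using assms(1,2) by (intro Max_in) auto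
    then obtain v where "v \<in> C" "?f v = Max (?f ` C)" by auto
    then show thesis using assms(1) that[of v] by simp
  qed
  have "u \<in> set (b v @ [v])" if u: "u \<in> C" for u
  proof (cases "u = v")
    case False
    then obtain s where s: "s \<in> T" "u \<in> set s" "v \<in> set s"
      using arc[of u v] assms(4)[OF u v(1)] by blast
    obtain r1 r2 where r: "s = b u @ u # r1" "s = b v @ v # r2"
      using branch_prefix[OF s(1,2) b[OF u]] branch_prefix[OF s(1,3) b[OF v(1)]] by blast
    have "u = s ! length (b u)" using r(1) by simp
    also have "\<dots> = (b v @ [v]) ! length (b u)"
      using v(2)[OF u] unfolding r(2) by (auto simp: nth_append)
    finally show ?thesis using v(2)[OF u] nth_mem[of "length (b u)" "b v @ [v]"] by simp
  qed simp
  then show ?thesis using b[OF v(1)] by blast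
qed

end

text \<open>
  A structure interprets the edge relation, the element variables (by singletons) and the
  relation variables.
\<close>

datatype key = KEdge | KElem nat | KRel "nat \<times> nat"

primrec arity :: "key \<Rightarrow> nat" where
  "arity KEdge = 2"
| "arity (KElem x) = 1"
| "arity (KRel p) = snd p"

text \<open>This is guardedness in convenient form: a simple graph is its own Gaifman graph, so the
  entries of a tuple have to be pairwise adjacent or equal.\<close>

definition clique_rel :: "'a pair_pre_digraph \<Rightarrow> nat \<Rightarrow> 'a list set \<Rightarrow> bool" where
  "clique_rel G r R \<longleftrightarrow> (\<forall>t\<in>R. length t = r \<and> set t \<subseteq> pverts G \<and>
     (\<forall>u\<in>set t. \<forall>v\<in>set t. u \<noteq> v \<longrightarrow> (u, v) \<in> parcs G))"

lemma guarded_iff: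
  assumes "simple_graph G"
  shows "R \<subseteq> tuples r (pverts G) \<and> guarded G R \<longleftrightarrow> clique_rel G r R"
proof -
  interpret pair_bidirected_digraph G using assms by (simp add: simple_graph_def)
  have wf: "wf_digraph (with_proj G)" by unfold_locales
  show ?thesis
  proof
    assume "R \<subseteq> tuples r (pverts G) \<and> guarded G R"
    then show "clique_rel G r R"
      unfolding guarded_def gaifman_graph_simple[OF assms] subgraph_def
      by (auto simp: clique_rel_def tuples_def gaifman_rel_def)
  next
    assume R: "clique_rel G r R"
    have "wf_digraph (with_proj (gaifman_rel (pverts G) R))"
      by unfold_locales (use R in \<open>fastforce simp: clique_rel_def gaifman_rel_def\<close>)+
    then show "R \<subseteq> tuples r (pverts G) \<and> guarded G R"
      using R wf unfolding guarded_def gaifman_graph_simple[OF assms] subgraph_def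
      by (auto simp: clique_rel_def tuples_def gaifman_rel_def compatible_def)
  qed
qed

definition structure_on :: "'a pair_pre_digraph \<Rightarrow> (key \<Rightarrow> 'a list set) \<Rightarrow> bool" where
  "structure_on G S \<longleftrightarrow> S KEdge = {[u, v] |u v. (u, v) \<in> parcs G} \<and> (\<forall>k. clique_rel G (arity k) (S k))"

lemma structure_on_upd:
  "structure_on G S \<Longrightarrow> k \<noteq> KEdge \<Longrightarrow> clique_rel G (arity k) R \<Longrightarrow> structure_on G (S(k := R))"
  by (simp add: structure_on_def)

text \<open>
  A tuple is recorded at its last vertex on a branch, so that the labels of the branches
  are independent of each other.
\<close>

definition newidx :: "nat \<Rightarrow> nat \<Rightarrow> nat list set" where
  "newidx n r = {is. set is \<subseteq> {..<n} \<and> (n = 0 \<or> n - 1 \<in> set is) \<and> length is = r}"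

text \<open>Keys outside \<open>K\<close> get the empty set so that finitely many labels arise. The
  empty tuple has only the index list \<open>[]\<close>, which \<open>newidx\<close> admits at
  length 0 alone, so a nullary relation is recorded at the virtual root.\<close>

definition label :: "key set \<Rightarrow> (key \<Rightarrow> 'a list set) \<Rightarrow> 'a list \<Rightarrow> key \<Rightarrow> nat list set" where
  "label K S s k = (if k \<in> K then {is \<in> newidx (length s) (arity k). map ((!) s) is \<in> S k} else {})"

lemma finite_newidx: "finite (newidx n r)"
  by (rule finite_subset[OF _ finite_lists_length_eq[of "{..<n}" r]]) (auto simp: newidx_def)

definition labels :: "key set \<Rightarrow> nat \<Rightarrow> (key \<Rightarrow> nat list set) set" where
  "labels K d = {f. \<forall>k. (k \<in> K \<longrightarrow> f k \<in> Pow (\<Union>k\<in>K. \<Union>n\<le>d. newidx n (arity k))) \<and> (k \<notin> K \<longrightarrow> f k = {})}"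

lemma finite_labels: "finite K \<Longrightarrow> finite (labels K d)"
  unfolding labels_def by (rule finite_set_of_finite_funs) (auto simp: finite_newidx)

lemma label_labels: "length s \<le> d \<Longrightarrow> label K S s \<in> labels K d"
  by (auto simp: labels_def label_def)

context elimination begin

lemma label_ctrees: "(T, label K S) \<in> ctrees (labels K d)"
  using nil depth by (auto simp: ctrees_def label_labels)

lemma tuple_indices:
  assumes "s \<in> T" "set t \<subseteq> set s"
  shows "\<exists>is. set is \<subseteq> {..<length s} \<and> length is = length t \<and> t = map ((!) s) is"
proof -
  have "\<forall>v\<in>set t. \<exists>i<length s. s ! i = v" using assms(2) by (meson in_set_conv_nth subsetD)
  then obtain f where f: "\<And>v. v \<in> set t \<Longrightarrow> f v < length s \<and> s ! f v = v" by metis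
  then have "map ((!) s) (map f t) = t" by (simp add: map_idI)
  then show ?thesis using f by (intro exI[of _ "map f t"]) auto
qed

lemma tuple_branch:
  assumes "clique_rel G r {t}"
  shows "\<exists>s\<in>T. set t \<subseteq> set s"
proof (cases "t = []")
  case False
  then show ?thesis using assms by (intro clique_branch) (auto simp: clique_rel_def)
qed (use nil in auto)

text \<open>The tuple contains the last vertex of \<open>s\<close>, so this vertex lies on
  \<open>s'\<close> and \<open>s\<close> is a prefix of \<open>s'\<close>; the converse holds by
  symmetry. Consequently labels of different branches never speak about the same tuple, and a
  relation can be defined branch by branch.\<close>

lemma tuple_newidx_unique:
  assumes "s \<in> T" "s' \<in> T" "is \<in> newidx (length s) r" "is' \<in> newidx (length s') r"
    and eq: "map ((!) s) is = map ((!) s') is'"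
  shows "s = s'" "is = is'"
proof -
  have ex: "\<exists>w. q = p @ w"
    if p: "p \<in> T" "i \<in> newidx (length p) r" and q: "q \<in> T" "j \<in> newidx (length q) r"
      and e: "map ((!) p) i = map ((!) q) j" for p q i j
  proof (cases "p = []")
    case False
    then have "length p - 1 \<in> set i" using p(2) by (simp add: newidx_def)
    then have "last p \<in> set (map ((!) p) i)" using False by (auto simp: last_conv_nth)
    then have "last p \<in> set q" unfolding e using q(2) by (auto simp: newidx_def)
    moreover have "butlast p @ [last p] \<in> T" using False p(1) by simp
    ultimately obtain w where "q = butlast p @ last p # w" using branch_prefix[OF q(1)] by blast
    then have "q = p @ w" using False by (metis append_butlast_last_id append_Cons append_Nil append_assoc)
    then show ?thesis by blast
  qed simp
  obtain w where w: "s' = s @ w" using ex assms by blast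
  obtain w' where "s = s' @ w'" using ex[of s' is' s "is"] assms by metis
  with w show ss: "s = s'" by simp
  have "inj_on ((!) s) (set is \<union> set is')"
    using distinct_branch[OF assms(1)] assms(3,4) ss
    by (intro inj_onI) (auto simp: newidx_def nth_eq_iff_index_eq subset_iff)
  then show "is = is'" using eq ss by (auto dest: map_inj_on)
qed

end

text \<open>A tuple is recorded at the prefix that ends in its last vertex, so equal labels along
  all prefixes determine every tuple on the branch.\<close>

lemma label_transfer:
  fixes s s' :: "'a list"
  assumes "length s = length s'" "\<And>i. i \<le> length s \<Longrightarrow> label K S (take i s) = label K S' (take i s')"
    and "k \<in> K" "set is \<subseteq> {..<length s}" "length is = arity k"
  shows "map ((!) s) is \<in> S k \<longleftrightarrow> map ((!) s') is \<in> S' k"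
proof -
  \<comment> \<open>The length of this prefix is one more than the largest index; it is 0 for the
    empty tuple.\<close>
  define j where "j = (if is = [] then 0 else Suc (Max (set is)))"
  have lt: "i < j" if "i \<in> set is" for i
    using that by (auto simp: j_def less_Suc_eq_le)
  have j: "j \<le> length s"
    using assms(4) Max_in[of "set is"] by (auto simp: j_def Suc_le_eq)
  have idx: "is \<in> newidx j (arity k)"
    using lt assms(5) Max_in[of "set is"] by (auto simp: newidx_def j_def)
  have take: "map ((!) (take j q)) is = map ((!) q) is" for q :: "'a list"
    using lt by auto
  have "is \<in> label K S (take j s) k \<longleftrightarrow> is \<in> label K S' (take j s') k"
    using assms(2)[OF j] by simp
  moreover have "length (take j s) = j" "length (take j s') = j" using j assms(1) by simp_all
  ultimately show ?thesis
    using idx assms(3) by (simp add: label_def take del: length_take)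
qed

section \<open>Transfer between similar elimination forests\<close>

definition config :: "nat \<Rightarrow> 'a pair_pre_digraph \<Rightarrow> 'a list set \<Rightarrow> (key \<Rightarrow> 'a list set) \<Rightarrow> bool" where
  "config d G T S \<longleftrightarrow> simple_graph G \<and> elimination G d T \<and> structure_on G S"

lemma config_branch:
  assumes "config d G T S" "config d G' T' S'" "0 < t" "sim t d (T, label K S) (T', label K S')" "s \<in> T"
  shows "\<exists>s'\<in>T'. length s' = length s \<and> (\<forall>i\<le>length s'. label K S' (take i s') = label K S (take i s))"
proof (rule sim_branch[OF sim_sym[OF assms(4)] assms(3,5)])
  interpret elimination G d T using assms(1) by (simp add: config_def)
  interpret G': elimination G' d T' using assms(2) by (simp add: config_def)
  show "length s \<le> d" using depth assms(5) .
  show "s \<in> T'" if "s @ r \<in> T'" for s r using G'.prefix that .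
  show "s \<in> T" if "s @ r \<in> T" for s r using prefix that .
  show "[] \<in> T'" by (rule G'.nil)
qed

text \<open>The clique \<open>xs\<close> lies on a branch, and \<open>ys\<close> occupies the same
  positions of a branch with the same labels. All tuples formed from entries of \<open>xs\<close>
  are transferred simultaneously, which settles the atomic formulas.\<close>

lemma config_tuple:
  assumes "config d G T S" "config d G' T' S'" "0 < t" "sim t d (T, label K S) (T', label K S')"
    and "clique_rel G r {xs}"
  shows "\<exists>ys. length ys = length xs \<and> (\<forall>k\<in>K. \<forall>js. set js \<subseteq> {..<length xs} \<and> length js = arity k \<longrightarrow>
     (map ((!) xs) js \<in> S k \<longleftrightarrow> map ((!) ys) js \<in> S' k))"
proof -
  interpret elimination G d T using assms(1) by (simp add: config_def)
  obtain s where s: "s \<in> T" "set xs \<subseteq> set s" using tuple_branch[OF assms(5)] by blast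
  then obtain "is" where i: "set is \<subseteq> {..<length s}" "length is = length xs" "xs = map ((!) s) is"
    using tuple_indices by blast
  obtain s' where s': "s' \<in> T'" "length s' = length s"
      "\<forall>i\<le>length s'. label K S' (take i s') = label K S (take i s)"
    using config_branch[OF assms(1-4) s(1)] by blast
  have "map ((!) xs) js \<in> S k \<longleftrightarrow> map ((!) (map ((!) s') is)) js \<in> S' k"
    if "k \<in> K" "set js \<subseteq> {..<length xs}" "length js = arity k" for k js
  proof -
    have m: "map ((!) (map ((!) q) is)) js = map ((!) q) (map ((!) is) js)" for q :: "'a list"
      using that(2) i(2) by (auto simp: subset_iff)
    have "set (map ((!) is) js) \<subseteq> set is" using that(2) i(2) by (auto simp: subset_iff)
    then have sub: "set (map ((!) is) js) \<subseteq> {..<length s}" using i(1) by blast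
    have "map ((!) s) (map ((!) is) js) \<in> S k \<longleftrightarrow> map ((!) s') (map ((!) is) js) \<in> S' k"
      by (rule label_transfer[where K = K]) (use s' sub that in auto)
    moreover have "map ((!) xs) js = map ((!) s) (map ((!) is) js)" using m[of s] i(3) by simp
    ultimately show ?thesis by (simp only: m)
  qed
  then show ?thesis using i(2) by (intro exI[of _ "map ((!) s') is"]) auto
qed

text \<open>Adding a relation changes one component of the labels, so \<open>sim_expand\<close>
  supplies an answer in terms of labels. What remains is to see that this answer comes from a
  guarded relation.\<close>

lemma config_expand:
  assumes "finite K" "KEdge \<in> K" "k \<in> K" "k \<noteq> KEdge" "0 < t'"
  shows "\<exists>t0. \<forall>t\<ge>t0. \<forall>(G :: 'a pair_pre_digraph) T S G' T' S' R. config d G T S \<and> config d G' T' S' \<and>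
    sim t d (T, label K S) (T', label K S') \<and> clique_rel G (arity k) R \<longrightarrow>
    (\<exists>R'. clique_rel G' (arity k) R' \<and> sim t' d (T, label K (S(k := R))) (T', label K (S'(k := R'))))"
proof -
  define FX where "FX = Pow (\<Union>n\<le>d. newidx n (arity k))"
  have fin: "finite (labels K d)" "finite FX"
    using assms(1) by (auto simp: finite_labels FX_def finite_newidx)
  obtain t0 where t0: "\<forall>t\<ge>t0. \<forall>(T :: 'a list set) L T' L' X. (T, L) \<in> ctrees (labels K d) \<and>
     (T', L') \<in> ctrees (labels K d) \<and> (\<forall>s\<in>T. X s \<in> FX) \<and> sim t d (T, L) (T', L') \<longrightarrow>
     (\<exists>X'. sim t' d (T, \<lambda>s. (L s)(k := X s)) (T', \<lambda>s. (L' s)(k := X' s)))"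
    using sim_expand[OF fin assms(5), of d "\<lambda>l x. l(k := x)"] by blast
  show ?thesis
  proof (intro exI[of _ t0] allI impI, elim conjE)
    fix t :: nat and G :: "'a pair_pre_digraph" and T S G' T' S' R
    assume t: "t0 \<le> t" and G: "config d G T S" and G': "config d G' T' S'"
      and sim: "sim t d (T, label K S) (T', label K S')" and R: "clique_rel G (arity k) R"
    interpret G: elimination G d T using G by (simp add: config_def)
    interpret G': elimination G' d T' using G' by (simp add: config_def)
    define X where "X s = {is \<in> newidx (length s) (arity k). map ((!) s) is \<in> R}" for s
    have "\<forall>s\<in>T. X s \<in> FX" using G.depth by (auto simp: FX_def X_def)
    then obtain X' where X': "sim t' d (T, \<lambda>s. (label K S s)(k := X s)) (T', \<lambda>s. (label K S' s)(k := X' s))"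
      using t0[rule_format, OF t] G.label_ctrees G'.label_ctrees sim by blast
    have lab1: "(\<lambda>s. (label K S s)(k := X s)) = label K (S(k := R))"
      using assms(3) by (auto simp: label_def X_def fun_eq_iff)
    \<comment> \<open>The relation is read off the labels \<open>X'\<close>, which so far are
      arbitrary. That they consist of admissible index lists, and that the tuples are cliques, is
      inherited from a branch of \<open>T\<close> with the same labels.\<close>
    define R' where "R' = {map ((!) s) is |s is. s \<in> T' \<and> is \<in> X' s}"
    have match: "\<exists>s\<in>T. length s = length s' \<and> (\<forall>i\<le>length s. label K (S(k := R)) (take i s) =
        (label K S' (take i s'))(k := X' (take i s')))" if s': "s' \<in> T'" for s'
      by (rule sim_branch[OF X'[unfolded lab1] assms(5) s'])
        (use s' G.prefix G'.prefix G'.depth G.nil in auto)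
    have X'idx: "X' s \<subseteq> newidx (length s) (arity k)" if s': "s \<in> T'" for s
    proof -
      obtain q where q: "q \<in> T" "length q = length s" "\<forall>i\<le>length q. label K (S(k := R)) (take i q) =
        (label K S' (take i s))(k := X' (take i s))" using match[OF s'] by blast
      have "label K (S(k := R)) q k = X' s" using q(2) q(3)[rule_format, of "length q"] by simp
      then show ?thesis using q(2) by (auto simp: label_def split: if_splits)
    qed
    have mem: "map ((!) s) is \<in> R' \<longleftrightarrow> is \<in> X' s" if s: "s \<in> T'" "is \<in> newidx (length s) (arity k)" for s "is"
    proof
      assume "map ((!) s) is \<in> R'"
      then obtain s2 is2 where s2: "s2 \<in> T'" "is2 \<in> X' s2" "map ((!) s) is = map ((!) s2) is2"
        by (auto simp: R'_def)
      have "is2 \<in> newidx (length s2) (arity k)" using X'idx s2(1,2) by blast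
      then have "s = s2" "is = is2" using G'.tuple_newidx_unique[OF s(1) s2(1) s(2) _ s2(3)] by blast+
      then show "is \<in> X' s" using s2(2) by simp
    qed (use s in \<open>auto simp: R'_def\<close>)
    have lab2: "(label K S' s)(k := X' s) = label K (S'(k := R')) s" if "s \<in> T'" for s
    proof
      fix k'
      have "X' s = {is \<in> newidx (length s) (arity k). map ((!) s) is \<in> R'}"
        using mem[OF that] X'idx[OF that] by blast
      then show "((label K S' s)(k := X' s)) k' = label K (S'(k := R')) s k'"
        using assms(3) by (simp add: label_def)
    qed
    have R': "clique_rel G' (arity k) R'"
      unfolding clique_rel_def
    proof (intro ballI)
      fix t assume "t \<in> R'"
      then obtain s "is" where s: "s \<in> T'" "is \<in> X' s" "t = map ((!) s) is" by (auto simp: R'_def)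
      have idx: "is \<in> newidx (length s) (arity k)" using X'idx s(1,2) by blast
      obtain q where q: "q \<in> T" "length q = length s" "\<forall>i\<le>length q. label K (S(k := R)) (take i q) =
        (label K S' (take i s))(k := X' (take i s))" using match[OF s(1)] by blast
      have q2: "label K (S(k := R)) (take i q) = label K (S'(k := R')) (take i s)" if "i \<le> length q" for i
        using q(3) that lab2[of "take i s"] G'.prefix[of "take i s" "drop i s"] s(1) by simp
      have tr: "map ((!) q) js \<in> (S(k := R)) k' \<longleftrightarrow> map ((!) s) js \<in> (S'(k := R')) k'"
        if "k' \<in> K" "set js \<subseteq> {..<length q}" "length js = arity k'" for k' js
        by (rule label_transfer[OF q(2) q2 that])
      have qR: "map ((!) q) is \<in> R"
        using tr[OF assms(3), of "is"] idx q(2) \<open>t \<in> R'\<close> s(3) by (auto simp: newidx_def)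
      have "set t \<subseteq> set s" using idx s(3) by (auto simp: newidx_def)
      then have "set t \<subseteq> pverts G'" using G'.set_branch[OF s(1)] by blast
      moreover have "length t = arity k" using idx s(3) by (simp add: newidx_def)
      \<comment> \<open>On the matching branch \<open>q\<close> the two positions carry distinct
        entries of a tuple of \<open>R\<close>, which are adjacent as \<open>R\<close> is guarded.
        The edge relation is part of the labels, so adjacency comes back to
        \<open>s\<close>.\<close>
      moreover have "(s ! i, s ! j) \<in> parcs G'"
        if ij: "i \<in> set is" "j \<in> set is" and ne: "s ! i \<noteq> s ! j" for i j
      proof -
        have lt: "i < length q" "j < length q" "i \<noteq> j"
          using ij idx q(2) ne by (auto simp: newidx_def)
        then have "q ! i \<noteq> q ! j" using G.distinct_branch[OF q(1)] by (simp add: nth_eq_iff_index_eq)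
        then have "(q ! i, q ! j) \<in> parcs G"
          using R qR ij unfolding clique_rel_def by fastforce
        then have "map ((!) q) [i, j] \<in> S KEdge" using G by (simp add: config_def structure_on_def)
        then have "map ((!) s) [i, j] \<in> S' KEdge"
          using tr[OF assms(2), of "[i, j]"] lt assms(4) by simp
        then show ?thesis using G' by (simp add: config_def structure_on_def)
      qed
      ultimately show "length t = arity k \<and> set t \<subseteq> pverts G' \<and>
          (\<forall>u\<in>set t. \<forall>v\<in>set t. u \<noteq> v \<longrightarrow> (u, v) \<in> parcs G')"
        using s(3) by auto
    qed
    have "sim t' d (T, label K (S(k := R))) (T', label K (S'(k := R')))"
      by (rule sim_sym, rule sim_cong, rule sim_sym, rule X'[unfolded lab1])
        (use lab2 G'.nil G'.prefix in auto)
    then show "\<exists>R'. clique_rel G' (arity k) R' \<and> sim t' d (T, label K (S(k := R))) (T', label K (S'(k := R')))"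
      using R' by blast
  qed
qed

text \<open>\<open>thr q\<close> is the threshold that suffices for \<open>q\<close> further rounds
  of the game. The axiom \<open>expand\<close> is \<open>config_expand\<close> with one threshold
  for all finitely many keys.\<close>

locale expansion =
  fixes d :: nat and K :: "key set" and thr :: "nat \<Rightarrow> nat" and ty :: "'a itself"
  assumes thr_pos: "0 < thr q"
    and KEdge: "KEdge \<in> K"
    and expand: "\<And>k (G :: 'a pair_pre_digraph) T S G' T' S' R. k \<in> K - {KEdge} \<Longrightarrow> config d G T S \<Longrightarrow>
      config d G' T' S' \<Longrightarrow> sim (thr (Suc q)) d (T, label K S) (T', label K S') \<Longrightarrow> clique_rel G (arity k) R \<Longrightarrow>
      \<exists>R'. clique_rel G' (arity k) R' \<and> sim (thr q) d (T, label K (S(k := R))) (T', label K (S'(k := R')))"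

lemma expansion_exists:
  assumes "finite K" "KEdge \<in> K"
  shows "\<exists>thr. expansion TYPE('a) d K thr"
proof -
  define P where "P t t' k \<longleftrightarrow> (\<forall>(G :: 'a pair_pre_digraph) T S G' T' S' R. config d G T S \<and> config d G' T' S' \<and>
    sim t d (T, label K S) (T', label K S') \<and> clique_rel G (arity k) R \<longrightarrow>
    (\<exists>R'. clique_rel G' (arity k) R' \<and> sim t' d (T, label K (S(k := R))) (T', label K (S'(k := R')))))"
    for t t' k
  have step: "\<exists>t>0. \<forall>k\<in>K - {KEdge}. P t t' k" if "0 < t'" for t'
  proof -
    have "\<forall>k\<in>K - {KEdge}. \<exists>t0. \<forall>t\<ge>t0. P t t' k"
    proof
      fix k assume "k \<in> K - {KEdge}"
      then show "\<exists>t0. \<forall>t\<ge>t0. P t t' k" using that unfolding P_def by (intro config_expand assms) auto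
    qed
    then obtain f where f: "\<forall>k\<in>K - {KEdge}. \<forall>t\<ge>f k. P t t' k" using bchoice by metis
    \<comment> \<open>The element 1 keeps the maximum defined and positive when \<open>KEdge\<close>
      is the only key.\<close>
    define t where "t = Max (insert 1 (f ` (K - {KEdge})))"
    have "finite (insert 1 (f ` (K - {KEdge})))" using assms(1) by simp
    then have "1 \<le> t" "\<forall>k\<in>K - {KEdge}. f k \<le> t" unfolding t_def by (auto intro!: Max_ge)
    then show ?thesis using f by (intro exI[of _ t]) auto
  qed
  define thr where "thr = rec_nat 1 (\<lambda>_ t'. SOME t. 0 < t \<and> (\<forall>k\<in>K - {KEdge}. P t t' k))"
  have "0 < thr q \<and> (\<forall>k\<in>K - {KEdge}. P (thr (Suc q)) (thr q) k) \<and> 0 < thr (Suc q)" for q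
  proof (induction q)
    case 0
    show ?case using someI_ex[OF step[of 1]] by (simp add: thr_def)
  next
    case (Suc q)
    have "thr (Suc (Suc q)) = (SOME t. 0 < t \<and> (\<forall>k\<in>K - {KEdge}. P t (thr (Suc q)) k))"
      by (simp add: thr_def)
    then show ?case using someI_ex[OF step[of "thr (Suc q)"]] Suc by simp
  qed
  then have "expansion TYPE('a) d K thr" using assms(2) unfolding P_def by unfold_locales blast+
  then show ?thesis by blast
qed

section \<open>Preservation of second-order formulas\<close>

primrec so_keys :: "so \<Rightarrow> key set" where
  "so_keys (SOEq x y) = {KElem x, KElem y}"
| "so_keys (SOEdge x y) = {KElem x, KElem y}"
| "so_keys (SORel X xs) = insert (KRel (X, length xs)) (KElem ` set xs)"
| "so_keys (SONot \<phi>) = so_keys \<phi>"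
| "so_keys (SOAnd \<phi> \<psi>) = so_keys \<phi> \<union> so_keys \<psi>"
| "so_keys (SOEx x \<phi>) = insert (KElem x) (so_keys \<phi>)"
| "so_keys (SOExRel X r \<phi>) = insert (KRel (X, r)) (so_keys \<phi>)"

primrec so_rank :: "so \<Rightarrow> nat" where
  "so_rank (SOEq x y) = 0"
| "so_rank (SOEdge x y) = 0"
| "so_rank (SORel X xs) = 0"
| "so_rank (SONot \<phi>) = so_rank \<phi>"
| "so_rank (SOAnd \<phi> \<psi>) = max (so_rank \<phi>) (so_rank \<psi>)"
| "so_rank (SOEx x \<phi>) = Suc (so_rank \<phi>)"
| "so_rank (SOExRel X r \<phi>) = Suc (so_rank \<phi>)"

lemma finite_so_keys: "finite (so_keys \<phi>)"
  by (induction \<phi>) auto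

definition agrees :: "(key \<Rightarrow> 'a list set) \<Rightarrow> (nat \<Rightarrow> 'a) \<Rightarrow> (nat \<times> nat \<Rightarrow> 'a list set) \<Rightarrow> so \<Rightarrow> bool" where
  "agrees S \<sigma> \<rho> \<phi> \<longleftrightarrow> (\<forall>x\<in>so_free \<phi>. S (KElem x) = {[\<sigma> x]}) \<and> (\<forall>p\<in>so_free_rel \<phi>. S (KRel p) = \<rho> p)"

lemma clique_rel_singleton: "a \<in> pverts G \<Longrightarrow> clique_rel G (Suc 0) {[a]}"
  by (auto simp: clique_rel_def)

lemma config_clique: "config d G T S \<Longrightarrow> t \<in> S k \<Longrightarrow> clique_rel G (arity k) {t}"
  by (auto simp: config_def structure_on_def clique_rel_def)

context expansion begin

lemma config_upd: "config d G T S \<Longrightarrow> k \<noteq> KEdge \<Longrightarrow> clique_rel G (arity k) R \<Longrightarrow> config d G T (S(k := R))"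
  by (simp add: config_def structure_on_upd)

text \<open>
  The answer to a singleton is a singleton: otherwise the spare unary relation variable could
  separate two of its elements.
\<close>

lemma expand_element:
  fixes G G' :: "'a pair_pre_digraph"
  assumes "KElem x \<in> K" "x \<noteq> z" and fresh: "KElem z \<in> K" and G: "config d G T S" and G': "config d G' T' S'"
    and sim: "sim (thr (Suc (Suc q))) d (T, label K S) (T', label K S')" and a: "a \<in> pverts G"
  shows "\<exists>a'\<in>pverts G'. sim (thr (Suc q)) d (T, label K (S(KElem x := {[a]}))) (T', label K (S'(KElem x := {[a']})))"
proof -
  let ?S = "S(KElem x := {[a]})"
  have ca: "clique_rel G (arity (KElem x)) {[a]}" using clique_rel_singleton[OF a] by simp
  obtain R' where R': "clique_rel G' (arity (KElem x)) R'"
    and sim1: "sim (thr (Suc q)) d (T, label K ?S) (T', label K (S'(KElem x := R')))"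
    using expand[OF _ G G' sim ca] assms(1) by auto
  let ?S' = "S'(KElem x := R')"
  have G1: "config d G T ?S" and G1': "config d G' T' ?S'"
    using config_upd[OF G _ ca] config_upd[OF G' _ R'] by simp_all
  obtain ys where ys: "length ys = length [a]" "\<forall>k\<in>K. \<forall>js. set js \<subseteq> {..<length [a]} \<and> length js = arity k \<longrightarrow>
     (map ((!) [a]) js \<in> ?S k \<longleftrightarrow> map ((!) ys) js \<in> ?S' k)"
    using config_tuple[OF G1 G1' thr_pos sim1 clique_rel_singleton[OF a]] by blast
  then have "[ys ! 0] \<in> R'" using assms(1) ys(2)[rule_format, of "KElem x" "[0]"] by simp
  then obtain a' where a': "[a'] \<in> R'" by blast
  have a'V: "a' \<in> pverts G'" using R' a' by (auto simp: clique_rel_def)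
  have ca': "clique_rel G' (arity (KElem z)) {[a']}" using clique_rel_singleton[OF a'V] by simp
  obtain Q where Q: "clique_rel G (arity (KElem z)) Q"
    and sim2: "sim (thr q) d (T', label K (?S'(KElem z := {[a']}))) (T, label K (?S(KElem z := Q)))"
    using expand[OF _ G1' G1 sim_sym[OF sim1] ca'] fresh by auto
  have G2: "config d G T (?S(KElem z := Q))" and G2': "config d G' T' (?S'(KElem z := {[a']}))"
    using config_upd[OF G1 _ Q] config_upd[OF G1' _ ca'] by simp_all
  \<comment> \<open>The roles of the two structures are swapped, and \<open>z\<close> marks
    \<open>a'\<close>. For every \<open>[b]\<close> in \<open>R'\<close> the partner of
    \<open>b\<close> has to lie in the value of \<open>x\<close>, hence is \<open>a\<close>; so
    whether \<open>[a]\<close> is in \<open>Q\<close> would decide \<open>b = a'\<close> for all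
    such \<open>b\<close> at once.\<close>
  have transfer: "[b] \<in> R' \<Longrightarrow> [a] \<in> Q \<longleftrightarrow> b = a'" for b
  proof -
    assume b: "[b] \<in> R'"
    then have bV: "b \<in> pverts G'" using R' by (auto simp: clique_rel_def)
    obtain ys where ys: "length ys = length [b]" "\<forall>k\<in>K. \<forall>js. set js \<subseteq> {..<length [b]} \<and> length js = arity k \<longrightarrow>
       (map ((!) [b]) js \<in> (?S'(KElem z := {[a']})) k \<longleftrightarrow> map ((!) ys) js \<in> (?S(KElem z := Q)) k)"
      using config_tuple[OF G2' G2 thr_pos sim2 clique_rel_singleton[OF bV]] by blast
    have "ys ! 0 = a" using ys(2)[rule_format, of "KElem x" "[0]"] assms(1,2) b by simp
    moreover have "[ys ! 0] \<in> Q \<longleftrightarrow> b = a'" using ys(2)[rule_format, of "KElem z" "[0]"] fresh by simp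
    ultimately show "[a] \<in> Q \<longleftrightarrow> b = a'" by simp
  qed
  have "R' = {[a']}"
  proof
    show "R' \<subseteq> {[a']}"
    proof
      fix t assume t: "t \<in> R'"
      then have "length t = 1" using R' by (simp add: clique_rel_def)
      then obtain b where "t = [b]" by (auto simp: length_Suc_conv)
      then show "t \<in> {[a']}" using transfer[of b] transfer[OF a'] t by simp
    qed
  qed (use a' in simp)
  then show ?thesis using sim1 a'V by auto
qed

text \<open>The index of the threshold exceeds the rank by one because the answer to an element
  needs an extra round with the spare variable \<open>z\<close>. One implication suffices:
  similarity is symmetric, and negation swaps the two sides.\<close>

lemma gso_transfer:
  fixes G G' :: "'a pair_pre_digraph"
  assumes fresh: "KElem z \<in> K"
    and "simple_graph G" "simple_graph G'"
    and "config d G T S" "config d G' T' S'"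
    and "sim (thr (Suc q)) d (T, label K S) (T', label K S')"
    and "so_keys \<phi> \<subseteq> K - {KElem z}" "so_rank \<phi> \<le> q"
    and "agrees S \<sigma> \<rho> \<phi>" "agrees S' \<sigma>' \<rho>' \<phi>" "gso_sat G \<sigma> \<rho> \<phi>"
  shows "gso_sat G' \<sigma>' \<rho>' \<phi>"
  using assms(2-)
proof (induction \<phi> arbitrary: G G' T T' S S' \<sigma> \<sigma>' \<rho> \<rho>' q)
  case (SOEq x y)
  have "[\<sigma> x] \<in> S (KElem x)" using SOEq.prems(8) by (simp add: agrees_def)
  then have "clique_rel G (arity (KElem x)) {[\<sigma> x]}" by (rule config_clique[OF SOEq.prems(3)])
  then obtain ys where ys: "\<forall>k\<in>K. \<forall>js. set js \<subseteq> {..<length [\<sigma> x]} \<and> length js = arity k \<longrightarrow>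
     (map ((!) [\<sigma> x]) js \<in> S k \<longleftrightarrow> map ((!) ys) js \<in> S' k)"
    using config_tuple[OF SOEq.prems(3,4) thr_pos SOEq.prems(5)] by blast
  have "ys ! 0 = \<sigma>' x" "ys ! 0 = \<sigma>' y"
    using ys[rule_format, of "KElem x" "[0]"] ys[rule_format, of "KElem y" "[0]"] SOEq.prems(6,8,9,10)
    by (auto simp: agrees_def)
  then show ?case by simp
next
  case (SOEdge x y)
  have e: "(\<sigma> x, \<sigma> y) \<in> parcs G" using SOEdge.prems(10) by simp
  then have "[\<sigma> x, \<sigma> y] \<in> S KEdge" using SOEdge.prems(3) by (simp add: config_def structure_on_def)
  then have "clique_rel G (arity KEdge) {[\<sigma> x, \<sigma> y]}" by (rule config_clique[OF SOEdge.prems(3)])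
  then obtain ys where ys: "\<forall>k\<in>K. \<forall>js. set js \<subseteq> {..<length [\<sigma> x, \<sigma> y]} \<and> length js = arity k \<longrightarrow>
     (map ((!) [\<sigma> x, \<sigma> y]) js \<in> S k \<longleftrightarrow> map ((!) ys) js \<in> S' k)"
    using config_tuple[OF SOEdge.prems(3,4) thr_pos SOEdge.prems(5)] by blast
  have "ys ! 0 = \<sigma>' x" "ys ! 1 = \<sigma>' y"
    using ys[rule_format, of "KElem x" "[0]"] ys[rule_format, of "KElem y" "[1]"] SOEdge.prems(6,8,9)
    by (auto simp: agrees_def)
  moreover have "[ys ! 0, ys ! 1] \<in> S' KEdge"
    using ys[rule_format, of KEdge "[0, 1]"] e SOEdge.prems(3) KEdge
    by (simp add: config_def structure_on_def)
  ultimately show ?case using SOEdge.prems(4) by (simp add: config_def structure_on_def)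
next
  case (SORel X xs)
  let ?k = "KRel (X, length xs)"
  have in_S: "map \<sigma> xs \<in> S ?k" using SORel.prems(8,10) by (simp add: agrees_def)
  then have "clique_rel G (arity ?k) {map \<sigma> xs}" by (rule config_clique[OF SORel.prems(3)])
  then obtain ys where ys: "length ys = length (map \<sigma> xs)"
    "\<forall>k\<in>K. \<forall>js. set js \<subseteq> {..<length (map \<sigma> xs)} \<and> length js = arity k \<longrightarrow>
     (map ((!) (map \<sigma> xs)) js \<in> S k \<longleftrightarrow> map ((!) ys) js \<in> S' k)"
    using config_tuple[OF SORel.prems(3,4) thr_pos SORel.prems(5)] by blast
  have "ys ! i = \<sigma>' (xs ! i)" if "i < length xs" for i
  proof -
    have "KElem (xs ! i) \<in> so_keys (SORel X xs)" using that by simp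
    then have "KElem (xs ! i) \<in> K" using SORel.prems(6) by blast
    then show ?thesis
      using ys(2)[rule_format, of "KElem (xs ! i)" "[i]"] that SORel.prems(6,8,9) by (auto simp: agrees_def)
  qed
  then have "ys = map \<sigma>' xs" using ys(1) by (intro nth_equalityI) auto
  moreover have "map ((!) ys) [0..<length xs] = ys" using ys(1) by (metis length_map map_nth)
  moreover have "map ((!) (map \<sigma> xs)) [0..<length xs] = map \<sigma> xs" by (metis length_map map_nth)
  ultimately have "map \<sigma>' xs \<in> S' ?k"
    using ys(2)[rule_format, of ?k "[0..<length xs]"] SORel.prems(6) in_S by (auto simp: atLeast0LessThan)
  then show ?case using SORel.prems(9) by (simp add: agrees_def)
next
  case (SONot \<phi>)
  have "gso_sat G \<sigma> \<rho> \<phi>" if "gso_sat G' \<sigma>' \<rho>' \<phi>"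
    using SONot.IH[OF SONot.prems(2,1,4,3) sim_sym[OF SONot.prems(5)] _ _ _ _ that] SONot.prems(6-9)
    by (auto simp: agrees_def)
  then show ?case using SONot.prems(10) by auto
next
  case (SOAnd \<phi> \<psi>)
  have "gso_sat G' \<sigma>' \<rho>' \<phi>"
    by (rule SOAnd.IH(1)[OF SOAnd.prems(1-5)]) (use SOAnd.prems(6-10) in \<open>auto simp: agrees_def\<close>)
  moreover have "gso_sat G' \<sigma>' \<rho>' \<psi>"
    by (rule SOAnd.IH(2)[OF SOAnd.prems(1-5)]) (use SOAnd.prems(6-10) in \<open>auto simp: agrees_def\<close>)
  ultimately show ?case by simp
next
  case (SOEx x \<phi>)
  then obtain q' where q: "q = Suc q'" by (cases q) auto
  obtain a where a: "a \<in> pverts G" "gso_sat G (\<sigma>(x := a)) \<rho> \<phi>" using SOEx.prems(10) by auto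
  have x: "KElem x \<in> K" "x \<noteq> z" using SOEx.prems(6) by auto
  obtain a' where a': "a' \<in> pverts G'"
    "sim (thr (Suc q')) d (T, label K (S(KElem x := {[a]}))) (T', label K (S'(KElem x := {[a']})))"
    using expand_element[OF x fresh SOEx.prems(3,4) _ a(1)] SOEx.prems(5) unfolding q by blast
  have "config d G T (S(KElem x := {[a]}))" "config d G' T' (S'(KElem x := {[a']}))"
    by (auto intro!: config_upd SOEx.prems(3,4) clique_rel_singleton a(1) a'(1))
  then have "gso_sat G' (\<sigma>'(x := a')) \<rho>' \<phi>"
    by (rule SOEx.IH[OF SOEx.prems(1,2) _ _ a'(2)])
      (use SOEx.prems(6-9) q a(2) in \<open>auto simp: agrees_def\<close>)
  then show ?case using a'(1) by auto
next
  case (SOExRel X r \<phi>)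
  let ?k = "KRel (X, r)"
  obtain q' where q: "q = Suc q'" using SOExRel.prems(7) by (cases q) auto
  obtain R where R: "R \<subseteq> tuples r (pverts G)" "guarded G R" "gso_sat G \<sigma> (\<rho>((X, r) := R)) \<phi>"
    using SOExRel.prems(10) by auto
  then have cR: "clique_rel G (arity ?k) R" using guarded_iff[OF SOExRel.prems(1)] by auto
  obtain R' where R': "clique_rel G' (arity ?k) R'"
    "sim (thr (Suc q')) d (T, label K (S(?k := R))) (T', label K (S'(?k := R')))"
    using expand[OF _ SOExRel.prems(3,4) _ cR] SOExRel.prems(5,6) unfolding q by auto
  have "config d G T (S(?k := R))" "config d G' T' (S'(?k := R'))"
    using config_upd[OF SOExRel.prems(3) _ cR] config_upd[OF SOExRel.prems(4) _ R'(1)] by simp_all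
  then have "gso_sat G' \<sigma>' (\<rho>'((X, r) := R')) \<phi>"
    by (rule SOExRel.IH[OF SOExRel.prems(1,2) _ _ R'(2)])
      (use SOExRel.prems(6-9) q R(3) in \<open>auto simp: agrees_def\<close>)
  moreover have "R' \<subseteq> tuples r (pverts G') \<and> guarded G' R'"
    using R'(1) guarded_iff[OF SOExRel.prems(2)] by simp
  ultimately show ?case by auto
qed

end

definition edge_structure :: "'a pair_pre_digraph \<Rightarrow> key \<Rightarrow> 'a list set" where
  "edge_structure G k = (if k = KEdge then {[u, v] |u v. (u, v) \<in> parcs G} else {})"

lemma structure_on_edge:
  assumes "simple_graph G"
  shows "structure_on G (edge_structure G)"
proof -
  interpret pair_bidirected_digraph G using assms by (simp add: simple_graph_def)
  have "(v, u) \<in> parcs G" if "(u, v) \<in> parcs G" for u v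
    using graph_symmetric that by simp
  then show ?thesis
    using in_arcsD1 in_arcsD2 by (fastforce simp: structure_on_def edge_structure_def clique_rel_def)
qed

lemma gso_models_transfer:
  fixes \<phi> :: so and d :: nat
  assumes "so_free \<phi> = {}" "so_free_rel \<phi> = {}"
  shows "\<exists>t>0. \<exists>K. finite K \<and> (\<forall>(G :: 'a pair_pre_digraph) T G' T'. simple_graph G \<and> simple_graph G' \<and>
    elimination G d T \<and> elimination G' d T' \<and>
    sim t d (T, label K (edge_structure G)) (T', label K (edge_structure G')) \<longrightarrow> gso_models G \<phi> \<longrightarrow> gso_models G' \<phi>)"
proof -
  have "\<exists>z. KElem z \<notin> so_keys \<phi>"
  proof (rule ccontr)
    assume "\<nexists>z. KElem z \<notin> so_keys \<phi>"
    then have "range KElem \<subseteq> so_keys \<phi>" by blast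
    then have "finite (range KElem)" using finite_so_keys finite_subset by blast
    then show False using finite_imageD[of KElem UNIV] by (simp add: inj_def)
  qed
  then obtain z where z: "KElem z \<notin> so_keys \<phi>" by blast
  define K where "K = insert KEdge (insert (KElem z) (so_keys \<phi>))"
  have K: "finite K" "KEdge \<in> K" by (simp_all add: K_def finite_so_keys)
  obtain thr where "expansion TYPE('a) d K thr" using expansion_exists[OF K] by blast
  then interpret expansion d K thr "TYPE('a)" .
  have fresh: "KElem z \<in> K" by (simp add: K_def)
  have "gso_models G' \<phi>"
    if G: "simple_graph G" "elimination G d T" and G': "simple_graph G'" "elimination G' d T'"
      and sim: "sim (thr (Suc (so_rank \<phi>))) d (T, label K (edge_structure G)) (T', label K (edge_structure G'))"
      and m: "gso_models G \<phi>" for G G' :: "'a pair_pre_digraph" and T T'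
    unfolding gso_models_def
  proof (intro allI impI)
    fix \<sigma>' :: "nat \<Rightarrow> 'a" and \<rho>'
    obtain v where "v \<in> pverts G" using G(1) by (auto simp: simple_graph_def)
    then have "gso_sat G (\<lambda>_. v) (\<lambda>_. {}) \<phi>" using m by (auto simp: gso_models_def)
    moreover have "config d G T (edge_structure G)" "config d G' T' (edge_structure G')"
      using G G' by (auto simp: config_def structure_on_edge)
    ultimately show "gso_sat G' \<sigma>' \<rho>' \<phi>"
      by (intro gso_transfer[OF fresh G(1) G'(1) _ _ sim]) (use z assms in \<open>auto simp: K_def agrees_def\<close>)
  qed
  then show ?thesis
    using K(1) thr_pos by (intro exI[of _ "thr (Suc (so_rank \<phi>))"] conjI exI[of _ K]) blast+
qed

section \<open>Elimination forests in first-order logic\<close>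

locale fo_class =
  fixes \<C> :: "'a pair_pre_digraph set" and N :: nat
  assumes simple: "G \<in> \<C> \<Longrightarrow> simple_graph G"
    and short: "G \<in> \<C> \<Longrightarrow> path (parcs G) ps \<Longrightarrow> set ps \<subseteq> pverts G \<Longrightarrow> length ps \<le> N"
begin

text \<open>Formulas are hidden behind the property that they define on members of the class, so
  closure under connectives replaces writing them out. Equivalence is demanded only for assignments
  into the universe.\<close>

definition fodef :: "nat set \<Rightarrow> ('a pair_pre_digraph \<Rightarrow> (nat \<Rightarrow> 'a) \<Rightarrow> bool) \<Rightarrow> bool" where
  "fodef A P \<longleftrightarrow> (\<exists>\<phi>. fo_free \<phi> \<subseteq> A \<and>
     (\<forall>G\<in>\<C>. \<forall>\<sigma>. range \<sigma> \<subseteq> pverts G \<longrightarrow> (fo_sat G \<sigma> \<phi> \<longleftrightarrow> P G \<sigma>)))"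

lemma fodef_cong:
  assumes "fodef A P" "\<And>G \<sigma>. G \<in> \<C> \<Longrightarrow> range \<sigma> \<subseteq> pverts G \<Longrightarrow> P G \<sigma> \<longleftrightarrow> Q G \<sigma>"
  shows "fodef A Q"
  using assms unfolding fodef_def by blast

lemma fodef_mono: "fodef A P \<Longrightarrow> A \<subseteq> B \<Longrightarrow> fodef B P"
  unfolding fodef_def by blast

lemma fodef_eq: "x \<in> A \<Longrightarrow> y \<in> A \<Longrightarrow> fodef A (\<lambda>G \<sigma>. \<sigma> x = \<sigma> y)"
  unfolding fodef_def by (intro exI[of _ "FOEq x y"]) auto

lemma fodef_edge: "x \<in> A \<Longrightarrow> y \<in> A \<Longrightarrow> fodef A (\<lambda>G \<sigma>. (\<sigma> x, \<sigma> y) \<in> parcs G)"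
  unfolding fodef_def by (intro exI[of _ "FOEdge x y"]) auto

lemma fodef_not: "fodef A P \<Longrightarrow> fodef A (\<lambda>G \<sigma>. \<not> P G \<sigma>)"
  unfolding fodef_def by (metis fo_free.simps(3) fo_sat.simps(3))

lemma fodef_conj:
  assumes "fodef A P" "fodef A Q"
  shows "fodef A (\<lambda>G \<sigma>. P G \<sigma> \<and> Q G \<sigma>)"
proof -
  from assms obtain \<phi> \<psi> where
    "fo_free \<phi> \<subseteq> A" "\<forall>G\<in>\<C>. \<forall>\<sigma>. range \<sigma> \<subseteq> pverts G \<longrightarrow> (fo_sat G \<sigma> \<phi> \<longleftrightarrow> P G \<sigma>)"
    "fo_free \<psi> \<subseteq> A" "\<forall>G\<in>\<C>. \<forall>\<sigma>. range \<sigma> \<subseteq> pverts G \<longrightarrow> (fo_sat G \<sigma> \<psi> \<longleftrightarrow> Q G \<sigma>)"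
    unfolding fodef_def by blast
  then show ?thesis unfolding fodef_def by (intro exI[of _ "FOAnd \<phi> \<psi>"]) auto
qed

lemma fodef_disj: "fodef A P \<Longrightarrow> fodef A Q \<Longrightarrow> fodef A (\<lambda>G \<sigma>. P G \<sigma> \<or> Q G \<sigma>)"
  using fodef_not[OF fodef_conj[OF fodef_not fodef_not]] by (rule fodef_cong) auto

lemma fodef_imp: "fodef A P \<Longrightarrow> fodef A Q \<Longrightarrow> fodef A (\<lambda>G \<sigma>. P G \<sigma> \<longrightarrow> Q G \<sigma>)"
  unfolding imp_conv_disj by (intro fodef_disj fodef_not)

lemma fodef_iff: "fodef A P \<Longrightarrow> fodef A Q \<Longrightarrow> fodef A (\<lambda>G \<sigma>. P G \<sigma> \<longleftrightarrow> Q G \<sigma>)"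
  unfolding iff_conv_conj_imp by (intro fodef_conj fodef_imp)

lemma fodef_const: "fodef A (\<lambda>G \<sigma>. b)"
proof -
  have "fodef A (\<lambda>G \<sigma>. True)"
    unfolding fodef_def
    \<comment> \<open>Since \<open>A\<close> may be empty, truth needs a sentence without free
      variables; this one holds because universes are nonempty.\<close>
    by (intro exI[of _ "FOEx 0 (FOEq 0 0)"]) (auto simp: ex_in_conv simple_graph_def dest: simple)
  then show ?thesis using fodef_not[of A "\<lambda>G \<sigma>. True"] by (cases b) simp_all
qed

lemma fodef_ball:
  assumes "finite I" "\<And>i. i \<in> I \<Longrightarrow> fodef A (P i)"
  shows "fodef A (\<lambda>G \<sigma>. \<forall>i\<in>I. P i G \<sigma>)"
  using assms
proof (induction I)
  case (insert i I)
  then show ?case using fodef_conj[of A "P i" "\<lambda>G \<sigma>. \<forall>i\<in>I. P i G \<sigma>"] by simp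
qed (simp add: fodef_const)

lemma fodef_bex:
  assumes "finite I" "\<And>i. i \<in> I \<Longrightarrow> fodef A (P i)"
  shows "fodef A (\<lambda>G \<sigma>. \<exists>i\<in>I. P i G \<sigma>)"
  using fodef_not[OF fodef_ball[OF assms(1) fodef_not[OF assms(2)]]] by (rule fodef_cong) auto

lemma fodef_ex: "fodef (insert u A) P \<Longrightarrow> fodef A (\<lambda>G \<sigma>. \<exists>a\<in>pverts G. P G (\<sigma>(u := a)))"
  unfolding fodef_def
proof (elim exE conjE)
  fix \<phi>
  assume f: "fo_free \<phi> \<subseteq> insert u A"
    and \<phi>: "\<forall>G\<in>\<C>. \<forall>\<sigma>. range \<sigma> \<subseteq> pverts G \<longrightarrow> (fo_sat G \<sigma> \<phi> \<longleftrightarrow> P G \<sigma>)"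
  have "range (\<sigma>(u := a)) \<subseteq> pverts G" if "range \<sigma> \<subseteq> pverts G" "a \<in> pverts G" for \<sigma> a and G :: "'a pair_pre_digraph"
    using that by auto
  then show "\<exists>\<phi>. fo_free \<phi> \<subseteq> A \<and> (\<forall>G\<in>\<C>. \<forall>\<sigma>. range \<sigma> \<subseteq> pverts G \<longrightarrow>
      fo_sat G \<sigma> \<phi> = (\<exists>a\<in>pverts G. P G (\<sigma>(u := a))))"
    using f \<phi> by (intro exI[of _ "FOEx u \<phi>"]) auto
qed

text \<open>Quantifying over all choices of the variables makes substitution unnecessary.\<close>

definition fodef1 :: "nat \<Rightarrow> ('a pair_pre_digraph \<Rightarrow> 'a list \<Rightarrow> 'a \<Rightarrow> bool) \<Rightarrow> bool" where
  "fodef1 n P \<longleftrightarrow> (\<forall>xs u. length xs = n \<longrightarrow> fodef (insert u (set xs)) (\<lambda>G \<sigma>. P G (map \<sigma> xs) (\<sigma> u)))"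

definition fodef2 :: "nat \<Rightarrow> ('a pair_pre_digraph \<Rightarrow> 'a list \<Rightarrow> 'a \<Rightarrow> 'a \<Rightarrow> bool) \<Rightarrow> bool" where
  "fodef2 n P \<longleftrightarrow> (\<forall>xs u v. length xs = n \<longrightarrow>
     fodef (insert u (insert v (set xs))) (\<lambda>G \<sigma>. P G (map \<sigma> xs) (\<sigma> u) (\<sigma> v)))"

lemma fodef1_fodef: "fodef1 n P \<Longrightarrow> length xs = n \<Longrightarrow> u \<in> A \<Longrightarrow> set xs \<subseteq> A \<Longrightarrow>
    fodef A (\<lambda>G \<sigma>. P G (map \<sigma> xs) (\<sigma> u))"
  by (rule fodef_mono[of "insert u (set xs)"]) (auto simp: fodef1_def)

lemma fodef2_fodef: "fodef2 n P \<Longrightarrow> length xs = n \<Longrightarrow> u \<in> A \<Longrightarrow> v \<in> A \<Longrightarrow> set xs \<subseteq> A \<Longrightarrow>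
    fodef A (\<lambda>G \<sigma>. P G (map \<sigma> xs) (\<sigma> u) (\<sigma> v))"
  by (rule fodef_mono[of "insert u (insert v (set xs))"]) (auto simp: fodef2_def)

text \<open>The value of the quantified vertex is passed as a separate argument of \<open>P\<close>,
  so that any variable outside \<open>A\<close> may carry it; \<open>indep\<close> says that
  overwriting this variable changes nothing else.\<close>

lemma fodef_ex_fresh:
  assumes "finite A" and P: "\<And>u. u \<notin> A \<Longrightarrow> fodef (insert u A) (\<lambda>G \<sigma>. P G \<sigma> (\<sigma> u))"
    and indep: "\<And>G \<sigma> u a. u \<notin> A \<Longrightarrow> P G (\<sigma>(u := a)) a \<longleftrightarrow> P G \<sigma> a"
  shows "fodef A (\<lambda>G \<sigma>. \<exists>a\<in>pverts G. P G \<sigma> a)"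
proof -
  obtain u where u: "u \<notin> A" using ex_new_if_finite[OF infinite_UNIV_nat assms(1)] by blast
  show ?thesis using fodef_ex[OF P[OF u]] by (rule fodef_cong) (simp add: indep[OF u])
qed

lemma fodef_ex1:
  assumes "fodef1 n P" "length xs = n"
  shows "fodef (set xs) (\<lambda>G \<sigma>. \<exists>a\<in>pverts G. P G (map \<sigma> xs) a)"
  by (rule fodef_ex_fresh) (use assms in \<open>auto intro: fodef1_fodef\<close>)

lemma fodef1_ex:
  assumes "fodef2 n P"
  shows "fodef1 n (\<lambda>G as x. \<exists>a\<in>pverts G. P G as x a)"
  unfolding fodef1_def
proof (intro allI impI)
  fix xs :: "nat list" and u assume n: "length xs = n"
  show "fodef (insert u (set xs)) (\<lambda>G \<sigma>. \<exists>a\<in>pverts G. P G (map \<sigma> xs) (\<sigma> u) a)"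
    by (rule fodef_ex_fresh) (use assms n in \<open>auto intro: fodef2_fodef\<close>)
qed

lemma fodef1_conj: "fodef1 n P \<Longrightarrow> fodef1 n Q \<Longrightarrow> fodef1 n (\<lambda>G as x. P G as x \<and> Q G as x)"
  unfolding fodef1_def by (auto intro: fodef_conj)

lemma fodef2_conj: "fodef2 n P \<Longrightarrow> fodef2 n Q \<Longrightarrow> fodef2 n (\<lambda>G as x y. P G as x y \<and> Q G as x y)"
  unfolding fodef2_def by (auto intro: fodef_conj)

section \<open>Definability of components\<close>

lemma simple_sym: "G \<in> \<C> \<Longrightarrow> sym (parcs G)"
proof -
  assume "G \<in> \<C>"
  then interpret pair_bidirected_digraph G using simple by (simp add: simple_graph_def)
  show ?thesis using pair_sym_arcs by (simp add: symmetric_def)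
qed

lemma simple_wf: "G \<in> \<C> \<Longrightarrow> (u, v) \<in> parcs G \<Longrightarrow> u \<in> pverts G \<and> v \<in> pverts G"
proof -
  assume "G \<in> \<C>" and uv: "(u, v) \<in> parcs G"
  then interpret pair_bidirected_digraph G using simple by (simp add: simple_graph_def)
  show ?thesis using in_arcsD1[OF uv] in_arcsD2[OF uv] by simp
qed

lemma component_short:
  assumes "G \<in> \<C>" "W \<subseteq> pverts G"
  shows "component (parcs G) W u = {v. (u, v) \<in> ((parcs G \<inter> W \<times> W)\<^sup>=) ^^ N}"
proof (cases "u \<in> W")
  case True
  then show ?thesis using assms short by (intro component_bounded) auto
next
  case False
  have "v = u" if "(u, v) \<in> (parcs G \<inter> W \<times> W)\<^sup>*" for v
    using that by (rule converse_rtranclE) (use False in auto)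
  moreover have "(u, v) \<in> (parcs G \<inter> W \<times> W)\<^sup>*" if "(u, v) \<in> ((parcs G \<inter> W \<times> W)\<^sup>=) ^^ N" for v
    using relpow_imp_rtrancl[OF that] by simp
  moreover have "(u, u) \<in> ((parcs G \<inter> W \<times> W)\<^sup>=) ^^ N" by (induction N) auto
  ultimately show ?thesis by (auto simp: component_def)
qed

text \<open>By \<open>component_short\<close>, membership in a component is a fixed power of a
  definable relation; each factor costs one quantifier over an intermediate vertex.\<close>

lemma fodef_component:
  assumes W: "fodef1 n (\<lambda>G as x. x \<in> W G as)" and sub: "\<And>G as. W G as \<subseteq> pverts G"
  shows "fodef2 n (\<lambda>G as x y. y \<in> component (parcs G) (W G as) x)"
proof -
  have relpow: "fodef2 n (\<lambda>G as x y. (x, y) \<in> ((parcs G \<inter> W G as \<times> W G as)\<^sup>=) ^^ j)" for j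
  proof (induction j)
    case 0
    show ?case by (auto simp: fodef2_def intro: fodef_eq)
  next
    case (Suc j)
    show ?case
      unfolding fodef2_def
    proof (intro allI impI)
      fix xs :: "nat list" and u v assume n: "length xs = n"
      let ?R = "\<lambda>G \<sigma>. (parcs G \<inter> W G (map \<sigma> xs) \<times> W G (map \<sigma> xs))\<^sup>="
      have "fodef (insert u (insert v (set xs))) (\<lambda>G \<sigma>. \<exists>a\<in>pverts G. (\<sigma> u, a) \<in> ?R G \<sigma> ^^ j \<and> (a, \<sigma> v) \<in> ?R G \<sigma>)"
      proof (rule fodef_ex_fresh)
        fix w assume w: "w \<notin> insert u (insert v (set xs))"
        let ?A = "insert w (insert u (insert v (set xs)))"
        have "fodef ?A (\<lambda>G \<sigma>. (\<sigma> w = \<sigma> v) \<or>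
            ((\<sigma> w, \<sigma> v) \<in> parcs G \<and> \<sigma> w \<in> W G (map \<sigma> xs) \<and> \<sigma> v \<in> W G (map \<sigma> xs)))"
          by (intro fodef_disj fodef_conj fodef_eq fodef_edge fodef1_fodef[OF W] n) auto
        then have "fodef ?A (\<lambda>G \<sigma>. (\<sigma> w, \<sigma> v) \<in> ?R G \<sigma>)" by (rule fodef_cong) auto
        then show "fodef ?A (\<lambda>G \<sigma>. (\<sigma> u, \<sigma> w) \<in> ?R G \<sigma> ^^ j \<and> (\<sigma> w, \<sigma> v) \<in> ?R G \<sigma>)"
          by (intro fodef_conj fodef2_fodef[OF Suc] n) auto
        show "((\<sigma>(w := a)) u, a) \<in> ?R G (\<sigma>(w := a)) ^^ j \<and> (a, (\<sigma>(w := a)) v) \<in> ?R G (\<sigma>(w := a)) \<longleftrightarrow>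
            (\<sigma> u, a) \<in> ?R G \<sigma> ^^ j \<and> (a, \<sigma> v) \<in> ?R G \<sigma>" for G \<sigma> a
        proof -
          have "map (\<sigma>(w := a)) xs = map \<sigma> xs" using w by simp
          then show ?thesis using w by auto
        qed
      qed simp
      then show "fodef (insert u (insert v (set xs))) (\<lambda>G \<sigma>. (\<sigma> u, \<sigma> v) \<in> ?R G \<sigma> ^^ Suc j)"
      proof (rule fodef_cong)
        fix G and \<sigma> :: "nat \<Rightarrow> 'a" assume G: "G \<in> \<C>" "range \<sigma> \<subseteq> pverts G"
        have "a \<in> pverts G" if "(a, \<sigma> v) \<in> ?R G \<sigma>" for a
          using that G simple_wf[OF G(1)] by auto
        then show "(\<exists>a\<in>pverts G. (\<sigma> u, a) \<in> ?R G \<sigma> ^^ j \<and> (a, \<sigma> v) \<in> ?R G \<sigma>) \<longleftrightarrow>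
            (\<sigma> u, \<sigma> v) \<in> ?R G \<sigma> ^^ Suc j"
          unfolding relpow.simps by blast
      qed
    qed
  qed
  show ?thesis
    unfolding fodef2_def
  proof (intro allI impI)
    fix xs :: "nat list" and u v assume n: "length xs = n"
    have "fodef (insert u (insert v (set xs)))
        (\<lambda>G \<sigma>. (\<sigma> u, \<sigma> v) \<in> ((parcs G \<inter> W G (map \<sigma> xs) \<times> W G (map \<sigma> xs))\<^sup>=) ^^ N)"
      by (rule fodef2_fodef[OF relpow n]) auto
    then show "fodef (insert u (insert v (set xs)))
        (\<lambda>G \<sigma>. \<sigma> v \<in> component (parcs G) (W G (map \<sigma> xs)) (\<sigma> u))"
      by (rule fodef_cong) (simp add: component_short sub)
  qed
qed

end

text \<open>The part of the graph that is still to be eliminated below the branch \<open>as\<close>.\<close>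

definition rest :: "'a pair_pre_digraph \<Rightarrow> 'a list \<Rightarrow> 'a set" where
  "rest G as = (if as = [] then pverts G
     else component (parcs G) (pverts G - set (butlast as)) (last as) - {last as})"

lemma rest_subset: "rest G as \<subseteq> pverts G"
proof (cases "as = [] \<or> last as \<in> pverts G - set (butlast as)")
  case True
  then show ?thesis using component_subset[of "last as" "pverts G - set (butlast as)" "parcs G"]
    by (auto simp: rest_def)
next
  case False
  have "v = last as" if "(last as, v) \<in> (parcs G \<inter> (pverts G - set (butlast as)) \<times> (pverts G - set (butlast as)))\<^sup>*" for v
    using that by (rule converse_rtranclE) (use False in auto)
  then show ?thesis using False by (auto simp: rest_def component_def)
qed

text \<open>The last vertex was chosen among those not yet deleted. Nothing is asked of the earlier
  entries, as \<open>rest\<close> depends only on their set and on the last vertex.\<close>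

definition live :: "'a pair_pre_digraph \<Rightarrow> 'a list \<Rightarrow> bool" where
  "live G as \<longleftrightarrow> as = [] \<or> last as \<in> pverts G - set (butlast as)"

lemma rest_component:
  assumes "live G as" "u \<in> rest G as"
  shows "component (parcs G) (rest G as) u = component (parcs G) (pverts G - set as) u"
    and "rest G (as @ [u]) = component (parcs G) (rest G as) u - {u}" and "live G (as @ [u])"
proof -
  show eq: "component (parcs G) (rest G as) u = component (parcs G) (pverts G - set as) u"
  proof (cases "as = []")
    case False
    have "set as = insert (last as) (set (butlast as))"
      using False by (metis append_butlast_last_id list.simps(15) rotate1.simps(2) set_rotate1)
    then have "pverts G - set as = (pverts G - set (butlast as)) - {last as}" by auto
    then show ?thesis
      using component_component(2)[of "last as" "pverts G - set (butlast as)" u "parcs G"] assms False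
      by (simp add: rest_def live_def)
  qed (simp add: rest_def)
  then show "rest G (as @ [u]) = component (parcs G) (rest G as) u - {u}"
    by (simp add: rest_def[of G "as @ [u]"])
  have "u \<notin> set as"
  proof (cases "as = []")
    case False
    have "set as = insert (last as) (set (butlast as))"
      using False by (metis append_butlast_last_id list.simps(15) rotate1.simps(2) set_rotate1)
    moreover have "last as \<in> pverts G - set (butlast as)" using assms(1) False by (simp add: live_def)
    ultimately show ?thesis
      using assms(2) component_subset[of "last as" "pverts G - set (butlast as)" "parcs G"] False
      by (auto simp: rest_def)
  qed simp
  then show "live G (as @ [u])" using rest_subset[of G as] assms(2) by (auto simp: live_def)
qed

text \<open>Components are disjoint, so their roots differ and each vertex still ends exactly one
  branch. An edge stays within one component; there it either meets the root, which is on every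
  nonempty branch, or lies in the forest below it.\<close>

lemma elimination_glue:
  assumes sym: "sym (parcs G)"
    and r: "\<And>C. C \<in> comps (parcs G) W \<Longrightarrow> r C \<in> C"
    and T: "\<And>C. C \<in> comps (parcs G) W \<Longrightarrow> elimination (induced G (C - {r C})) m (T C)"
  defines "TT \<equiv> insert [] (\<Union>C\<in>comps (parcs G) W. (#) (r C) ` T C)"
  shows "elimination (induced G W) (Suc m) TT" and "kids (TT, L) = r ` comps (parcs G) W"
    and "inj_on r (comps (parcs G) W)"
    and "C \<in> comps (parcs G) W \<Longrightarrow> sub (TT, L) (r C) = (T C, \<lambda>s. L (r C # s))"
proof -
  let ?E = "parcs G"
  have disj: "C = D" if "C \<in> comps ?E W" "D \<in> comps ?E W" "v \<in> C" "v \<in> D" for C D v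
    using comps_eq[OF sym that(1,3)] comps_eq[OF sym that(2,4)] by simp
  have eqC: "C = D" if "C \<in> comps ?E W" "D \<in> comps ?E W" "r C = r D" for C D
    using disj[OF that(1,2) r[OF that(1)]] r[OF that(2)] that(3) by simp
  then show "inj_on r (comps ?E W)" by (auto intro: inj_onI)
  have TT_Cons: "u # s \<in> TT \<longleftrightarrow> (\<exists>C\<in>comps ?E W. u = r C \<and> s \<in> T C)" for u s
    by (auto simp: TT_def)
  have nilT: "[] \<in> T C" if "C \<in> comps ?E W" for C
    using T[OF that] by (simp add: elimination.nil)
  show "kids (TT, L) = r ` comps ?E W" using nilT by (auto simp: kids_def TT_Cons)
  show "sub (TT, L) (r C) = (T C, \<lambda>s. L (r C # s))" if "C \<in> comps ?E W" for C
    using that eqC[OF that] by (auto simp: sub_def TT_Cons)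
  have vT: "(\<exists>s. s @ [v] \<in> T C) \<longleftrightarrow> v \<in> C - {r C}" if "C \<in> comps ?E W" for C v
    using elimination.verts[OF T[OF that], of v] by simp
  have snoc: "s @ [v] \<in> TT \<longleftrightarrow> (\<exists>C\<in>comps ?E W. (s = [] \<and> v = r C) \<or> (\<exists>s'. s = r C # s' \<and> s' @ [v] \<in> T C))" for s v
    using nilT by (cases s) (auto simp: TT_Cons)
  show "elimination (induced G W) (Suc m) TT"
  proof
    show "[] \<in> TT" by (simp add: TT_def)
    show "s \<in> TT" if sq: "s @ q \<in> TT" for s q
    proof (cases s)
      case (Cons u s')
      then obtain C where C: "C \<in> comps ?E W" "u = r C" "s' @ q \<in> T C"
        using sq TT_Cons by auto
      then have "s' \<in> T C" using elimination.prefix[OF T] by blast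
      then show ?thesis using C Cons TT_Cons by auto
    qed (simp add: TT_def)
    show "v \<in> pverts (induced G W) \<longleftrightarrow> (\<exists>s. s @ [v] \<in> TT)" for v
    proof
      assume "v \<in> pverts (induced G W)"
      then have v: "v \<in> W" by simp
      let ?C = "component ?E W v"
      have C: "?C \<in> comps ?E W" using v by (simp add: comps_def)
      show "\<exists>s. s @ [v] \<in> TT"
      proof (cases "v = r ?C")
        case True
        then have "[] @ [v] \<in> TT" unfolding snoc using C by blast
        then show ?thesis by blast
      next
        case False
        then obtain s where "s @ [v] \<in> T ?C" using vT[OF C, of v] by auto
        then have "(r ?C # s) @ [v] \<in> TT" unfolding snoc using C by blast
        then show ?thesis by blast
      qed
    next
      assume "\<exists>s. s @ [v] \<in> TT"
      then obtain C where "C \<in> comps ?E W" "v \<in> C" unfolding snoc using vT r by blast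
      then show "v \<in> pverts (induced G W)" using comps_subset by fastforce
    qed
    show "s = s'" if s: "s @ [v] \<in> TT" "s' @ [v] \<in> TT" for s s' v
    proof -
      obtain C where C: "C \<in> comps ?E W" "(s = [] \<and> v = r C) \<or> (\<exists>q. s = r C # q \<and> q @ [v] \<in> T C)"
        using s(1) unfolding snoc by blast
      obtain D where D: "D \<in> comps ?E W" "(s' = [] \<and> v = r D) \<or> (\<exists>q. s' = r D # q \<and> q @ [v] \<in> T D)"
        using s(2) unfolding snoc by blast
      have vC: "v \<in> C" "v = r C \<longleftrightarrow> s = []" using C vT[OF C(1), of v] r[OF C(1)] by auto
      have vD: "v \<in> D" "v = r D \<longleftrightarrow> s' = []" using D vT[OF D(1), of v] r[OF D(1)] by auto
      have CD: "C = D" by (rule disj[OF C(1) D(1) vC(1) vD(1)])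
      show ?thesis
      proof (cases "v = r C")
        case False
        then obtain q q' where "s = r C # q" "q @ [v] \<in> T C" "s' = r C # q'" "q' @ [v] \<in> T C"
          using C(2) D(2) CD by auto
        then show ?thesis using elimination.uniq[OF T[OF C(1)]] by blast
      qed (use vC(2) vD(2) CD in simp)
    qed
    show "\<exists>s\<in>TT. u \<in> set s \<and> v \<in> set s" if "(u, v) \<in> parcs (induced G W)" for u v
    proof -
      have uv: "(u, v) \<in> ?E" "u \<in> W" "v \<in> W" using that by (auto simp: induced_def)
      let ?C = "component ?E W u"
      have C: "?C \<in> comps ?E W" using uv by (simp add: comps_def)
      have v: "v \<in> ?C" using component_arc[OF sym uv] component_refl[of v ?E W] by simp
      have branch: "\<exists>s\<in>TT. r ?C \<in> set s \<and> w \<in> set s" if w: "w \<in> ?C" for w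
      proof (cases "w = r ?C")
        case True
        then have "[r ?C] \<in> TT" using C nilT by (auto simp: TT_Cons)
        then show ?thesis using True by force
      next
        case False
        then obtain s where "s @ [w] \<in> T ?C" using vT[OF C, of w] w by auto
        then have "r ?C # s @ [w] \<in> TT" using C by (auto simp: TT_Cons)
        then show ?thesis by (intro bexI[of _ "r ?C # s @ [w]"]) auto
      qed
      show ?thesis
      proof (cases "u = r ?C \<or> v = r ?C")
        case True
        then show ?thesis using branch[OF v] branch[OF component_refl] by auto
      next
        case False
        then have "(u, v) \<in> parcs (induced G (?C - {r ?C}))" using uv v by (auto simp: induced_def)
        then obtain s where "s \<in> T ?C" "u \<in> set s" "v \<in> set s"
          using elimination.arc[OF T[OF C]] by blast
        then show ?thesis using C by (intro bexI[of _ "r ?C # s"]) (auto simp: TT_Cons)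
      qed
    qed
    show "length s \<le> Suc m" if "s \<in> TT" for s
      using that elimination.depth[OF T] by (auto simp: TT_def)
  qed
qed

section \<open>Counting components by representatives\<close>

primrec choosable :: "('b \<Rightarrow> 'c) \<Rightarrow> 'b set \<Rightarrow> nat \<Rightarrow> 'b list \<Rightarrow> bool" where
  "choosable f D 0 bs \<longleftrightarrow> True"
| "choosable f D (Suc j) bs \<longleftrightarrow> (\<exists>v\<in>D. (\<forall>b\<in>set bs. f b \<noteq> f v) \<and> choosable f D j (bs @ [v]))"

lemma ex_card_Diff_singleton:
  "(\<exists>x\<in>S. infinite (S - {x}) \<or> j \<le> card (S - {x})) \<longleftrightarrow> infinite S \<or> Suc j \<le> card S"
proof (cases "finite S")
  case True
  then have "card (S - {x}) = card S - 1" "0 < card S" if "x \<in> S" for x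
    using that by (auto simp: card_gt_0_iff)
  moreover have "S \<noteq> {}" if "Suc j \<le> card S" using that by auto
  ultimately show ?thesis using True by fastforce
next
  case False
  then have "S \<noteq> {}" by auto
  then show ?thesis using False by auto
qed

text \<open>Values are removed one at a time. With \<open>f\<close> mapping a vertex to its
  component, the number of components of a certain kind is tested by choosing vertices from
  different ones, so that no quantification over sets is required.\<close>

lemma choosable_iff: "choosable f D j bs \<longleftrightarrow> infinite (f ` D - f ` set bs) \<or> j \<le> card (f ` D - f ` set bs)"
proof (induction j arbitrary: bs)
  case (Suc j)
  have diff: "f ` D - f ` set (bs @ [v]) = (f ` D - f ` set bs) - {f v}" for v by auto
  have new: "(\<forall>b\<in>set bs. f b \<noteq> f v) \<longleftrightarrow> f v \<notin> f ` set bs" for v by (metis imageE imageI)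
  have "choosable f D (Suc j) bs \<longleftrightarrow> (\<exists>x\<in>f ` D - f ` set bs.
      infinite ((f ` D - f ` set bs) - {x}) \<or> j \<le> card ((f ` D - f ` set bs) - {x}))"
    unfolding choosable.simps Suc diff new by blast
  also have "\<dots> \<longleftrightarrow> infinite (f ` D - f ` set bs) \<or> Suc j \<le> card (f ` D - f ` set bs)"
    by (rule ex_card_Diff_singleton)
  finally show ?case .
qed simp

lemma ccard_eq_iff: "ccard t A = k \<longleftrightarrow> k \<le> t \<and> (infinite A \<or> k \<le> card A) \<and> (k < t \<longrightarrow> \<not> (infinite A \<or> Suc k \<le> card A))"
  by (auto simp: ccard_def)

context fo_class begin

lemma fodef_choosable:
  assumes D: "fodef1 n (\<lambda>G as x. x \<in> D G as)" and sub: "\<And>G as. D G as \<subseteq> pverts G"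
    and f: "fodef2 n (\<lambda>G as x y. f G as x = f G as y)" and n: "length xs = n"
  shows "fodef (set xs \<union> set bs) (\<lambda>G \<sigma>. choosable (f G (map \<sigma> xs)) (D G (map \<sigma> xs)) j (map \<sigma> bs))"
proof (induction j arbitrary: bs)
  case (Suc j)
  let ?P = "\<lambda>G \<sigma> a. a \<in> D G (map \<sigma> xs) \<and> (\<forall>b\<in>set bs. f G (map \<sigma> xs) (\<sigma> b) \<noteq> f G (map \<sigma> xs) a) \<and>
      choosable (f G (map \<sigma> xs)) (D G (map \<sigma> xs)) j (map \<sigma> bs @ [a])"
  have "fodef (set xs \<union> set bs) (\<lambda>G \<sigma>. \<exists>a\<in>pverts G. ?P G \<sigma> a)"
  proof (rule fodef_ex_fresh)
    fix u assume u: "u \<notin> set xs \<union> set bs"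
    let ?A = "insert u (set xs \<union> set bs)"
    have "fodef ?A (\<lambda>G \<sigma>. choosable (f G (map \<sigma> xs)) (D G (map \<sigma> xs)) j (map \<sigma> bs @ [\<sigma> u]))"
      using Suc[of "bs @ [u]"] by simp
    then show "fodef ?A (\<lambda>G \<sigma>. ?P G \<sigma> (\<sigma> u))"
      by (intro fodef_conj fodef_ball fodef_not fodef1_fodef[OF D] fodef2_fodef[OF f] n) auto
    show "?P G (\<sigma>(u := a)) a \<longleftrightarrow> ?P G \<sigma> a" for G \<sigma> a
    proof -
      have "map (\<sigma>(u := a)) xs = map \<sigma> xs" "map (\<sigma>(u := a)) bs = map \<sigma> bs" using u by auto
      moreover have "(\<sigma>(u := a)) b = \<sigma> b" if "b \<in> set bs" for b using u that by auto
      ultimately show ?thesis by (simp only: cong: ball_cong)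
    qed
  qed simp
  then show ?case
  proof (rule fodef_cong)
    fix G :: "'a pair_pre_digraph" and \<sigma> :: "nat \<Rightarrow> 'a"
    show "(\<exists>a\<in>pverts G. ?P G \<sigma> a) \<longleftrightarrow> choosable (f G (map \<sigma> xs)) (D G (map \<sigma> xs)) (Suc j) (map \<sigma> bs)"
      using sub[of G "map \<sigma> xs"] by auto
  qed
qed (simp add: fodef_const)

lemma fodef_ccard:
  assumes "fodef1 n (\<lambda>G as x. x \<in> D G as)" "\<And>G as. D G as \<subseteq> pverts G"
    and "fodef2 n (\<lambda>G as x y. f G as x = f G as y)" "length xs = n"
  shows "fodef (set xs) (\<lambda>G \<sigma>. ccard t (f G (map \<sigma> xs) ` D G (map \<sigma> xs)) = k)"
proof -
  have "fodef (set xs) (\<lambda>G \<sigma>. infinite (f G (map \<sigma> xs) ` D G (map \<sigma> xs)) \<or>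
      j \<le> card (f G (map \<sigma> xs) ` D G (map \<sigma> xs)))" for j
    using fodef_choosable[OF assms, of "[]" j] by (simp add: choosable_iff)
  then show ?thesis unfolding ccard_eq_iff by (intro fodef_conj fodef_imp fodef_not fodef_const)
qed

lemma fodef1_rest: "fodef1 n (\<lambda>G as x. x \<in> rest G as)"
  unfolding fodef1_def
proof (intro allI impI)
  fix xs :: "nat list" and u assume n: "length xs = n"
  show "fodef (insert u (set xs)) (\<lambda>G \<sigma>. \<sigma> u \<in> rest G (map \<sigma> xs))"
  proof (cases xs rule: rev_cases)
    case Nil
    show ?thesis by (rule fodef_cong[OF fodef_const[of _ True]]) (auto simp: rest_def Nil)
  next
    case (snoc ys w)
    have "fodef1 (length ys) (\<lambda>G as x. x \<in> pverts G - set as)"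
      unfolding fodef1_def
    proof (intro allI impI)
      fix zs :: "nat list" and u
      have "fodef (insert u (set zs)) (\<lambda>G \<sigma>. \<forall>z\<in>set zs. \<not> \<sigma> u = \<sigma> z)"
        by (intro fodef_ball fodef_not fodef_eq) auto
      then show "fodef (insert u (set zs)) (\<lambda>G \<sigma>. \<sigma> u \<in> pverts G - set (map \<sigma> zs))"
        by (rule fodef_cong) auto
    qed
    then have "fodef2 (length ys) (\<lambda>G as x y. y \<in> component (parcs G) (pverts G - set as) x)"
      by (rule fodef_component) auto
    then have "fodef (insert u (set xs)) (\<lambda>G \<sigma>.
        \<sigma> u \<in> component (parcs G) (pverts G - set (map \<sigma> ys)) (\<sigma> w) \<and> \<not> \<sigma> u = \<sigma> w)"
      by (intro fodef_conj fodef_not fodef_eq fodef2_fodef) (auto simp: snoc)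
    then show ?thesis by (rule fodef_cong) (auto simp: rest_def snoc)
  qed
qed

lemma fodef2_component_rest:
  "fodef2 n (\<lambda>G as x y. y \<in> component (parcs G) (rest G as) x)"
  by (rule fodef_component[OF fodef1_rest rest_subset])

lemma component_rest_subset: "x \<in> pverts G \<Longrightarrow> component (parcs G) (rest G as) x \<subseteq> pverts G"
proof (cases "x \<in> rest G as")
  case True
  then show ?thesis using component_subset[of x "rest G as" "parcs G"] rest_subset[of G as] by blast
next
  case False
  assume x: "x \<in> pverts G"
  have "v = x" if "(x, v) \<in> (parcs G \<inter> rest G as \<times> rest G as)\<^sup>*" for v
    using that by (rule converse_rtranclE) (use False in auto)
  then show ?thesis using x by (auto simp: component_def)
qed

lemma fodef2_same_component:
  "fodef2 n (\<lambda>G as x y. component (parcs G) (rest G as) x = component (parcs G) (rest G as) y)"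
  unfolding fodef2_def
proof (intro allI impI)
  fix xs :: "nat list" and u v assume n: "length xs = n"
  let ?c = "\<lambda>G \<sigma>. component (parcs G) (rest G (map \<sigma> xs))"
  have "fodef (insert u (insert v (set xs))) (\<lambda>G \<sigma>. \<exists>a\<in>pverts G. \<not> (a \<in> ?c G \<sigma> (\<sigma> u) \<longleftrightarrow> a \<in> ?c G \<sigma> (\<sigma> v)))"
  proof (rule fodef_ex_fresh)
    fix w assume w: "w \<notin> insert u (insert v (set xs))"
    show "fodef (insert w (insert u (insert v (set xs))))
        (\<lambda>G \<sigma>. \<not> (\<sigma> w \<in> ?c G \<sigma> (\<sigma> u) \<longleftrightarrow> \<sigma> w \<in> ?c G \<sigma> (\<sigma> v)))"
      by (intro fodef_not fodef_iff fodef2_fodef[OF fodef2_component_rest n]) auto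
  qed auto
  then have "fodef (insert u (insert v (set xs)))
      (\<lambda>G \<sigma>. \<not> (\<exists>a\<in>pverts G. \<not> (a \<in> ?c G \<sigma> (\<sigma> u) \<longleftrightarrow> a \<in> ?c G \<sigma> (\<sigma> v))))"
    by (rule fodef_not)
  then show "fodef (insert u (insert v (set xs))) (\<lambda>G \<sigma>. ?c G \<sigma> (\<sigma> u) = ?c G \<sigma> (\<sigma> v))"
  proof (rule fodef_cong)
    fix G :: "'a pair_pre_digraph" and \<sigma> :: "nat \<Rightarrow> 'a" assume "range \<sigma> \<subseteq> pverts G"
    then have "?c G \<sigma> (\<sigma> u) \<subseteq> pverts G" "?c G \<sigma> (\<sigma> v) \<subseteq> pverts G"
      by (auto intro!: component_rest_subset)
    then show "(\<not> (\<exists>a\<in>pverts G. \<not> (a \<in> ?c G \<sigma> (\<sigma> u) \<longleftrightarrow> a \<in> ?c G \<sigma> (\<sigma> v)))) \<longleftrightarrow>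
        ?c G \<sigma> (\<sigma> u) = ?c G \<sigma> (\<sigma> v)" by blast
  qed
qed

end

section \<open>Canonical classes of elimination forests and their definability\<close>

locale branch_types = fo_class +
  fixes K :: "key set" and d t :: nat
  assumes finite_K: "finite K"
begin

definition elabel :: "'a pair_pre_digraph \<Rightarrow> 'a list \<Rightarrow> key \<Rightarrow> nat list set" where
  "elabel G = label K (edge_structure G)"

definition classes :: "nat \<Rightarrow> ('a, key \<Rightarrow> nat list set) ctree set set" where
  "classes m = class_of t m ` ctrees (labels K d)"

lemma finite_classes_K: "finite (classes m)"
  unfolding classes_def by (rule finite_classes[OF finite_labels[OF finite_K]])

text \<open>Applied to the set of classes available to a component, it makes components with the
  same options decide alike, in all graphs. The decision then depends on finitely many membership
  questions only.\<close>

definition pick :: "'b set \<Rightarrow> 'b" where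
  "pick A = (SOME x. x \<in> A)"

text \<open>
  The classes of the elimination forests of \<^term>\<open>rest G as\<close>. Each component commits to one of
  the classes available to it, so that \<open>forest_class m G as\<close> has at most one element.
\<close>

primrec forest_class :: "nat \<Rightarrow> 'a pair_pre_digraph \<Rightarrow> 'a list \<Rightarrow> ('a, key \<Rightarrow> nat list set) ctree set set" where
  "forest_class 0 G as = {class_of t 0 e |e. e \<in> ctrees (labels K d) \<and> snd e [] = elabel G as \<and> rest G as = {}}"
| "forest_class (Suc m) G as = {class_of t (Suc m) e |e. e \<in> ctrees (labels K d) \<and> snd e [] = elabel G as \<and>
     (\<forall>C\<in>comps (parcs G) (rest G as). (\<Union>u\<in>C. forest_class m G (as @ [u])) \<noteq> {}) \<and>
     (\<forall>\<kappa>\<in>classes m. ccard t {C \<in> comps (parcs G) (rest G as). pick (\<Union>u\<in>C. forest_class m G (as @ [u])) = \<kappa>} =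
        ccard t {w \<in> kids e. class_of t m (sub e w) = \<kappa>})}"

lemma forest_class_classes: "forest_class m G as \<subseteq> classes m"
  by (cases m) (auto simp: classes_def)

lemma elabel_tree:
  assumes "elimination (induced G W) m T" "length as + m \<le> d"
  shows "(T, \<lambda>s. elabel G (as @ s)) \<in> ctrees (labels K d)"
  using assms elimination.nil[OF assms(1)] elimination.depth[OF assms(1)]
  by (force simp: ctrees_def elabel_def intro!: label_labels)

text \<open>Every component has a root that realizes its picked class, and the forests below these
  roots are glued. Realizability one level lower is an explicit hypothesis because the lemma serves
  both the induction for \<open>forest_class_realize\<close> and the proof of
  \<open>forest_class_nonempty\<close>.\<close>

lemma forest_class_glue:
  assumes IH: "\<And>as \<kappa>. live G as \<Longrightarrow> length as + m \<le> d \<Longrightarrow> \<kappa> \<in> forest_class m G as \<Longrightarrow>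
      \<exists>T. elimination (induced G (rest G as)) m T \<and> class_of t m (T, \<lambda>s. elabel G (as @ s)) = \<kappa>"
    and G: "G \<in> \<C>" and as: "live G as" "length as + Suc m \<le> d"
    and ne: "\<forall>C\<in>comps (parcs G) (rest G as). (\<Union>u\<in>C. forest_class m G (as @ [u])) \<noteq> {}"
  shows "\<exists>T. elimination (induced G (rest G as)) (Suc m) T \<and>
    (\<forall>\<kappa>. ccard t {C \<in> comps (parcs G) (rest G as). pick (\<Union>u\<in>C. forest_class m G (as @ [u])) = \<kappa>} =
      ccard t {w \<in> kids (T, \<lambda>s. elabel G (as @ s)). class_of t m (sub (T, \<lambda>s. elabel G (as @ s)) w) = \<kappa>})"
proof -
  let ?cs = "comps (parcs G) (rest G as)" and ?p = "\<lambda>C. pick (\<Union>u\<in>C. forest_class m G (as @ [u]))"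
  note sym = simple_sym[OF G]
  have "\<exists>u T. u \<in> C \<and> elimination (induced G (C - {u})) m T \<and> class_of t m (T, \<lambda>s. elabel G (as @ u # s)) = ?p C"
    if C: "C \<in> ?cs" for C
  proof -
    have "?p C \<in> (\<Union>u\<in>C. forest_class m G (as @ [u]))"
      using ne C unfolding pick_def by (metis some_in_eq)
    then obtain u where u: "u \<in> C" "?p C \<in> forest_class m G (as @ [u])" by blast
    have uW: "u \<in> rest G as" using u(1) comps_subset[OF C] by blast
    have CC: "C = component (parcs G) (rest G as) u" using comps_eq[OF sym C u(1)] .
    have "live G (as @ [u])" "rest G (as @ [u]) = C - {u}"
      using rest_component[OF as(1) uW] CC by simp_all
    then show ?thesis using IH[of "as @ [u]" "?p C"] u as(2) by auto
  qed
  then obtain r T where r: "\<And>C. C \<in> ?cs \<Longrightarrow> r C \<in> C"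
    and T: "\<And>C. C \<in> ?cs \<Longrightarrow> elimination (induced G (C - {r C})) m (T C)"
    and cl: "\<And>C. C \<in> ?cs \<Longrightarrow> class_of t m (T C, \<lambda>s. elabel G (as @ r C # s)) = ?p C"
    by metis
  define TT where "TT = insert [] (\<Union>C\<in>?cs. (#) (r C) ` T C)"
  let ?e = "(TT, \<lambda>s. elabel G (as @ s))"
  have elim: "elimination (induced G (rest G as)) (Suc m) TT"
    unfolding TT_def using sym r T by (rule elimination_glue(1))
  have kids: "kids ?e = r ` ?cs"
    unfolding TT_def using sym r T by (rule elimination_glue(2))
  have inj: "inj_on r ?cs" using sym r T by (rule elimination_glue(3))
  have sub: "class_of t m (sub ?e (r C)) = ?p C" if C: "C \<in> ?cs" for C
  proof -
    have "sub ?e (r C) = (T C, \<lambda>s. elabel G (as @ r C # s))"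
      unfolding TT_def using sym r T C by (rule elimination_glue(4))
    then show ?thesis using cl[OF C] by simp
  qed
  have "{w \<in> kids ?e. class_of t m (sub ?e w) = \<kappa>} = r ` {C \<in> ?cs. ?p C = \<kappa>}" for \<kappa>
  proof -
    have "{w \<in> kids ?e. class_of t m (sub ?e w) = \<kappa>} = r ` {C \<in> ?cs. class_of t m (sub ?e (r C)) = \<kappa>}"
      unfolding kids by blast
    also have "{C \<in> ?cs. class_of t m (sub ?e (r C)) = \<kappa>} = {C \<in> ?cs. ?p C = \<kappa>}"
      by (intro Collect_cong conj_cong refl) (simp only: sub)
    finally show ?thesis .
  qed
  moreover have "inj_on r {C \<in> ?cs. ?p C = \<kappa>}" for \<kappa>
    by (rule inj_on_subset[OF inj]) auto
  ultimately have "ccard t {w \<in> kids ?e. class_of t m (sub ?e w) = \<kappa>} = ccard t {C \<in> ?cs. ?p C = \<kappa>}" for \<kappa>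
    by (simp add: ccard_image)
  then show ?thesis using elim by auto
qed

text \<open>The glued forest has the prescribed label at its root and the prescribed counts of
  classes in \<open>classes m\<close>. Other classes do not occur among its children, so its class
  is the given one.\<close>

lemma forest_class_realize:
  assumes "G \<in> \<C>" "live G as" "length as + m \<le> d" "\<kappa> \<in> forest_class m G as"
  shows "\<exists>T. elimination (induced G (rest G as)) m T \<and> class_of t m (T, \<lambda>s. elabel G (as @ s)) = \<kappa>"
  using assms(2-4)
proof (induction m arbitrary: as \<kappa>)
  case 0
  then obtain e where e: "\<kappa> = class_of t 0 e" "snd e [] = elabel G as" "rest G as = {}" by auto
  have "elimination (induced G (rest G as)) 0 {[]}"
    by unfold_locales (auto simp: e(3) induced_def)
  moreover have "class_of t 0 ({[]}, \<lambda>s. elabel G (as @ s)) = \<kappa>" by (simp add: e(1,2) class_of_eq_iff)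
  ultimately show ?case by blast
next
  case (Suc m)
  obtain e where e: "\<kappa> = class_of t (Suc m) e" "e \<in> ctrees (labels K d)" "snd e [] = elabel G as"
    and ne: "\<forall>C\<in>comps (parcs G) (rest G as). (\<Union>u\<in>C. forest_class m G (as @ [u])) \<noteq> {}"
    and cnt: "\<forall>\<kappa>\<in>classes m. ccard t {C \<in> comps (parcs G) (rest G as). pick (\<Union>u\<in>C. forest_class m G (as @ [u])) = \<kappa>} =
        ccard t {w \<in> kids e. class_of t m (sub e w) = \<kappa>}"
    using Suc.prems(3) by auto
  obtain T where T: "elimination (induced G (rest G as)) (Suc m) T"
    "\<And>\<kappa>. ccard t {C \<in> comps (parcs G) (rest G as). pick (\<Union>u\<in>C. forest_class m G (as @ [u])) = \<kappa>} =
      ccard t {w \<in> kids (T, \<lambda>s. elabel G (as @ s)). class_of t m (sub (T, \<lambda>s. elabel G (as @ s)) w) = \<kappa>}"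
    using forest_class_glue[OF Suc.IH assms(1) Suc.prems(1,2) ne] by blast
  let ?e = "(T, \<lambda>s. elabel G (as @ s))"
  have e': "?e \<in> ctrees (labels K d)" using elabel_tree[OF T(1) Suc.prems(2)] .
  have "ccard t {w \<in> kids e. class_of t m (sub e w) = k} = ccard t {w \<in> kids ?e. class_of t m (sub ?e w) = k}" for k
  proof (cases "k \<in> classes m")
    case True
    then show ?thesis using cnt T(2) by simp
  next
    case False
    then have "{w \<in> kids e. class_of t m (sub e w) = k} = {}" "{w \<in> kids ?e. class_of t m (sub ?e w) = k} = {}"
      unfolding classes_def using sub_ctrees[OF e(2)] sub_ctrees[OF e'] by blast+
    then show ?thesis by (simp only:)
  qed
  then have "sim t (Suc m) ?e e" unfolding sim_Suc_class using e(3) by simp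
  then have "class_of t (Suc m) ?e = \<kappa>" unfolding e(1) class_of_eq_iff .
  then show ?case using T(1) by blast
qed

text \<open>Bounded elimination depth offers in each component a root below which the induction
  applies, so every component has a class to pick.\<close>

lemma forest_class_nonempty:
  assumes "G \<in> \<C>" "live G as" "length as + m \<le> d" "\<forall>C\<in>comps (parcs G) (rest G as). elim_depth_le (parcs G) m C"
  shows "forest_class m G as \<noteq> {}"
  using assms(2-4)
proof (induction m arbitrary: as)
  case 0
  then have "comps (parcs G) (rest G as) = {}" by auto
  then have "rest G as = {}" using Union_comps[of "parcs G" "rest G as"] by simp
  moreover have "({[]}, \<lambda>s. elabel G as) \<in> ctrees (labels K d)"
    using 0 by (simp add: ctrees_def elabel_def label_labels)
  ultimately show ?case by (auto intro!: exI[of _ "({[]}, \<lambda>s. elabel G as)"])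
next
  case (Suc m)
  have ne: "\<forall>C\<in>comps (parcs G) (rest G as). (\<Union>u\<in>C. forest_class m G (as @ [u])) \<noteq> {}"
  proof
    fix C assume C: "C \<in> comps (parcs G) (rest G as)"
    then obtain u where u: "u \<in> C" "\<forall>D\<in>comps (parcs G) (C - {u}). elim_depth_le (parcs G) m D"
      using Suc.prems(3) by fastforce
    have uW: "u \<in> rest G as" using u(1) comps_subset[OF C] by blast
    have "C = component (parcs G) (rest G as) u" using comps_eq[OF simple_sym[OF assms(1)] C u(1)] .
    then have "live G (as @ [u])" "rest G (as @ [u]) = C - {u}"
      using rest_component[OF Suc.prems(1) uW] by simp_all
    then have "forest_class m G (as @ [u]) \<noteq> {}" using Suc.IH[of "as @ [u]"] Suc.prems(2) u(2) by simp
    then show "(\<Union>u\<in>C. forest_class m G (as @ [u])) \<noteq> {}" using u(1) by blast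
  qed
  obtain T where T: "elimination (induced G (rest G as)) (Suc m) T"
    "\<And>\<kappa>. ccard t {C \<in> comps (parcs G) (rest G as). pick (\<Union>u\<in>C. forest_class m G (as @ [u])) = \<kappa>} =
      ccard t {w \<in> kids (T, \<lambda>s. elabel G (as @ s)). class_of t m (sub (T, \<lambda>s. elabel G (as @ s)) w) = \<kappa>}"
    using forest_class_glue[OF forest_class_realize[OF assms(1)] assms(1) Suc.prems(1,2) ne] by blast
  have "(T, \<lambda>s. elabel G (as @ s)) \<in> ctrees (labels K d)" using elabel_tree[OF T(1) Suc.prems(2)] .
  then have "class_of t (Suc m) (T, \<lambda>s. elabel G (as @ s)) \<in> forest_class (Suc m) G as"
    using ne T(2) by (auto intro!: exI[of _ "(T, \<lambda>s. elabel G (as @ s))"])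
  then show ?case by blast
qed

lemma fodef_elabel: "fodef (set xs) (\<lambda>G \<sigma>. elabel G (map \<sigma> xs) = l)"
proof -
  let ?N = "newidx (length xs) 2"
  \<comment> \<open>This condition does not depend on the graph or the assignment; it excludes
    values \<open>l\<close> that no branch can have.\<close>
  let ?b = "(\<forall>k. k \<noteq> KEdge \<or> k \<notin> K \<longrightarrow> l k = {}) \<and> (KEdge \<in> K \<longrightarrow> l KEdge \<subseteq> ?N)"
  have "fodef (set xs) (\<lambda>G \<sigma>. ?b \<and> (KEdge \<in> K \<longrightarrow>
      (\<forall>is\<in>?N. ((\<sigma> (xs ! (is ! 0)), \<sigma> (xs ! (is ! 1))) \<in> parcs G) \<longleftrightarrow> is \<in> l KEdge)))"
  proof (intro fodef_conj fodef_imp fodef_const fodef_ball fodef_iff fodef_edge finite_newidx)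
    fix "is" assume "is \<in> ?N"
    then have "length is = 2" "set is \<subseteq> {..<length xs}" by (auto simp: newidx_def)
    then obtain i j where "is = [i, j]" "i < length xs" "j < length xs"
      by (auto simp: length_Suc_conv numeral_2_eq_2)
    then show "xs ! (is ! 0) \<in> set xs" "xs ! (is ! 1) \<in> set xs" by simp_all
  qed
  then show ?thesis
  proof (rule fodef_cong)
    fix G :: "'a pair_pre_digraph" and \<sigma> :: "nat \<Rightarrow> 'a"
    have e: "map ((!) (map \<sigma> xs)) is \<in> edge_structure G KEdge \<longleftrightarrow>
        (\<sigma> (xs ! (is ! 0)), \<sigma> (xs ! (is ! 1))) \<in> parcs G" if "is \<in> ?N" for "is"
    proof -
      have "length is = 2" "set is \<subseteq> {..<length xs}" using that by (auto simp: newidx_def)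
      then obtain i j where "is = [i, j]" "i < length xs" "j < length xs"
        by (auto simp: length_Suc_conv numeral_2_eq_2)
      then show ?thesis by (simp add: edge_structure_def)
    qed
    have all: "elabel G (map \<sigma> xs) = l \<longleftrightarrow> (\<forall>k. k \<noteq> KEdge \<or> k \<notin> K \<longrightarrow> elabel G (map \<sigma> xs) k = l k) \<and>
        (KEdge \<in> K \<longrightarrow> elabel G (map \<sigma> xs) KEdge = l KEdge)" (is "_ \<longleftrightarrow> ?r")
    proof
      assume r: ?r
      show "elabel G (map \<sigma> xs) = l"
      proof
        fix k
        show "elabel G (map \<sigma> xs) k = l k" using r by (cases "k = KEdge \<and> KEdge \<in> K") auto
      qed
    qed simp
    have "elabel G (map \<sigma> xs) k = l k \<longleftrightarrow> l k = {}" if "k \<noteq> KEdge \<or> k \<notin> K" for k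
      using that by (auto simp: elabel_def label_def edge_structure_def)
    moreover have "elabel G (map \<sigma> xs) KEdge = l KEdge \<longleftrightarrow> l KEdge \<subseteq> ?N \<and>
        (\<forall>is\<in>?N. ((\<sigma> (xs ! (is ! 0)), \<sigma> (xs ! (is ! 1))) \<in> parcs G) \<longleftrightarrow> is \<in> l KEdge)" if "KEdge \<in> K"
    proof -
      have "elabel G (map \<sigma> xs) KEdge =
          {is \<in> ?N. (\<sigma> (xs ! (is ! 0)), \<sigma> (xs ! (is ! 1))) \<in> parcs G}"
        using that e by (auto simp: elabel_def label_def)
      then show ?thesis by blast
    qed
    ultimately show "(?b \<and> (KEdge \<in> K \<longrightarrow>
      (\<forall>is\<in>?N. ((\<sigma> (xs ! (is ! 0)), \<sigma> (xs ! (is ! 1))) \<in> parcs G) \<longleftrightarrow> is \<in> l KEdge))) \<longleftrightarrow>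
      elabel G (map \<sigma> xs) = l"
      unfolding all by (simp cong: imp_cong) blast
  qed
qed

lemma fodef_forest_class: "fodef (set xs) (\<lambda>G \<sigma>. \<kappa> \<in> forest_class m G (map \<sigma> xs))"
proof (induction m arbitrary: xs \<kappa>)
  case 0
  have "fodef (set xs) (\<lambda>G \<sigma>. \<exists>a\<in>pverts G. a \<in> rest G (map \<sigma> xs))"
    by (rule fodef_ex1[OF fodef1_rest]) simp
  then have "fodef (set xs) (\<lambda>G \<sigma>. \<exists>l\<in>labels K d. (\<exists>e\<in>ctrees (labels K d). snd e [] = l \<and> \<kappa> = class_of t 0 e) \<and>
      elabel G (map \<sigma> xs) = l \<and> \<not> (\<exists>a\<in>pverts G. a \<in> rest G (map \<sigma> xs)))"
    by (intro fodef_bex fodef_conj fodef_not fodef_const fodef_elabel finite_labels finite_K)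
  then show ?case
  proof (rule fodef_cong)
    fix G :: "'a pair_pre_digraph" and \<sigma> :: "nat \<Rightarrow> 'a"
    have empty: "\<not> (\<exists>a\<in>pverts G. a \<in> rest G (map \<sigma> xs)) \<longleftrightarrow> rest G (map \<sigma> xs) = {}"
      using rest_subset[of G "map \<sigma> xs"] by blast
    show "(\<exists>l\<in>labels K d. (\<exists>e\<in>ctrees (labels K d). snd e [] = l \<and> \<kappa> = class_of t 0 e) \<and>
      elabel G (map \<sigma> xs) = l \<and> \<not> (\<exists>a\<in>pverts G. a \<in> rest G (map \<sigma> xs))) \<longleftrightarrow> \<kappa> \<in> forest_class 0 G (map \<sigma> xs)"
      unfolding empty
    proof
      assume "\<kappa> \<in> forest_class 0 G (map \<sigma> xs)"
      then obtain e where e: "\<kappa> = class_of t 0 e" "e \<in> ctrees (labels K d)" "snd e [] = elabel G (map \<sigma> xs)"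
        "rest G (map \<sigma> xs) = {}" by auto
      moreover have "snd e [] \<in> labels K d" using e(2) by (simp add: ctrees_def)
      ultimately show "\<exists>l\<in>labels K d. (\<exists>e\<in>ctrees (labels K d). snd e [] = l \<and> \<kappa> = class_of t 0 e) \<and>
        elabel G (map \<sigma> xs) = l \<and> rest G (map \<sigma> xs) = {}" by (intro bexI[of _ "snd e []"] conjI bexI[of _ e]) simp_all
    qed auto
  qed
next
  case (Suc m)
  \<comment> \<open>The options of a component, indexed by any of its vertices, since formulas speak
    about vertices and not about components.\<close>
  define RC where "RC G as v = (\<Union>u\<in>component (parcs G) (rest G as) v. forest_class m G (as @ [u]))" for G as v
  have RC_sub: "RC G as v \<subseteq> classes m" for G as v using forest_class_classes by (auto simp: RC_def)
  let ?n = "length xs"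
  have "fodef2 ?n (\<lambda>G as x y. k \<in> forest_class m G (as @ [y]))" for k
    unfolding fodef2_def
  proof (intro allI impI)
    fix ys :: "nat list" and u v
    have "fodef (set (ys @ [v])) (\<lambda>G \<sigma>. k \<in> forest_class m G (map \<sigma> (ys @ [v])))" by (rule Suc)
    then have "fodef (insert u (insert v (set ys))) (\<lambda>G \<sigma>. k \<in> forest_class m G (map \<sigma> (ys @ [v])))"
      by (rule fodef_mono) auto
    then show "fodef (insert u (insert v (set ys))) (\<lambda>G \<sigma>. k \<in> forest_class m G (map \<sigma> ys @ [\<sigma> v]))"
      by simp
  qed
  then have "fodef1 ?n (\<lambda>G as x. \<exists>a\<in>pverts G. a \<in> component (parcs G) (rest G as) x \<and> k \<in> forest_class m G (as @ [a]))" for k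
    by (intro fodef1_ex fodef2_conj fodef2_component_rest)
  then have RC: "fodef1 ?n (\<lambda>G as x. k \<in> RC G as x)" for k
    unfolding fodef1_def
  proof (intro allI impI)
    fix ys :: "nat list" and u
    assume n: "length ys = ?n" and *: "\<And>k. \<forall>xsa u. length xsa = ?n \<longrightarrow> fodef (insert u (set xsa)) (\<lambda>G \<sigma>.
      \<exists>a\<in>pverts G. a \<in> component (parcs G) (rest G (map \<sigma> xsa)) (\<sigma> u) \<and> k \<in> forest_class m G (map \<sigma> xsa @ [a]))"
    show "fodef (insert u (set ys)) (\<lambda>G \<sigma>. k \<in> RC G (map \<sigma> ys) (\<sigma> u))"
      using *[of k, rule_format, OF n, of u]
    proof (rule fodef_cong)
      fix G :: "'a pair_pre_digraph" and \<sigma> :: "nat \<Rightarrow> 'a" assume "range \<sigma> \<subseteq> pverts G"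
      then have "component (parcs G) (rest G (map \<sigma> ys)) (\<sigma> u) \<subseteq> pverts G"
        by (intro component_rest_subset) auto
      then show "(\<exists>a\<in>pverts G. a \<in> component (parcs G) (rest G (map \<sigma> ys)) (\<sigma> u) \<and> k \<in> forest_class m G (map \<sigma> ys @ [a]))
        \<longleftrightarrow> k \<in> RC G (map \<sigma> ys) (\<sigma> u)" unfolding RC_def by blast
    qed
  qed
  have pickRC: "fodef1 ?n (\<lambda>G as x. pick (RC G as x) = k)" for k
    unfolding fodef1_def
  proof (intro allI impI)
    fix ys :: "nat list" and u assume n: "length ys = ?n"
    \<comment> \<open>\<open>pick\<close> itself has no first-order meaning, but its argument is one
      of finitely many sets; the disjunction runs over those \<open>Q\<close> whose picked class is
      \<open>k\<close>.\<close>
    have "fodef (insert u (set ys)) (\<lambda>G \<sigma>. \<exists>Q\<in>Pow (classes m). pick Q = k \<and>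
        (\<forall>c\<in>classes m. c \<in> RC G (map \<sigma> ys) (\<sigma> u) \<longleftrightarrow> c \<in> Q))"
      by (intro fodef_bex fodef_conj fodef_ball fodef_iff fodef_const fodef1_fodef[OF RC n])
        (auto simp: finite_classes_K)
    then show "fodef (insert u (set ys)) (\<lambda>G \<sigma>. pick (RC G (map \<sigma> ys) (\<sigma> u)) = k)"
    proof (rule fodef_cong)
      fix G :: "'a pair_pre_digraph" and \<sigma> :: "nat \<Rightarrow> 'a"
      let ?R = "RC G (map \<sigma> ys) (\<sigma> u)"
      show "(\<exists>Q\<in>Pow (classes m). pick Q = k \<and> (\<forall>c\<in>classes m. c \<in> ?R \<longleftrightarrow> c \<in> Q)) \<longleftrightarrow> pick ?R = k"
      proof
        assume "\<exists>Q\<in>Pow (classes m). pick Q = k \<and> (\<forall>c\<in>classes m. c \<in> ?R \<longleftrightarrow> c \<in> Q)"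
        then obtain Q where Q: "Q \<subseteq> classes m" "pick Q = k" "\<forall>c\<in>classes m. c \<in> ?R \<longleftrightarrow> c \<in> Q" by blast
        then have "?R = Q" using RC_sub[of G "map \<sigma> ys" "\<sigma> u"] by blast
        then show "pick ?R = k" using Q(2) by simp
      next
        assume "pick ?R = k"
        then show "\<exists>Q\<in>Pow (classes m). pick Q = k \<and> (\<forall>c\<in>classes m. c \<in> ?R \<longleftrightarrow> c \<in> Q)"
          using RC_sub[of G "map \<sigma> ys" "\<sigma> u"] by (intro bexI[of _ ?R]) auto
      qed
    qed
  qed
  have cnt: "fodef (set xs) (\<lambda>G \<sigma>. ccard t (component (parcs G) (rest G (map \<sigma> xs)) `
      {v \<in> rest G (map \<sigma> xs). pick (RC G (map \<sigma> xs) v) = k}) = j)" for k j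
    by (rule fodef_ccard[where n = ?n and D = "\<lambda>G as. {v \<in> rest G as. pick (RC G as v) = k}"])
      (auto intro: fodef1_conj fodef1_rest pickRC fodef2_same_component subsetD[OF rest_subset])
  have empty: "fodef (set xs) (\<lambda>G \<sigma>. \<exists>v\<in>pverts G. v \<in> rest G (map \<sigma> xs) \<and> RC G (map \<sigma> xs) v = {})"
  proof (rule fodef_ex1[where P = "\<lambda>G as v. v \<in> rest G as \<and> RC G as v = {}"])
    have "fodef1 ?n (\<lambda>G as v. RC G as v = {})"
      unfolding fodef1_def
    proof (intro allI impI)
      fix ys :: "nat list" and u assume n: "length ys = ?n"
      have "fodef (insert u (set ys)) (\<lambda>G \<sigma>. \<forall>c\<in>classes m. \<not> c \<in> RC G (map \<sigma> ys) (\<sigma> u))"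
        by (intro fodef_ball fodef_not fodef1_fodef[OF RC n]) (auto simp: finite_classes_K)
      then show "fodef (insert u (set ys)) (\<lambda>G \<sigma>. RC G (map \<sigma> ys) (\<sigma> u) = {})"
        by (rule fodef_cong) (use RC_sub in blast)
    qed
    then show "fodef1 ?n (\<lambda>G as v. v \<in> rest G as \<and> RC G as v = {})"
      by (intro fodef1_conj fodef1_rest)
  qed simp
  \<comment> \<open>Fixing a representative \<open>e\<close> of the class removes the existential
    quantifier over trees: any other representative has the same root label and the same
    counts.\<close>
  have Suc_iff: "\<kappa> \<in> forest_class (Suc m) G as \<longleftrightarrow>
      elabel G as = snd e [] \<and> \<not> (\<exists>v\<in>pverts G. v \<in> rest G as \<and> RC G as v = {}) \<and>
      (\<forall>k\<in>classes m. ccard t (component (parcs G) (rest G as) ` {v \<in> rest G as. pick (RC G as v) = k}) =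
         ccard t {w \<in> kids e. class_of t m (sub e w) = k})"
    if e: "e \<in> ctrees (labels K d)" "\<kappa> = class_of t (Suc m) e" and G: "G \<in> \<C>" for G as e
  proof -
    let ?cs = "comps (parcs G) (rest G as)" and ?R = "\<lambda>C. (\<Union>u\<in>C. forest_class m G (as @ [u]))"
    have 1: "\<not> (\<exists>v\<in>pverts G. v \<in> rest G as \<and> RC G as v = {}) \<longleftrightarrow> (\<forall>C\<in>?cs. ?R C \<noteq> {})"
      using rest_subset[of G as] unfolding comps_def RC_def by blast
    have 2: "component (parcs G) (rest G as) ` {v \<in> rest G as. pick (RC G as v) = k} =
        {C \<in> ?cs. pick (?R C) = k}" for k
      by (auto simp: comps_def RC_def)
    have 3: "class_of t (Suc m) e' = \<kappa> \<longleftrightarrow> snd e' [] = snd e [] \<and>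
        (\<forall>k. ccard t {u \<in> kids e'. class_of t m (sub e' u) = k} = ccard t {u \<in> kids e. class_of t m (sub e u) = k})" for e'
      unfolding e(2) class_of_eq_iff sim_Suc_class ..
    show ?thesis
      unfolding 1 2 forest_class.simps mem_Collect_eq
    proof
      assume "\<exists>e'. \<kappa> = class_of t (Suc m) e' \<and> e' \<in> ctrees (labels K d) \<and> snd e' [] = elabel G as \<and>
         (\<forall>C\<in>?cs. ?R C \<noteq> {}) \<and> (\<forall>\<kappa>\<in>classes m. ccard t {C \<in> ?cs. pick (?R C) = \<kappa>} =
            ccard t {w \<in> kids e'. class_of t m (sub e' w) = \<kappa>})"
      then obtain e' where e': "\<kappa> = class_of t (Suc m) e'" "snd e' [] = elabel G as" "\<forall>C\<in>?cs. ?R C \<noteq> {}"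
        "\<forall>\<kappa>\<in>classes m. ccard t {C \<in> ?cs. pick (?R C) = \<kappa>} = ccard t {w \<in> kids e'. class_of t m (sub e' w) = \<kappa>}"
        by blast
      have "snd e' [] = snd e []" and
        "\<And>k. ccard t {u \<in> kids e'. class_of t m (sub e' u) = k} = ccard t {u \<in> kids e. class_of t m (sub e u) = k}"
        using 3[of e'] e'(1) by simp_all
      then show "elabel G as = snd e [] \<and> (\<forall>C\<in>?cs. ?R C \<noteq> {}) \<and> (\<forall>k\<in>classes m.
          ccard t {C \<in> ?cs. pick (?R C) = k} = ccard t {w \<in> kids e. class_of t m (sub e w) = k})"
        using e' by simp
    next
      assume "elabel G as = snd e [] \<and> (\<forall>C\<in>?cs. ?R C \<noteq> {}) \<and> (\<forall>k\<in>classes m.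
          ccard t {C \<in> ?cs. pick (?R C) = k} = ccard t {w \<in> kids e. class_of t m (sub e w) = k})"
      then show "\<exists>e'. \<kappa> = class_of t (Suc m) e' \<and> e' \<in> ctrees (labels K d) \<and> snd e' [] = elabel G as \<and>
         (\<forall>C\<in>?cs. ?R C \<noteq> {}) \<and> (\<forall>\<kappa>\<in>classes m. ccard t {C \<in> ?cs. pick (?R C) = \<kappa>} =
            ccard t {w \<in> kids e'. class_of t m (sub e' w) = \<kappa>})"
        using e by (intro exI[of _ e]) simp
    qed
  qed
  show ?case
  proof (cases "\<kappa> \<in> classes (Suc m)")
    case True
    then obtain e where e: "e \<in> ctrees (labels K d)" "\<kappa> = class_of t (Suc m) e" unfolding classes_def by blast
    have "fodef (set xs) (\<lambda>G \<sigma>. elabel G (map \<sigma> xs) = snd e [] \<and>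
      \<not> (\<exists>v\<in>pverts G. v \<in> rest G (map \<sigma> xs) \<and> RC G (map \<sigma> xs) v = {}) \<and>
      (\<forall>k\<in>classes m. ccard t (component (parcs G) (rest G (map \<sigma> xs)) `
         {v \<in> rest G (map \<sigma> xs). pick (RC G (map \<sigma> xs) v) = k}) = ccard t {w \<in> kids e. class_of t m (sub e w) = k}))"
      by (intro fodef_conj fodef_not fodef_ball finite_classes_K fodef_elabel cnt empty)
    then show ?thesis by (rule fodef_cong) (rule Suc_iff[OF e, symmetric])
  next
    case False
    then have "\<kappa> \<notin> forest_class (Suc m) G as" for G as using forest_class_classes[of "Suc m"] by blast
    then show ?thesis using fodef_const[of "set xs" False] by (simp del: forest_class.simps)
  qed
qed

end

section \<open>Bounded tree depth implies equal expressive power\<close>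

primrec so_of_fo :: "fo \<Rightarrow> so" where
  "so_of_fo (FOEq x y) = SOEq x y"
| "so_of_fo (FOEdge x y) = SOEdge x y"
| "so_of_fo (FONot \<phi>) = SONot (so_of_fo \<phi>)"
| "so_of_fo (FOAnd \<phi> \<psi>) = SOAnd (so_of_fo \<phi>) (so_of_fo \<psi>)"
| "so_of_fo (FOEx x \<phi>) = SOEx x (so_of_fo \<phi>)"

lemma gso_sat_so_of_fo: "gso_sat G \<sigma> \<rho> (so_of_fo \<phi>) \<longleftrightarrow> fo_sat G \<sigma> \<phi>"
  by (induction \<phi> arbitrary: \<sigma>) auto

lemma free_so_of_fo: "so_free (so_of_fo \<phi>) = fo_free \<phi>" "so_free_rel (so_of_fo \<phi>) = {}"
  by (induction \<phi>) auto

lemma FO_at_most_GSO: "at_most_expressive \<C> FO GSO"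
  unfolding at_most_expressive_def FO_def GSO_def
proof (clarsimp, intro exI conjI)
  fix \<phi> assume "fo_free \<phi> = {}"
  then show "so_free (so_of_fo \<phi>) = {}" by (simp add: free_so_of_fo)
  show "so_free_rel (so_of_fo \<phi>) = {}" by (simp add: free_so_of_fo)
  show "{S \<in> \<C>. fo_models S \<phi>} = {S \<in> \<C>. gso_models S (so_of_fo \<phi>)}"
    by (simp add: fo_models_def gso_models_def gso_sat_so_of_fo)
qed

lemma fo_sat_cong: "(\<And>x. x \<in> fo_free \<phi> \<Longrightarrow> \<sigma> x = \<tau> x) \<Longrightarrow> fo_sat G \<sigma> \<phi> \<longleftrightarrow> fo_sat G \<tau> \<phi>"
proof (induction \<phi> arbitrary: \<sigma> \<tau>)
  case (FOAnd \<phi> \<psi>)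
  then show ?case by (metis UnCI fo_free.simps(4) fo_sat.simps(4))
next
  case (FOEx x \<phi>)
  have "fo_sat G (\<sigma>(x := a)) \<phi> \<longleftrightarrow> fo_sat G (\<tau>(x := a)) \<phi>" for a
    by (rule FOEx.IH) (use FOEx.prems in auto)
  then show ?case by simp
next
  case (FONot \<phi>)
  then show ?case by (metis fo_free.simps(3) fo_sat.simps(3))
qed auto

lemma induced_pverts:
  assumes "simple_graph G"
  shows "induced G (pverts G) = G"
proof -
  interpret pair_bidirected_digraph G using assms by (simp add: simple_graph_def)
  have "parcs G \<subseteq> pverts G \<times> pverts G" using in_arcsD1 in_arcsD2 by auto
  then have "parcs G \<inter> pverts G \<times> pverts G = parcs G" by blast
  then show ?thesis by (simp add: induced_def)
qed

theorem bounded_tree_depth_same_power: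
  fixes \<C> :: "'a pair_pre_digraph set"
  assumes simple: "\<And>G. G \<in> \<C> \<Longrightarrow> simple_graph G" and d: "\<And>G. G \<in> \<C> \<Longrightarrow> tree_depth G \<le> enat d"
  shows "at_most_expressive \<C> GSO FO"
  unfolding at_most_expressive_def
proof
  fix \<phi> assume "\<phi> \<in> fst (GSO :: ('a pair_pre_digraph, so) logic)"
  then have \<phi>: "so_free \<phi> = {}" "so_free_rel \<phi> = {}" by (simp_all add: GSO_def)
  obtain t K where t: "0 < t" "finite K" and transfer: "\<forall>(G :: 'a pair_pre_digraph) T G' T'.
    simple_graph G \<and> simple_graph G' \<and> elimination G d T \<and> elimination G' d T' \<and>
    sim t d (T, label K (edge_structure G)) (T', label K (edge_structure G')) \<longrightarrow> gso_models G \<phi> \<longrightarrow> gso_models G' \<phi>"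
    using gso_models_transfer[OF \<phi>, of d, where 'a = 'a] by blast
  have sym: "sym (parcs G)" if "G \<in> \<C>" for G
  proof -
    interpret pair_bidirected_digraph G using simple[OF that] by (simp add: simple_graph_def)
    show ?thesis using pair_sym_arcs by (simp add: symmetric_def)
  qed
  have elim_depth_le: "\<forall>C\<in>comps (parcs G) (pverts G). elim_depth_le (parcs G) d C" if "G \<in> \<C>" for G
    using tree_depth_elim_depth_le[OF sym[OF that], of "pverts G" d] d[OF that] induced_pverts[OF simple[OF that]] by simp
  have "length ps \<le> 2 ^ d" if G: "G \<in> \<C>" and ps: "path (parcs G) ps" "set ps \<subseteq> pverts G" for G ps
  proof (cases ps)
    case (Cons x qs)
    have "set ps \<subseteq> component (parcs G) (pverts G) x" using path_subset_component[of "parcs G" x qs] ps Cons by simp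
    moreover have "component (parcs G) (pverts G) x \<in> comps (parcs G) (pverts G)"
      using ps(2) Cons by (simp add: comps_def)
    ultimately show ?thesis using elim_depth_le_path_length[OF _ ps(1)] elim_depth_le[OF G] by (meson less_imp_le)
  qed simp
  then interpret branch_types \<C> "2 ^ d" K d t
    using simple t(2) by unfold_locales auto
  \<comment> \<open>The sentence says that the graph admits a class that some model of
    \<open>\<phi>\<close> in the collection also admits. Sharing a class makes two forests similar,
    hence the graphs agree on \<open>\<phi>\<close>.\<close>
  define Good where "Good = {\<kappa> \<in> classes d. \<exists>G\<in>\<C>. gso_models G \<phi> \<and> \<kappa> \<in> forest_class d G []}"
  have "fodef {} (\<lambda>G \<sigma>. \<kappa> \<in> forest_class d G [])" for \<kappa> using fodef_forest_class[of "[]" \<kappa> d] by simp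
  then have "fodef {} (\<lambda>G \<sigma>. \<exists>\<kappa>\<in>Good. \<kappa> \<in> forest_class d G [])"
    by (intro fodef_bex) (use finite_classes_K[of d] in \<open>auto simp: Good_def\<close>)
  then obtain \<psi> where \<psi>: "fo_free \<psi> = {}"
    "\<forall>G\<in>\<C>. \<forall>\<sigma>. range \<sigma> \<subseteq> pverts G \<longrightarrow> (fo_sat G \<sigma> \<psi> \<longleftrightarrow> (\<exists>\<kappa>\<in>Good. \<kappa> \<in> forest_class d G []))"
    unfolding fodef_def by auto
  have real: "\<exists>T. elimination G d T \<and> class_of t d (T, label K (edge_structure G)) = \<kappa>"
    if "G \<in> \<C>" "\<kappa> \<in> forest_class d G []" for G \<kappa>
    using forest_class_realize[OF that(1) _ _ that(2)] induced_pverts[OF simple[OF that(1)]]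
    by (simp add: live_def rest_def elabel_def)
  have "gso_models G \<phi> \<longleftrightarrow> fo_models G \<psi>" if G: "G \<in> \<C>" for G
  proof -
    have "forest_class d G [] \<noteq> {}"
      using forest_class_nonempty[OF G, of "[]" d] elim_depth_le[OF G] by (simp add: live_def rest_def)
    then obtain \<kappa> where \<kappa>: "\<kappa> \<in> forest_class d G []" by blast
    obtain v where "v \<in> pverts G" using simple[OF G] by (auto simp: simple_graph_def)
    then have "range (\<lambda>_ :: nat. v) \<subseteq> pverts G" by auto
    then have fo: "fo_models G \<psi> \<longleftrightarrow> (\<exists>\<kappa>\<in>Good. \<kappa> \<in> forest_class d G [])"
      using \<psi>(2) G unfolding fo_models_def by blast
    show ?thesis
      unfolding fo
    proof
      assume "gso_models G \<phi>"
      then show "\<exists>\<kappa>\<in>Good. \<kappa> \<in> forest_class d G []" using \<kappa> G forest_class_classes unfolding Good_def by blast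
    next
      assume "\<exists>\<kappa>\<in>Good. \<kappa> \<in> forest_class d G []"
      then obtain k H where k: "k \<in> forest_class d G []" and H: "H \<in> \<C>" "gso_models H \<phi>" "k \<in> forest_class d H []"
        unfolding Good_def by blast
      obtain T where T: "elimination G d T" "class_of t d (T, label K (edge_structure G)) = k" using real[OF G k] by blast
      obtain S where S: "elimination H d S" "class_of t d (S, label K (edge_structure H)) = k" using real[OF H(1,3)] by blast
      have "sim t d (S, label K (edge_structure H)) (T, label K (edge_structure G))"
        using S(2) T(2) class_of_eq_iff by metis
      then show "gso_models G \<phi>" using transfer simple H G S(1) T(1) by blast
    qed
  qed
  then show "\<exists>\<psi>\<in>fst (FO :: ('a pair_pre_digraph, fo) logic).
      {S \<in> \<C>. snd GSO S \<phi>} = {S \<in> \<C>. snd FO S \<psi>}"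
    using \<psi>(1) by (intro bexI[of _ \<psi>]) (auto simp: FO_def GSO_def)
qed

section \<open>Unavoidable induced subgraphs of graphs with long paths\<close>

definition path_pattern :: "nat \<Rightarrow> nat \<Rightarrow> bool" where
  "path_pattern i j \<longleftrightarrow> j = Suc i \<or> i = Suc j"

definition clique_pattern :: "nat \<Rightarrow> nat \<Rightarrow> bool" where
  "clique_pattern i j \<longleftrightarrow> i \<noteq> j"

text \<open>The sides are numbered alternately. Thus every initial segment is balanced up to one
  vertex and consecutive vertices are adjacent, as in the other two patterns.\<close>

definition biclique_pattern :: "nat \<Rightarrow> nat \<Rightarrow> bool" where
  "biclique_pattern i j \<longleftrightarrow> odd (i + j)"

definition patterns :: "(nat \<Rightarrow> nat \<Rightarrow> bool) set" where
  "patterns = {path_pattern, clique_pattern, biclique_pattern}"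

definition realizes :: "('b \<Rightarrow> 'b \<Rightarrow> bool) \<Rightarrow> 'b set \<Rightarrow> nat \<Rightarrow> (nat \<Rightarrow> nat \<Rightarrow> bool) \<Rightarrow> (nat \<Rightarrow> 'b) \<Rightarrow> bool" where
  "realizes adj V r p v \<longleftrightarrow> inj_on v {..<r} \<and> v ` {..<r} \<subseteq> V \<and>
     (\<forall>i<r. \<forall>j<r. i \<noteq> j \<longrightarrow> (adj (v i) (v j) \<longleftrightarrow> p i j))"

lemma realizes_mono: "realizes adj V r p v \<Longrightarrow> V \<subseteq> W \<Longrightarrow> realizes adj W r p v"
  by (auto simp: realizes_def)

section \<open>Increasing paths in a numbered graph\<close>

definition incr :: "(nat \<Rightarrow> nat \<Rightarrow> bool) \<Rightarrow> nat set \<Rightarrow> nat rel" where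
  "incr adj S = {(a, b). a < b \<and> adj a b \<and> a \<in> S \<and> b \<in> S}"

lemma incr_path_sorted:
  assumes "successively (\<lambda>a b. (a, b) \<in> incr adj S) ys"
  shows "sorted_wrt (<) ys"
proof -
  have "successively (<) ys" by (rule successively_mono[OF assms]) (auto simp: incr_def)
  then show ?thesis by (simp add: successively_conv_sorted_wrt)
qed

text \<open>A shortest increasing path is induced.\<close>

lemma incr_induced_path:
  assumes "(x, y) \<in> (incr adj S)\<^sup>*"
  shows "\<exists>ys. ys \<noteq> [] \<and> hd ys = x \<and> last ys = y \<and> successively (\<lambda>a b. (a, b) \<in> incr adj S) ys \<and>
    (\<forall>a b. a < b \<and> b < length ys \<longrightarrow> (adj (ys ! a) (ys ! b) \<longleftrightarrow> b = Suc a))"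
proof -
  define P where "P ys \<longleftrightarrow> ys \<noteq> [] \<and> hd ys = x \<and> last ys = y \<and> successively (\<lambda>a b. (a, b) \<in> incr adj S) ys" for ys
  have "\<exists>ys. ys \<noteq> [] \<and> hd ys = x \<and> last ys = y \<and> successively (\<lambda>a b. (a, b) \<in> incr adj S) ys"
    using assms
  proof (induction rule: rtrancl_induct)
    case base
    then show ?case by (intro exI[of _ "[x]"]) simp
  next
    case (step y z)
    then obtain ys where "ys \<noteq> []" "hd ys = x" "last ys = y" "successively (\<lambda>a b. (a, b) \<in> incr adj S) ys"
      by blast
    then show ?case using step(2)
      by (intro exI[of _ "ys @ [z]"]) (auto simp: successively_append_iff)
  qed
  then have "\<exists>ys. P ys" unfolding P_def .
  then obtain ys where ys: "P ys" and min: "\<And>zs. P zs \<Longrightarrow> length ys \<le> length zs"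
    using ex_has_least_nat[of P _ length] by metis
  have succ: "(ys ! i, ys ! Suc i) \<in> incr adj S" if "Suc i < length ys" for i
  proof -
    have "successively (\<lambda>a b. (a, b) \<in> incr adj S) ys" using ys by (simp add: P_def)
    then show ?thesis using that by (rule successively_nth)
  qed
  have yS: "sorted_wrt (<) ys" using ys incr_path_sorted unfolding P_def by blast
  have "adj (ys ! a) (ys ! b) \<longleftrightarrow> b = Suc a" if ab: "a < b" "b < length ys" for a b
  proof
    assume "b = Suc a"
    then have "(ys ! a, ys ! b) \<in> incr adj S"
      using succ ab by simp
    then show "adj (ys ! a) (ys ! b)" by (simp add: incr_def)
  next
    assume adj: "adj (ys ! a) (ys ! b)"
    show "b = Suc a"
    proof (rule ccontr)
      assume ne: "b \<noteq> Suc a"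
      \<comment> \<open>A chord from position \<open>a\<close> to position \<open>b\<close> gives a
        shorter increasing path, against minimality.\<close>
      let ?zs = "take (Suc a) ys @ drop b ys"
      have split: "successively (\<lambda>a b. (a, b) \<in> incr adj S) (take k ys)"
        "successively (\<lambda>a b. (a, b) \<in> incr adj S) (drop k ys)" for k
      proof -
        have "successively (\<lambda>a b. (a, b) \<in> incr adj S) (take k ys @ drop k ys)"
          using ys by (simp add: P_def)
        then show "successively (\<lambda>a b. (a, b) \<in> incr adj S) (take k ys)"
          "successively (\<lambda>a b. (a, b) \<in> incr adj S) (drop k ys)"
          unfolding successively_append_iff by blast+
      qed
      have S: "ys ! i \<in> S" if i: "i < length ys" for i
      proof (cases "Suc i < length ys")
        case True
        then show ?thesis using succ[of i] by (simp add: incr_def)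
      next
        case False
        then obtain k where k: "i = Suc k" "Suc k < length ys" using ab i by (cases i) auto
        then show ?thesis using succ[of k] by (simp add: incr_def)
      qed
      have "ys ! a < ys ! b" using yS ab by (simp add: sorted_wrt_nth_less)
      then have "(ys ! a, ys ! b) \<in> incr adj S" using adj S ab by (simp add: incr_def)
      moreover have "last (take (Suc a) ys) = ys ! a" using ab by (simp add: take_Suc_conv_app_nth)
      moreover have "hd (drop b ys) = ys ! b" using ab by (simp add: hd_drop_conv_nth)
      ultimately have "successively (\<lambda>a b. (a, b) \<in> incr adj S) ?zs"
        using split(1)[of "Suc a"] split(2)[of b] by (simp add: successively_append_iff)
      moreover have "hd ?zs = x" using ys ab by (cases ys) (auto simp: P_def)
      moreover have "last ?zs = y" using ys ab by (simp add: P_def)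
      ultimately have "P ?zs" using ab by (simp add: P_def)
      then show False using min[of ?zs] ab ne by simp
    qed
  qed
  then show ?thesis using ys unfolding P_def by blast
qed

lemma induced_path_realizes:
  fixes ys :: "nat list"
  assumes sym: "\<And>a b. adj a b \<Longrightarrow> adj b a"
    and ys: "sorted_wrt (<) ys" "\<And>a b. a < b \<Longrightarrow> b < length ys \<Longrightarrow> adj (ys ! a) (ys ! b) \<longleftrightarrow> b = Suc a"
    and "r \<le> length ys" "set ys \<subseteq> V"
  shows "realizes adj V r path_pattern ((!) ys)"
proof -
  have "distinct ys" using ys(1) strict_sorted_iff by blast
  then have "inj_on ((!) ys) {..<r}" using assms(4) by (auto simp: inj_on_def nth_eq_iff_index_eq)
  moreover have "adj (ys ! i) (ys ! j) \<longleftrightarrow> path_pattern i j" if "i < r" "j < r" "i \<noteq> j" for i j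
  proof (cases "i < j")
    case True
    then show ?thesis using ys(2)[of i j] that assms(4) by (auto simp: path_pattern_def)
  next
    case False
    then have "adj (ys ! j) (ys ! i) \<longleftrightarrow> i = Suc j" using ys(2)[of j i] that assms(4) by simp
    then show ?thesis using False that sym by (auto simp: path_pattern_def)
  qed
  moreover have "(!) ys ` {..<r} \<subseteq> V" using assms(4,5) by (auto simp: subset_iff)
  ultimately show ?thesis by (simp add: realizes_def)
qed

text \<open>Ramsey's theorem is applied on each side. A clique on either side is a pattern by
  itself; independent sets on both sides form an induced biclique.\<close>

lemma biclique_realizes:
  "\<exists>s. \<forall>adj :: nat \<Rightarrow> nat \<Rightarrow> bool. \<forall>L R. (\<forall>a b. adj a b \<longrightarrow> adj b a) \<and> finite L \<and> finite R \<and> L \<inter> R = {} \<and>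
     s \<le> card L \<and> s \<le> card R \<and> (\<forall>a\<in>L. \<forall>b\<in>R. adj a b) \<longrightarrow> (\<exists>p\<in>patterns. \<exists>v. realizes adj (L \<union> R) r p v)"
proof -
  obtain s :: nat where s: "\<forall>(V :: nat set) (E :: nat set set). finite V \<and> s \<le> card V \<longrightarrow>
      (\<exists>R\<subseteq>V. card R = r \<and> clique R E \<or> card R = r \<and> indep R E)"
    using ramsey2[of r r] by blast
  show ?thesis
  proof (intro exI[of _ s] allI impI, elim conjE)
    fix adj :: "nat \<Rightarrow> nat \<Rightarrow> bool" and L R
    assume sym: "\<forall>a b. adj a b \<longrightarrow> adj b a" and fin: "finite L" "finite R" and dis: "L \<inter> R = {}"
      and card: "s \<le> card L" "s \<le> card R" and all: "\<forall>a\<in>L. \<forall>b\<in>R. adj a b"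
    define E where "E = {{a, b} |a b. adj a b}"
    have E: "{a, b} \<in> E \<longleftrightarrow> adj a b" for a b
      using sym by (auto simp: E_def doubleton_eq_iff)
    have ram: "(\<exists>v. realizes adj V r clique_pattern v) \<or>
        (\<exists>v. inj_on v {..<r} \<and> v ` {..<r} \<subseteq> V \<and> (\<forall>i<r. \<forall>j<r. i \<noteq> j \<longrightarrow> \<not> adj (v i) (v j)))"
      if V: "finite V" "s \<le> card V" for V
    proof -
      obtain A where A: "A \<subseteq> V" "card A = r" "clique A E \<or> indep A E" using s V by blast
      obtain v where v: "bij_betw v {0..<r} A"
        using ex_bij_betw_nat_finite[of A] A(1,2) V(1) finite_subset by metis
      then have inj: "inj_on v {..<r}" "v ` {..<r} = A"
        by (auto simp: bij_betw_def atLeast0LessThan)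
      have ne: "v i \<noteq> v j" "v i \<in> A" "v j \<in> A" if "i < r" "j < r" "i \<noteq> j" for i j
        using that inj by (auto dest: inj_onD)
      from A(3) show ?thesis
      proof
        assume "clique A E"
        then have "realizes adj V r clique_pattern v"
          using inj A(1) ne by (auto simp: realizes_def clique_pattern_def clique_def E)
        then show ?thesis by blast
      next
        assume "indep A E"
        then show ?thesis using inj A(1) ne by (intro disjI2 exI[of _ v]) (auto simp: indep_def E)
      qed
    qed
    show "\<exists>p\<in>patterns. \<exists>v. realizes adj (L \<union> R) r p v"
    proof (cases "\<exists>v. realizes adj L r clique_pattern v \<or> realizes adj R r clique_pattern v")
      case True
      then show ?thesis unfolding patterns_def realizes_def by blast
    next
      case False
      then have "\<nexists>v. realizes adj L r clique_pattern v" "\<nexists>v. realizes adj R r clique_pattern v" by blast+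
      then have "\<exists>v. inj_on v {..<r} \<and> v ` {..<r} \<subseteq> L \<and> (\<forall>i<r. \<forall>j<r. i \<noteq> j \<longrightarrow> \<not> adj (v i) (v j))"
        "\<exists>v. inj_on v {..<r} \<and> v ` {..<r} \<subseteq> R \<and> (\<forall>i<r. \<forall>j<r. i \<noteq> j \<longrightarrow> \<not> adj (v i) (v j))"
        using ram[OF fin(1) card(1)] ram[OF fin(2) card(2)] by simp_all
      then obtain l q where l: "inj_on l {..<r}" "l ` {..<r} \<subseteq> L" "\<forall>i<r. \<forall>j<r. i \<noteq> j \<longrightarrow> \<not> adj (l i) (l j)"
        and q: "inj_on q {..<r}" "q ` {..<r} \<subseteq> R" "\<forall>i<r. \<forall>j<r. i \<noteq> j \<longrightarrow> \<not> adj (q i) (q j)"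
        by (elim exE conjE)
      \<comment> \<open>The two independent sets are interleaved, the left one at even positions, to
        fit \<open>biclique_pattern\<close>.\<close>
      define v where "v i = (if even i then l (i div 2) else q (i div 2))" for i
      have vl: "v i \<in> L" if "i < r" "even i" for i using that l(2) by (auto simp: v_def)
      have vq: "v i \<in> R" if "i < r" "odd i" for i using that q(2) by (auto simp: v_def)
      have half: "i div 2 \<noteq> j div 2" if "i \<noteq> j" "even i = even j" for i j :: nat
      proof
        assume "i div 2 = j div 2"
        then show False
          using that dvd_mult_div_cancel[of 2 i] dvd_mult_div_cancel[of 2 j]
            odd_two_times_div_two_succ[of i] odd_two_times_div_two_succ[of j] by (cases "even i") auto
      qed
      have "inj_on v {..<r}"
      proof (rule inj_onI)
        fix i j assume ij: "i \<in> {..<r}" "j \<in> {..<r}" "v i = v j"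
        then have par: "even i = even j" using vl vq dis by (metis IntI empty_iff lessThan_iff)
        show "i = j"
        proof (rule ccontr)
          assume "i \<noteq> j"
          then have "i div 2 \<noteq> j div 2" using half par by blast
          moreover have "i div 2 \<in> {..<r}" "j div 2 \<in> {..<r}" using ij by auto
          ultimately have "l (i div 2) \<noteq> l (j div 2)" "q (i div 2) \<noteq> q (j div 2)"
            using l(1) q(1) by (meson inj_onD)+
          then show False using ij(3) par by (cases "even i") (simp_all add: v_def)
        qed
      qed
      moreover have "adj (v i) (v j) \<longleftrightarrow> biclique_pattern i j" if ij: "i < r" "j < r" "i \<noteq> j" for i j
      proof (cases "even i = even j")
        case True
        then have "i div 2 \<noteq> j div 2" "i div 2 < r" "j div 2 < r" using half ij by auto
        then show ?thesis using True l(3) q(3) by (auto simp: v_def biclique_pattern_def)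
      next
        case False
        then have "adj (v i) (v j)"
          using vl[of i] vl[of j] vq[of i] vq[of j] all sym ij by (cases "even i") auto
        then show ?thesis using False by (auto simp: biclique_pattern_def)
      qed
      moreover have "v ` {..<r} \<subseteq> L \<union> R" using vl vq by blast
      ultimately have "realizes adj (L \<union> R) r biclique_pattern v" by (simp add: realizes_def)
      then show ?thesis unfolding patterns_def by blast
    qed
  qed
qed

section \<open>The Ramsey argument on a long path\<close>

lemma ramsey_increasing:
  fixes k M :: nat
  shows "\<exists>N. \<forall>f :: nat \<Rightarrow> nat \<Rightarrow> nat \<Rightarrow> nat \<Rightarrow> nat. (\<forall>a b c d. f a b c d < k) \<longrightarrow>
    (\<exists>x i. (\<forall>a b. a < b \<and> b < M \<longrightarrow> x a < x b) \<and> (\<forall>a<M. x a < N) \<and>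
      (\<forall>a b c d. a < b \<and> b < c \<and> c < d \<and> d < M \<longrightarrow> f (x a) (x b) (x c) (x d) = i))"
proof -
  obtain N :: nat where N: "partn_lst {..<N} (replicate k M) 4" using ramsey_full by blast
  show ?thesis
  proof (intro exI[of _ N] allI impI)
    fix f :: "nat \<Rightarrow> nat \<Rightarrow> nat \<Rightarrow> nat \<Rightarrow> nat" assume f: "\<forall>a b c d. f a b c d < k"
    define g where "g A = (let l = sorted_list_of_set A in f (l ! 0) (l ! 1) (l ! 2) (l ! 3))" for A
    have "g \<in> nsets {..<N} 4 \<rightarrow> {..<length (replicate k M)}" using f by (simp add: g_def Let_def)
    then obtain i H where i: "i < k" and H: "H \<in> nsets {..<N} M" "g ` nsets H 4 \<subseteq> {i}"
      using N unfolding partn_lst_def monochromatic_def by fastforce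
    have fin: "finite H" "card H = M" "H \<subseteq> {..<N}" using H(1) by (auto simp: nsets_def)
    define l where "l = sorted_list_of_set H"
    have l: "sorted_wrt (<) l" "set l = H" "length l = M" using fin by (simp_all add: l_def)
    have mono: "l ! a < l ! b" if "a < b" "b < M" for a b
      using that l sorted_wrt_nth_less by blast
    have "f (l ! a) (l ! b) (l ! c) (l ! d) = i" if "a < b" "b < c" "c < d" "d < M" for a b c d
    proof -
      let ?A = "{l ! a, l ! b, l ! c, l ! d}"
      have lt: "l ! a < l ! b" "l ! b < l ! c" "l ! c < l ! d" using mono that by simp_all
      then have "sorted_list_of_set (set [l ! a, l ! b, l ! c, l ! d]) = [l ! a, l ! b, l ! c, l ! d]"
        by (intro sorted_list_of_set.idem_if_sorted_distinct) auto
      then have srt: "sorted_list_of_set ?A = [l ! a, l ! b, l ! c, l ! d]" by simp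
      have "?A \<subseteq> H" using that l(2,3) nth_mem[of _ l] by auto
      moreover have "card ?A = 4" using lt by simp
      ultimately have "?A \<in> nsets H 4" by (simp add: nsets_def)
      then have "g ?A = i" using H(2) by blast
      then show ?thesis by (simp add: g_def srt numeral_eq_Suc)
    qed
    moreover have "l ! a < N" if "a < M" for a using that l(2,3) fin(3) nth_mem[of a l] by auto
    ultimately show "\<exists>x i. (\<forall>a b. a < b \<and> b < M \<longrightarrow> x a < x b) \<and> (\<forall>a<M. x a < N) \<and>
      (\<forall>a b c d. a < b \<and> b < c \<and> c < d \<and> d < M \<longrightarrow> f (x a) (x b) (x c) (x d) = i)"
      using mono by (intro exI[of _ "(!) l"] exI[of _ i]) auto
  qed
qed

theorem traceable_patterns:
  assumes r: "0 < r"
  shows "\<exists>N. \<forall>adj :: nat \<Rightarrow> nat \<Rightarrow> bool. (\<forall>a b. adj a b \<longrightarrow> adj b a) \<and> (\<forall>i. Suc i < N \<longrightarrow> adj i (Suc i)) \<longrightarrow>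
    (\<exists>p\<in>patterns. \<exists>v. realizes adj {..<N} r p v)"
proof -
  obtain s where s: "\<forall>adj :: nat \<Rightarrow> nat \<Rightarrow> bool. \<forall>L R. (\<forall>a b. adj a b \<longrightarrow> adj b a) \<and> finite L \<and> finite R \<and>
     L \<inter> R = {} \<and> s \<le> card L \<and> s \<le> card R \<and> (\<forall>a\<in>L. \<forall>b\<in>R. adj a b) \<longrightarrow>
     (\<exists>p\<in>patterns. \<exists>v. realizes adj (L \<union> R) r p v)"
    using biclique_realizes[of r] by (rule exE)
  \<comment> \<open>The summand \<open>4 * s\<close> provides \<open>2 * s\<close> disjoint blocks,
    half of them for each side of a biclique. The summand \<open>2 * r\<close> makes a path with at
    least \<open>r\<close> vertices necessary when each step advances by at most two of the chosen
    points.\<close>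
  define M where "M = 2 * r + 4 * s"
  obtain N where N: "\<forall>f :: nat \<Rightarrow> nat \<Rightarrow> nat \<Rightarrow> nat \<Rightarrow> nat. (\<forall>a b c d. f a b c d < Suc (r * r)) \<longrightarrow>
    (\<exists>x i. (\<forall>a b. a < b \<and> b < M \<longrightarrow> x a < x b) \<and> (\<forall>a<M. x a < N) \<and>
      (\<forall>a b c d. a < b \<and> b < c \<and> c < d \<and> d < M \<longrightarrow> f (x a) (x b) (x c) (x d) = i))"
    using ramsey_increasing[of "Suc (r * r)" M] by (rule exE)
  show ?thesis
  proof (intro exI[of _ N] allI impI, elim conjE)
    fix adj :: "nat \<Rightarrow> nat \<Rightarrow> bool"
    assume sym: "\<forall>a b. adj a b \<longrightarrow> adj b a" and adj: "\<forall>i. Suc i < N \<longrightarrow> adj i (Suc i)"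
    have reach: "(x, y) \<in> (incr adj {x..y})\<^sup>*" if "x \<le> y" "y < N" for x y
    proof -
      have "(x, x + k) \<in> (incr adj {x..y})\<^sup>*" if "x + k \<le> y" for k
        using that
      proof (induction k)
        case (Suc k)
        then have "(x + k, x + Suc k) \<in> incr adj {x..y}" using adj \<open>y < N\<close> by (simp add: incr_def)
        then show ?case using Suc by (auto intro: rtrancl_into_rtrancl)
      qed simp
      from this[of "y - x"] show ?thesis using \<open>x \<le> y\<close> by simp
    qed
    let ?Q = "\<lambda>x y ys. ys \<noteq> [] \<and> hd ys = x \<and> last ys = y \<and> successively (\<lambda>a b. (a, b) \<in> incr adj {x..y}) ys \<and>
      (\<forall>a b. a < b \<and> b < length ys \<longrightarrow> (adj (ys ! a) (ys ! b) \<longleftrightarrow> b = Suc a))"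
    define Q where "Q x y = (SOME ys. ?Q x y ys)" for x y
    have Q: "?Q x y (Q x y)" if "x \<le> y" "y < N" for x y
      unfolding Q_def by (rule someI_ex) (rule incr_induced_path[OF reach[OF that]])
    have Qset: "set (Q x y) \<subseteq> {x..y}" if "x < y" "y < N" for x y
    proof -
      have q: "?Q x y (Q x y)" using Q that by simp
      have "i \<in> {x..y}" if "i \<in> set ys" "successively (\<lambda>a b. (a, b) \<in> incr adj {x..y}) ys" "hd ys = x" for i ys
        using that(2,1,3)
      proof (induction ys rule: rev_induct)
        case (snoc z zs)
        show ?case
        proof (cases "zs = []")
          case False
          then have "z \<in> {x..y}" using snoc.prems by (auto simp: successively_append_iff incr_def)
          then show ?thesis using snoc False by (auto simp: successively_append_iff)
        qed (use snoc \<open>x < y\<close> in auto)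
      qed simp
      then show ?thesis using q by blast
    qed
    show "\<exists>p\<in>patterns. \<exists>v. realizes adj {..<N} r p v"
    proof (cases "\<exists>x y. x < y \<and> y < N \<and> r \<le> length (Q x y)")
      case True
      then obtain x y where xy: "x < y" "y < N" "r \<le> length (Q x y)" by blast
      have q: "?Q x y (Q x y)" using Q xy by simp
      have "realizes adj {..<N} r path_pattern ((!) (Q x y))"
        by (rule induced_path_realizes)
          (use q sym xy incr_path_sorted Qset[OF xy(1,2)] in \<open>auto simp: subset_iff\<close>)
      then show ?thesis unfolding patterns_def by blast
    next
      case False
      then have Qlen: "length (Q x y) < r" if "x < y" "y < N" for x y using that by (meson not_le)
      \<comment> \<open>A number \<open>p\<close> below \<open>r * r\<close> encodes a position on
        each of the two paths; the remaining colour \<open>r * r\<close> says that no vertex of one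
        is adjacent to a vertex of the other.\<close>
      define edge where "edge a b c d p \<longleftrightarrow> p < r * r \<and> p div r < length (Q a b) \<and> p mod r < length (Q c d) \<and>
          adj (Q a b ! (p div r)) (Q c d ! (p mod r))" for a b c d p
      define f where "f a b c d = (if \<exists>p. edge a b c d p then SOME p. edge a b c d p else r * r)" for a b c d
      have f_edge: "edge a b c d (f a b c d)" if "f a b c d \<noteq> r * r" for a b c d
        using that someI_ex[of "edge a b c d"] by (auto simp: f_def split: if_splits)
      have "f a b c d < Suc (r * r)" for a b c d
        using f_edge[of a b c d] by (cases "f a b c d = r * r") (auto simp: edge_def)
      then obtain x i where x: "\<forall>a b. a < b \<and> b < M \<longrightarrow> x a < x b" "\<forall>a<M. x a < N"
        and hom: "\<forall>a b c d. a < b \<and> b < c \<and> c < d \<and> d < M \<longrightarrow> f (x a) (x b) (x c) (x d) = i"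
        using N by blast
      have block: "x a < x b" "x b < N" if "a < b" "b < M" for a b using x that by auto
      have Qblock: "set (Q (x a) (x b)) \<subseteq> {x a..x b}" if "a < b" "b < M" for a b
        by (rule Qset[OF block[OF that]])
      have Qblock_length: "length (Q (x a) (x b)) < r" if "a < b" "b < M" for a b
        by (rule Qlen[OF block[OF that]])
      have xle: "x a \<le> x b \<longleftrightarrow> a \<le> b" if "a < M" "b < M" for a b
        using x(1) that by (metis leD leI le_eq_less_or_eq)
      show ?thesis
      proof (cases "i = r * r")
        case False
        \<comment> \<open>The common colour fixes positions that are adjacent for any two blocks in
          this order, so \<open>A k\<close> is adjacent to \<open>B l\<close> for all
          \<open>k < l\<close>. Taking \<open>A\<close> from the lower half of the blocks and
          \<open>B\<close> from the upper half gives a complete bipartite graph.\<close>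
        define A where "A k = Q (x (2 * k)) (x (2 * k + 1)) ! (i div r)" for k
        define B where "B k = Q (x (2 * k)) (x (2 * k + 1)) ! (i mod r)" for k
        have e: "edge (x (2 * k)) (x (2 * k + 1)) (x (2 * l)) (x (2 * l + 1)) i" if "k < l" "l < 2 * s" for k l
          using f_edge[of "x (2 * k)" "x (2 * k + 1)" "x (2 * l)" "x (2 * l + 1)"]
            hom[rule_format, of "2 * k" "2 * k + 1" "2 * l" "2 * l + 1"] False that r by (simp add: M_def)
        have AB: "adj (A k) (B l)" if "k < l" "l < 2 * s" for k l
          using e[OF that] by (simp add: edge_def A_def B_def)
        have A: "A k \<in> {x (2 * k)..x (2 * k + 1)}" if "k < s" for k
        proof -
          have "A k \<in> set (Q (x (2 * k)) (x (2 * k + 1)))"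
            using e[of k s] that by (simp add: edge_def A_def)
          moreover have "2 * k + 1 < M" using that r by (simp add: M_def)
          ultimately show ?thesis using Qblock[of "2 * k" "2 * k + 1"] by auto
        qed
        have B: "B k \<in> {x (2 * k)..x (2 * k + 1)}" if "s \<le> k" "k < 2 * s" for k
        proof -
          have "0 < k" using that by linarith
          then have "B k \<in> set (Q (x (2 * k)) (x (2 * k + 1)))"
            using e[of 0 k] that by (simp add: edge_def B_def)
          moreover have "2 * k + 1 < M" using that r by (simp add: M_def)
          ultimately show ?thesis using Qblock[of "2 * k" "2 * k + 1"] by auto
        qed
        have sep: "x (2 * k + 1) < x (2 * l)" if "k < l" "l < 2 * s" for k l
          using block(1)[of "2 * k + 1" "2 * l"] that r by (simp add: M_def)
        have "inj_on A {..<s}"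
        proof (rule linorder_inj_onI)
          fix k l assume "k < l" "k \<in> {..<s}" "l \<in> {..<s}"
          then have "A k < A l" using A[of k] A[of l] sep[of k l] by auto
          then show "A k \<noteq> A l" by simp
        qed auto
        then have cA: "card (A ` {..<s}) = s" by (simp add: card_image)
        have "inj_on B {s..<2 * s}"
        proof (rule linorder_inj_onI)
          fix k l assume "k < l" "k \<in> {s..<2 * s}" "l \<in> {s..<2 * s}"
          then have "B k < B l" using B[of k] B[of l] sep[of k l] by auto
          then show "B k \<noteq> B l" by simp
        qed auto
        then have cB: "card (B ` {s..<2 * s}) = s" by (simp add: card_image)
        have lt: "A k < B l" if "k < s" "s \<le> l" "l < 2 * s" for k l
          using A[of k] B[of l] sep[of k l] that by auto
        have "\<exists>p\<in>patterns. \<exists>v. realizes adj (A ` {..<s} \<union> B ` {s..<2 * s}) r p v" (is "\<exists>p\<in>_. \<exists>v. realizes _ ?U _ _ _")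
        proof (intro s[rule_format] conjI ballI)
          show "A ` {..<s} \<inter> B ` {s..<2 * s} = {}" using lt by fastforce
          show "adj a b" if "a \<in> A ` {..<s}" "b \<in> B ` {s..<2 * s}" for a b
            using that AB by auto
        qed (use sym cA cB in auto)
        then obtain p v where p: "p \<in> patterns" "realizes adj ?U r p v" by (elim bexE exE)
        have "?U \<subseteq> {..<N}"
        proof -
          have "A k < N" if "k < s" for k
            using A[OF that] block(2)[of "2 * k" "2 * k + 1"] that r by (auto simp: M_def)
          moreover have "B k < N" if "s \<le> k" "k < 2 * s" for k
            using B[OF that] block(2)[of "2 * k" "2 * k + 1"] that r by (auto simp: M_def)
          ultimately show ?thesis by auto
        qed
        then have "realizes adj {..<N} r p v" by (rule realizes_mono[OF p(2)])
        then show ?thesis using p(1) by (intro bexI exI)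
      next
        case True
        let ?B = "\<lambda>k. set (Q (x k) (x (Suc k)))"
        have no_edge: "\<not> adj u w" if kl: "Suc k < l" "Suc l < M" "u \<in> ?B k" "w \<in> ?B l" for k l u w
        proof
          assume uw: "adj u w"
          obtain a where a: "a < length (Q (x k) (x (Suc k)))" "u = Q (x k) (x (Suc k)) ! a"
            using kl(3) by (metis in_set_conv_nth)
          obtain b where b: "b < length (Q (x l) (x (Suc l)))" "w = Q (x l) (x (Suc l)) ! b"
            using kl(4) by (metis in_set_conv_nth)
          have ab: "a < r" "b < r"
            using a(1) b(1) Qblock_length[of k "Suc k"] Qblock_length[of l "Suc l"] kl by auto
          define p where "p = a * r + b"
          have p: "p div r = a" "p mod r = b" using ab by (simp_all add: p_def)
          have "a * r + b < Suc a * r" using ab by simp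
          also have "\<dots> \<le> r * r" using ab by (intro mult_le_mono1) simp
          finally have pe: "edge (x k) (x (Suc k)) (x l) (x (Suc l)) p"
            using a b uw by (simp add: edge_def p) (simp add: p_def)
          then have "edge (x k) (x (Suc k)) (x l) (x (Suc l)) (f (x k) (x (Suc k)) (x l) (x (Suc l)))"
            unfolding f_def using someI[of "edge (x k) (x (Suc k)) (x l) (x (Suc l))"] by auto
          moreover have "f (x k) (x (Suc k)) (x l) (x (Suc l)) = r * r"
            using hom[rule_format, of k "Suc k" l "Suc l"] kl True by simp
          ultimately show False by (simp add: edge_def)
        qed
        \<comment> \<open>\<open>S\<close> collects the paths between successive chosen points.
          Adjacent vertices of \<open>S\<close> lie in the same or in neighbouring blocks, so an
          increasing path through \<open>S\<close> cannot skip a block.\<close>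
        define S where "S = (\<Union>k<M - 1. ?B k)"
        have M: "2 * r \<le> M" "0 < M" using r by (simp_all add: M_def)
        have "(x 0, x k) \<in> (incr adj S)\<^sup>*" if "k < M" for k
          using that
        proof (induction k)
          case (Suc k)
          have q: "?Q (x k) (x (Suc k)) (Q (x k) (x (Suc k)))"
            using Q[of "x k" "x (Suc k)"] block[of k "Suc k"] Suc.prems by simp
          have "(hd ys, last ys) \<in> (incr adj S)\<^sup>*"
            if "successively (\<lambda>a b. (a, b) \<in> incr adj T) ys" "set ys \<subseteq> S" "ys \<noteq> []" for ys T
            using that
          proof (induction ys rule: rev_induct)
            case (snoc z zs)
            show ?case
            proof (cases "zs = []")
              case False
              then have "(last zs, z) \<in> incr adj S"
                using snoc.prems last_in_set[OF False] by (auto simp: successively_append_iff incr_def)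
              moreover have "(hd zs, last zs) \<in> (incr adj S)\<^sup>*"
                using snoc False by (auto simp: successively_append_iff)
              ultimately show ?thesis using False by (auto intro: rtrancl_into_rtrancl)
            qed simp
          qed simp
          moreover have "?B k \<subseteq> S" unfolding S_def by (rule UN_upper) (use Suc.prems in simp)
          ultimately have "(x k, x (Suc k)) \<in> (incr adj S)\<^sup>*" using q by metis
          then show ?case using Suc by (meson Suc_lessD rtrancl_trans)
        qed simp
        then have "(x 0, x (M - 1)) \<in> (incr adj S)\<^sup>*" using M by simp
        then obtain ys where ys: "ys \<noteq> []" "hd ys = x 0" "last ys = x (M - 1)"
          "successively (\<lambda>a b. (a, b) \<in> incr adj S) ys"
          "\<forall>a b. a < b \<and> b < length ys \<longrightarrow> (adj (ys ! a) (ys ! b) \<longleftrightarrow> b = Suc a)"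
          using incr_induced_path by blast
        \<comment> \<open>A vertex not above \<open>x k\<close> starts its block at
          \<open>x k\<close> at the latest; the next vertex of the path is at most one block further
          and hence not above \<open>x (k + 2)\<close>.\<close>
        have slow: "\<exists>k\<le>2 * l. k < M \<and> ys ! l \<le> x k" if "l < length ys" for l
          using that
        proof (induction l)
          case 0
          then show ?case using ys(1,2) M by (intro exI[of _ 0]) (simp add: hd_conv_nth)
        next
          case (Suc l)
          then obtain k where k: "k \<le> 2 * l" "k < M" "ys ! l \<le> x k" by auto
          have st: "(ys ! l, ys ! Suc l) \<in> incr adj S"
            using ys(4) Suc.prems by (rule successively_nth)
          then obtain a b where a: "a < M - 1" "ys ! l \<in> ?B a" and b: "b < M - 1" "ys ! Suc l \<in> ?B b"
            by (auto simp: incr_def S_def)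
          then have lt: "Suc a < M" "Suc b < M" by simp_all
          have "x a \<le> ys ! l" using lt a Qblock[of a "Suc a"] by auto
          then have "a \<le> k" using k xle[of a k] a(1) by simp
          moreover have "b \<le> Suc a"
          proof (rule ccontr)
            assume "\<not> b \<le> Suc a"
            then show False using no_edge[of a b] a b st by (auto simp: incr_def)
          qed
          ultimately have "Suc b \<le> 2 * Suc l" using k(1) by simp
          moreover have "ys ! Suc l \<le> x (Suc b)" using lt b Qblock[of b "Suc b"] by auto
          ultimately show ?case using b(1) by (intro exI[of _ "Suc b"]) simp
        qed
        obtain k where k: "k \<le> 2 * (length ys - 1)" "k < M" "last ys \<le> x k"
          using slow[of "length ys - 1"] ys(1) by (auto simp: last_conv_nth)
        then have "M - 1 \<le> k" using xle[of "M - 1" k] ys(3) M by simp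
        then have len: "r \<le> length ys" using k(1) M by simp
        have "realizes adj {..<N} r path_pattern ((!) ys)"
        proof (rule induced_path_realizes)
          show "sorted_wrt (<) ys" using incr_path_sorted[OF ys(4)] .
          show "set ys \<subseteq> {..<N}"
          proof
            fix y assume "y \<in> set ys"
            then obtain l where "l < length ys" "y = ys ! l" by (metis in_set_conv_nth)
            then obtain k where "k < M" "y \<le> x k" using slow by blast
            then show "y \<in> {..<N}" using x(2) by (auto intro: le_less_trans)
          qed
        qed (use sym ys(5) len in auto)
        then show ?thesis unfolding patterns_def by blast
      qed
    qed
  qed
qed

section \<open>Separating first-order from guarded second-order logic\<close>

primrec fo_rank :: "fo \<Rightarrow> nat" where
  "fo_rank (FOEq x y) = 0"
| "fo_rank (FOEdge x y) = 0"
| "fo_rank (FONot \<phi>) = fo_rank \<phi>"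
| "fo_rank (FOAnd \<phi> \<psi>) = max (fo_rank \<phi>) (fo_rank \<psi>)"
| "fo_rank (FOEx x \<phi>) = Suc (fo_rank \<phi>)"

lemma finite_fo_free: "finite (fo_free \<phi>)"
  by (induction \<phi>) auto

definition pattern_graph :: "(nat \<Rightarrow> nat \<Rightarrow> bool) \<Rightarrow> nat \<Rightarrow> nat pair_pre_digraph" where
  "pattern_graph p n = \<lparr>pverts = {..<n}, parcs = {(i, j). i < n \<and> j < n \<and> i \<noteq> j \<and> p i j}\<rparr>"

lemma pattern_graph_simps [simp]:
  "pverts (pattern_graph p n) = {..<n}"
  "(i, j) \<in> parcs (pattern_graph p n) \<longleftrightarrow> i < n \<and> j < n \<and> i \<noteq> j \<and> p i j"
  by (simp_all add: pattern_graph_def)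

lemma fo_sat_pattern_graph:
  assumes "realizes (\<lambda>x y. (x, y) \<in> parcs G) V r p w" "n \<le> r" "\<And>x. (x, x) \<notin> parcs G"
    and "\<And>x. s x < n"
  shows "fo_sat (induced G (w ` {..<n})) (w \<circ> s) \<phi> \<longleftrightarrow> fo_sat (pattern_graph p n) s \<phi>"
  using assms(4)
proof (induction \<phi> arbitrary: s)
  case (FOEq x y)
  have "inj_on w {..<r}" using assms(1) by (simp add: realizes_def)
  moreover have "s x \<in> {..<r}" "s y \<in> {..<r}" using FOEq[of x] FOEq[of y] assms(2) by auto
  ultimately show ?case by (auto dest: inj_onD)
next
  case (FOEdge x y)
  have lt: "s x < n" "s y < n" "s x < r" "s y < r" using FOEdge[of x] FOEdge[of y] assms(2) by auto
  have "(w (s x), w (s y)) \<in> parcs G \<longleftrightarrow> s x \<noteq> s y \<and> p (s x) (s y)"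
    using assms(1,3) lt by (cases "s x = s y") (auto simp: realizes_def)
  then show ?case using lt by (auto simp: induced_def)
next
  case (FOEx x \<phi>)
  have "fo_sat (induced G (w ` {..<n})) ((w \<circ> s)(x := w i)) \<phi> \<longleftrightarrow> fo_sat (pattern_graph p n) (s(x := i)) \<phi>"
    if "i < n" for i
  proof -
    have "(s(x := i)) y < n" for y using FOEx.prems that by simp
    then have "fo_sat (induced G (w ` {..<n})) (w \<circ> s(x := i)) \<phi> \<longleftrightarrow> fo_sat (pattern_graph p n) (s(x := i)) \<phi>"
      by (rule FOEx.IH)
    moreover have "w \<circ> s(x := i) = (w \<circ> s)(x := w i)" by auto
    ultimately show ?thesis by (simp only:)
  qed
  then show ?case unfolding fo_sat.simps pverts_induced pattern_graph_simps by blast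
qed auto

subsection \<open>Games on paths\<close>

text \<open>Differences below \<open>K\<close> in absolute value are known exactly, of larger ones
  only the sign.\<close>

definition close :: "int \<Rightarrow> int \<Rightarrow> int \<Rightarrow> bool" where
  "close K z z' \<longleftrightarrow> z = z' \<or> (K \<le> z \<and> K \<le> z') \<or> (z \<le> - K \<and> z' \<le> - K)"

text \<open>The usual halving of distances in Ehrenfeucht-Fraisse games on finite orders: only the
  nearest marked positions \<open>l\<close> and \<open>q\<close> around \<open>a\<close> matter, as
  all others lie beyond them.\<close>

lemma close_extend:
  assumes Z: "finite Z" "(-1, -1) \<in> Z" "(n, m) \<in> Z"
    and cl: "\<And>a a' b b'. (a, a') \<in> Z \<Longrightarrow> (b, b') \<in> Z \<Longrightarrow> close (2 * K) (a - b) (a' - b')"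
    and a: "-1 < a" "a < n" and K: "1 \<le> K"
  shows "\<exists>a'. -1 < a' \<and> a' < m \<and> (\<forall>(b, b')\<in>Z. close K (a - b) (a' - b'))"
proof -
  define L where "L = {z \<in> Z. fst z \<le> a}"
  define R where "R = {z \<in> Z. a \<le> fst z}"
  have "finite L" "L \<noteq> {}" "finite R" "R \<noteq> {}" using Z a by (auto simp: L_def R_def)
  then have "Max (fst ` L) \<in> fst ` L" "Min (fst ` R) \<in> fst ` R" by (auto intro: Max_in Min_in)
  then obtain l l' q q' where l: "(l, l') \<in> Z" "l \<le> a" "l = Max (fst ` L)"
    and q: "(q, q') \<in> Z" "a \<le> q" "q = Min (fst ` R)"
    by (auto simp: L_def R_def)
  have side: "b \<le> l \<or> q \<le> b" if "(b, b') \<in> Z" for b b'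
  proof (cases "b \<le> a")
    case True
    then have "b \<in> fst ` L" using that by (force simp: L_def)
    then show ?thesis using l(3) \<open>finite L\<close> by simp
  next
    case False
    then have "b \<in> fst ` R" using that by (force simp: R_def)
    then show ?thesis using q(3) \<open>finite R\<close> by simp
  qed
  \<comment> \<open>A small distance to a neighbour is copied. If both distances are at least
    \<open>K\<close>, the gap is at least \<open>2 * K\<close>, and so is the gap on the other side,
    where \<open>l' + K\<close> leaves enough room.\<close>
  define a' where "a' = (if a - l < K then l' + (a - l) else if q - a < K then q' - (q - a) else l' + K)"
  have main: "close K (a - b) (a' - b')" if b: "(b, b') \<in> Z" for b b'
    using side[OF b] cl[OF b l(1)] cl[OF b q(1)] cl[OF l(1) q(1)] l(2) q(2) K
    unfolding close_def a'_def by (smt (verit))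
  have "close K (a - (-1)) (a' - (-1))" "close K (a - n) (a' - m)" using main Z by blast+
  then have "-1 < a'" "a' < m" using a K unfolding close_def by auto
  then show ?thesis using main by blast
qed

text \<open>The sentinels mark the positions just outside the two paths. They put the ends of the
  paths under the distance condition and force the answers into the universe.\<close>

definition game_pairs :: "nat \<Rightarrow> nat \<Rightarrow> nat set \<Rightarrow> (nat \<Rightarrow> nat) \<Rightarrow> (nat \<Rightarrow> nat) \<Rightarrow> (int \<times> int) set" where
  "game_pairs n m A s s' =
     insert (-1, -1) (insert (int n, int m) ((\<lambda>x. (int (s x), int (s' x))) ` A))"

text \<open>Each round halves the bound. With no round left it is 2, which still recognizes the
  differences 0, 1 and -1, that is, equality and adjacency.\<close>

definition path_game :: "nat \<Rightarrow> nat \<Rightarrow> nat \<Rightarrow> nat set \<Rightarrow> (nat \<Rightarrow> nat) \<Rightarrow> (nat \<Rightarrow> nat) \<Rightarrow> bool" where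
  "path_game q n m A s s' \<longleftrightarrow> (\<forall>a a' b b'. (a, a') \<in> game_pairs n m A s s' \<longrightarrow>
     (b, b') \<in> game_pairs n m A s s' \<longrightarrow> close (2 ^ Suc q) (a - b) (a' - b'))"

lemma close_mono: "close K z z' \<Longrightarrow> K' \<le> K \<Longrightarrow> close K' z z'"
  by (auto simp: close_def)

lemma close_swap: "close K z z' \<Longrightarrow> close K z' z"
  by (auto simp: close_def)

lemma path_game_mono:
  assumes "path_game q n m A s s'" "q' \<le> q" "B \<subseteq> A"
  shows "path_game q' n m B s s'"
proof -
  have "(2 :: int) ^ Suc q' \<le> 2 ^ Suc q" using assms(2) by (intro power_increasing) auto
  moreover have "game_pairs n m B s s' \<subseteq> game_pairs n m A s s'" using assms(3) by (auto simp: game_pairs_def)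
  ultimately show ?thesis
    using assms(1) close_mono unfolding path_game_def by blast
qed

lemma path_game_swap:
  assumes "path_game q n m A s s'"
  shows "path_game q m n A s' s"
proof -
  have "(a, a') \<in> game_pairs m n A s' s \<longleftrightarrow> (a', a) \<in> game_pairs n m A s s'" for a a'
    by (auto simp: game_pairs_def)
  then show ?thesis using assms close_swap unfolding path_game_def by simp
qed

lemma path_game_close:
  assumes "path_game q n m A s s'" "x \<in> A" "y \<in> A"
  shows "close (2 ^ Suc q) (int (s x) - int (s y)) (int (s' x) - int (s' y))"
proof -
  have "(int (s z), int (s' z)) \<in> game_pairs n m A s s'" if "z \<in> A" for z
    using that by (auto simp: game_pairs_def)
  then show ?thesis using assms unfolding path_game_def by blast
qed

lemma path_game_extend:
  assumes game: "path_game (Suc q) n m A s s'" and "finite A" "a < n"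
  shows "\<exists>a'<m. path_game q n m (insert x A) (s(x := a)) (s'(x := a'))"
proof -
  have game': "path_game (Suc q) n m (A - {x}) s s'" using path_game_mono[OF game] by auto
  define Z where "Z = game_pairs n m (A - {x}) s s'"
  have cl: "close (2 * 2 ^ Suc q) (a - b) (a' - b')" if "(a, a') \<in> Z" "(b, b') \<in> Z" for a a' b b'
    using game' that unfolding path_game_def Z_def[symmetric] power_Suc[of _ "Suc q"] by blast
  have "\<exists>c. -1 < c \<and> c < int m \<and> (\<forall>(b, b')\<in>Z. close (2 ^ Suc q) (int a - b) (c - b'))"
  proof (rule close_extend[of _ "int n"])
    show "(1 :: int) \<le> 2 ^ Suc q" by (rule one_le_power) simp
    show "finite Z" "(-1, -1) \<in> Z" "(int n, int m) \<in> Z" using assms(2) by (simp_all add: Z_def game_pairs_def)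
  qed (use cl assms(3) in simp_all)
  then obtain c where c: "-1 < c" "c < int m" "\<forall>(b, b')\<in>Z. close (2 ^ Suc q) (int a - b) (c - b')"
    by blast
  define a' where "a' = nat c"
  have ca: "c = int a'" "a' < m" using c by (simp_all add: a'_def)
  let ?f = "\<lambda>y. (int ((s(x := a)) y), int ((s'(x := a')) y))"
  have "?f ` insert x A = insert (?f x) (?f ` (A - {x}))" by blast
  also have "?f ` (A - {x}) = (\<lambda>y. (int (s y), int (s' y))) ` (A - {x})" by (rule image_cong) auto
  finally have all: "game_pairs n m (insert x A) (s(x := a)) (s'(x := a')) = insert (int a, int a') Z"
    unfolding game_pairs_def Z_def by (simp add: insert_commute)
  have "close (2 ^ Suc q) (b - d) (b' - d')"
    if bd: "(b, b') \<in> insert (int a, int a') Z" "(d, d') \<in> insert (int a, int a') Z" for b b' d d'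
  proof -
    have 1: "close (2 ^ Suc q) (int a - e) (int a' - e')" if "(e, e') \<in> Z" for e e' using c(3) ca that by blast
    have 2: "close (2 ^ Suc q) (e - int a) (e' - int a')" if "(e, e') \<in> Z" for e e'
      using 1[OF that] by (auto simp: close_def)
    have 3: "close (2 ^ Suc q) (b - d) (b' - d')" if "(b, b') \<in> Z" "(d, d') \<in> Z"
      by (rule close_mono[OF cl[OF that]]) simp
    have 4: "close (2 ^ Suc q) (int a - int a) (int a' - int a')" by (simp add: close_def)
    show ?thesis using bd 1 2 3 4 by (elim insertE) (simp_all del: diff_self)
  qed
  then have "path_game q n m (insert x A) (s(x := a)) (s'(x := a'))"
    unfolding path_game_def all by blast
  then show ?thesis using ca(2) by blast
qed

lemma path_game_sat:
  assumes "path_game q n m (fo_free \<phi>) s s'" "fo_rank \<phi> \<le> q" "\<And>x. s x < n" "\<And>x. s' x < m"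
    and "fo_sat (pattern_graph path_pattern n) s \<phi>"
  shows "fo_sat (pattern_graph path_pattern m) s' \<phi>"
  using assms
proof (induction \<phi> arbitrary: q n m s s')
  case (FOEq x y)
  have "path_game 0 n m {x, y} s s'" using path_game_mono[OF FOEq.prems(1), of 0] by simp
  then have "close 2 (int (s x) - int (s y)) (int (s' x) - int (s' y))" using path_game_close by fastforce
  then show ?case using FOEq.prems(5) by (simp add: close_def)
next
  case (FOEdge x y)
  have "path_game 0 n m {x, y} s s'" using path_game_mono[OF FOEdge.prems(1), of 0] by simp
  then have "close 2 (int (s x) - int (s y)) (int (s' x) - int (s' y))" using path_game_close by fastforce
  then show ?case using FOEdge.prems(3-5) by (auto simp: close_def path_pattern_def)
next
  case (FONot \<phi>)
  have "fo_sat (pattern_graph path_pattern n) s \<phi>" if "fo_sat (pattern_graph path_pattern m) s' \<phi>"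
    by (rule FONot.IH[OF path_game_swap _ _ _ that]) (use FONot.prems in auto)
  then show ?case using FONot.prems(5) by auto
next
  case (FOAnd \<phi> \<psi>)
  have "path_game q n m (fo_free \<phi>) s s'" "path_game q n m (fo_free \<psi>) s s'"
    using path_game_mono[OF FOAnd.prems(1) order_refl] by auto
  then show ?case using FOAnd by simp
next
  case (FOEx x \<phi>)
  obtain q' where q: "q = Suc q'" using FOEx.prems(2) by (cases q) auto
  obtain a where a: "a < n" "fo_sat (pattern_graph path_pattern n) (s(x := a)) \<phi>" using FOEx.prems(5) by auto
  obtain a' where a': "a' < m" "path_game q' n m (insert x (fo_free (FOEx x \<phi>))) (s(x := a)) (s'(x := a'))"
    using path_game_extend FOEx.prems(1) finite_fo_free a(1) unfolding q by blast
  have "path_game q' n m (fo_free \<phi>) (s(x := a)) (s'(x := a'))"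
    by (rule path_game_mono[OF a'(2)]) auto
  then have "fo_sat (pattern_graph path_pattern m) (s'(x := a')) \<phi>"
    by (rule FOEx.IH[OF _ _ _ _ a(2)]) (use FOEx.prems q a(1) a'(1) in auto)
  then show ?case using a'(1) by auto
qed

subsection \<open>Games on cliques and bicliques\<close>

text \<open>In a clique (one class) or biclique (two classes) only the classes of the vertices matter.\<close>

definition class_game :: "nat \<Rightarrow> (nat \<Rightarrow> nat) \<Rightarrow> nat set \<Rightarrow> (nat \<Rightarrow> nat) \<Rightarrow> (nat \<Rightarrow> nat) \<Rightarrow> bool" where
  "class_game S c A s s' \<longleftrightarrow> (\<forall>x\<in>A. c (s x) = c (s' x)) \<and> (\<forall>x\<in>A. \<forall>y\<in>A. s x = s y \<longleftrightarrow> s' x = s' y)"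

text \<open>A new vertex is answered by a new vertex of the same class. One is available since fewer
  than \<open>S\<close> vertices are in use, while every class has at least
  \<open>S\<close>.\<close>

lemma class_game_sat:
  assumes p: "\<And>i j i' j'. c i = c i' \<Longrightarrow> c j = c j' \<Longrightarrow> i \<noteq> j \<Longrightarrow> i' \<noteq> j' \<Longrightarrow> p i j \<longleftrightarrow> p i' j'"
    and "\<And>i. S \<le> card {j. j < n \<and> c j = c i}" "\<And>i. S \<le> card {j. j < m \<and> c j = c i}"
    and "class_game S c (fo_free \<phi>) s s'" "card (fo_free \<phi>) + fo_rank \<phi> \<le> S" "\<And>x. s x < n" "\<And>x. s' x < m"
    and "fo_sat (pattern_graph p n) s \<phi>"
  shows "fo_sat (pattern_graph p m) s' \<phi>"
  using assms(2-)
proof (induction \<phi> arbitrary: n m s s')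
  case (FOEq x y)
  then show ?case by (simp add: class_game_def)
next
  case (FOEdge x y)
  then have ne: "s x \<noteq> s y" "s' x \<noteq> s' y" and c: "c (s x) = c (s' x)" "c (s y) = c (s' y)"
    by (auto simp: class_game_def)
  have "p (s x) (s y) \<longleftrightarrow> p (s' x) (s' y)" by (rule p[OF c ne])
  then show ?case using FOEdge.prems(6,7) ne by simp
next
  case (FONot \<phi>)
  have "class_game S c (fo_free \<phi>) s' s" using FONot.prems(3) by (auto simp: class_game_def)
  then have "fo_sat (pattern_graph p n) s \<phi>" if "fo_sat (pattern_graph p m) s' \<phi>"
    by (rule FONot.IH[OF FONot.prems(2,1) _ _ _ _ that]) (use FONot.prems in auto)
  then show ?case using FONot.prems(7) by auto
next
  case (FOAnd \<phi> \<psi>)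
  have "card (fo_free \<phi>) \<le> card (fo_free (FOAnd \<phi> \<psi>))" "card (fo_free \<psi>) \<le> card (fo_free (FOAnd \<phi> \<psi>))"
    by (auto intro!: card_mono simp: finite_fo_free)
  then have r: "card (fo_free \<phi>) + fo_rank \<phi> \<le> S" "card (fo_free \<psi>) + fo_rank \<psi> \<le> S"
    using FOAnd.prems(4) by auto
  have g: "class_game S c (fo_free \<phi>) s s'" "class_game S c (fo_free \<psi>) s s'"
    using FOAnd.prems(3) by (auto simp: class_game_def)
  have s: "fo_sat (pattern_graph p n) s \<phi>" "fo_sat (pattern_graph p n) s \<psi>"
    using FOAnd.prems(7) by simp_all
  show ?case
    using FOAnd.IH(1)[OF FOAnd.prems(1,2) g(1) r(1) FOAnd.prems(5,6) s(1)]
      FOAnd.IH(2)[OF FOAnd.prems(1,2) g(2) r(2) FOAnd.prems(5,6) s(2)] by simp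
next
  case (FOEx x \<phi>)
  let ?A = "fo_free \<phi> - {x}"
  obtain a where a: "a < n" "fo_sat (pattern_graph p n) (s(x := a)) \<phi>" using FOEx.prems(7) by auto
  have "\<exists>a'<m. c a' = c a \<and> (\<forall>y\<in>?A. s y = a \<longleftrightarrow> s' y = a')"
  proof (cases "\<exists>y\<in>?A. s y = a")
    case True
    then obtain y where y: "y \<in> ?A" "s y = a" by blast
    then show ?thesis using FOEx.prems(3,6) by (intro exI[of _ "s' y"]) (auto simp: class_game_def)
  next
    case False
    have "card (s' ` ?A) \<le> card ?A" by (rule card_image_le) (simp add: finite_fo_free)
    also have "\<dots> < S" using FOEx.prems(4) by simp
    also have "\<dots> \<le> card {j. j < m \<and> c j = c a}" by (rule FOEx.prems(2))
    finally have "\<not> {j. j < m \<and> c j = c a} \<subseteq> s' ` ?A"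
      using card_mono[of "s' ` ?A" "{j. j < m \<and> c j = c a}"] finite_fo_free[of \<phi>] by auto
    then show ?thesis using False by blast
  qed
  then obtain a' where a': "a' < m" "c a' = c a" "\<forall>y\<in>?A. s y = a \<longleftrightarrow> s' y = a'" by blast
  have g: "class_game S c (fo_free \<phi>) (s(x := a)) (s'(x := a'))"
    using FOEx.prems(3) a'(2,3) by (auto simp: class_game_def)
  have "card (fo_free \<phi>) \<le> Suc (card ?A)"
    using finite_fo_free[of \<phi>] by (cases "x \<in> fo_free \<phi>") (auto simp: card_Diff_singleton)
  then have r: "card (fo_free \<phi>) + fo_rank \<phi> \<le> S" using FOEx.prems(4) by simp
  have "fo_sat (pattern_graph p m) (s'(x := a')) \<phi>"
    by (rule FOEx.IH[OF FOEx.prems(1,2) g r _ _ a(2)]) (use FOEx.prems(5,6) a(1) a'(1) in auto)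
  then show ?case using a'(1) by auto
qed

lemma patterns_indistinguishable:
  assumes "fo_free \<phi> = {}"
  shows "\<exists>k>0. \<forall>p\<in>patterns. \<forall>s s'. (\<forall>x. s x < 2 * k) \<longrightarrow> (\<forall>x. s' x < 2 * k - 1) \<longrightarrow>
    fo_sat (pattern_graph p (2 * k)) s \<phi> \<longrightarrow> fo_sat (pattern_graph p (2 * k - 1)) s' \<phi>"
proof -
  let ?q = "fo_rank \<phi>"
  \<comment> \<open>The power makes both paths longer than any distance visible in \<open>?q\<close>
    rounds; the summand \<open>?q\<close> leaves at least \<open>?q\<close> vertices in each class
    of a biclique.\<close>
  define k :: nat where "k = 2 ^ Suc ?q + ?q + 1"
  have half: "?q \<le> card {j. j < n \<and> j mod 2 = i mod 2}" if "2 * k - 1 \<le> n" for n i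
  proof -
    have "card ((\<lambda>j. 2 * j + i mod 2) ` {..<?q}) = ?q" by (simp add: card_image inj_on_def)
    moreover have sub: "(\<lambda>j. 2 * j + i mod 2) ` {..<?q} \<subseteq> {j. j < n \<and> j mod 2 = i mod 2}"
    proof
      fix y assume "y \<in> (\<lambda>j. 2 * j + i mod 2) ` {..<?q}"
      then obtain j where j: "j < ?q" "y = 2 * j + i mod 2" by auto
      moreover have "i mod 2 < 2" by simp
      ultimately have "y < 2 * ?q" by linarith
      then show "y \<in> {j. j < n \<and> j mod 2 = i mod 2}" using that j(2) by (simp add: k_def)
    qed
    moreover have "finite {j. j < n \<and> j mod 2 = i mod 2}" by simp
    ultimately show ?thesis using card_mono[OF _ sub] by simp
  qed
  have "fo_sat (pattern_graph p (2 * k - 1)) s' \<phi>"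
    if p: "p \<in> patterns" and s: "\<forall>x. s x < 2 * k" "\<forall>x. s' x < 2 * k - 1"
      and sat: "fo_sat (pattern_graph p (2 * k)) s \<phi>" for p s s'
  proof -
    consider "p = path_pattern" | "p = clique_pattern" | "p = biclique_pattern"
      using p by (auto simp: patterns_def)
    then show ?thesis
    proof cases
      case 1
      have "(2 :: int) ^ Suc ?q \<le> int (2 * k)" by (simp add: k_def)
      then have "path_game ?q (2 * k) (2 * k - 1) {} s s'"
        by (auto simp: path_game_def game_pairs_def close_def k_def)
      then show ?thesis using path_game_sat[of ?q "2 * k" "2 * k - 1" \<phi> s s'] assms s sat 1 by simp
    next
      case 2
      have "fo_sat (pattern_graph clique_pattern (2 * k - 1)) s' \<phi>"
        by (rule class_game_sat[where c = "\<lambda>_. 0" and S = ?q and n = "2 * k" and s = s])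
          (use assms s sat 2 in \<open>auto simp: clique_pattern_def class_game_def k_def\<close>)
      then show ?thesis using 2 by simp
    next
      case 3
      have "fo_sat (pattern_graph biclique_pattern (2 * k - 1)) s' \<phi>"
      proof (rule class_game_sat[where c = "\<lambda>i. i mod 2" and S = ?q and n = "2 * k" and s = s])
        show "biclique_pattern i j \<longleftrightarrow> biclique_pattern i' j'"
          if "i mod 2 = i' mod 2" "j mod 2 = j' mod 2" for i j i' j'
          using that unfolding biclique_pattern_def by presburger
        show "?q \<le> card {j. j < 2 * k \<and> j mod 2 = i mod 2}" for i by (rule half) simp
        show "?q \<le> card {j. j < 2 * k - 1 \<and> j mod 2 = i mod 2}" for i by (rule half) simp
      qed (use assms s sat 3 in \<open>simp_all add: class_game_def\<close>)
      then show ?thesis using 3 by simp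
    qed
  qed
  moreover have "0 < k" by (simp add: k_def)
  ultimately show ?thesis by blast
qed

subsection \<open>Perfect matchings\<close>

abbreviation SOAll :: "nat \<Rightarrow> so \<Rightarrow> so" where
  "SOAll x \<phi> \<equiv> SONot (SOEx x (SONot \<phi>))"

abbreviation SOImp :: "so \<Rightarrow> so \<Rightarrow> so" where
  "SOImp \<phi> \<psi> \<equiv> SONot (SOAnd \<phi> (SONot \<psi>))"

text \<open>The relation is total without fixed points, symmetric and functional. That its pairs are
  edges need not be stated, since it is enforced by guardedness.\<close>

definition matching_sentence :: so where
  "matching_sentence = SOExRel 0 2
     (SOAnd (SOAll 0 (SOEx 1 (SOAnd (SONot (SOEq 0 1)) (SORel 0 [0, 1]))))
     (SOAnd (SOAll 0 (SOAll 1 (SOImp (SORel 0 [0, 1]) (SORel 0 [1, 0]))))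
       (SOAll 0 (SOAll 1 (SOAll 2 (SOImp (SOAnd (SORel 0 [0, 1]) (SORel 0 [0, 2])) (SOEq 1 2)))))))"

definition perfect_matching :: "'a pair_pre_digraph \<Rightarrow> ('a \<Rightarrow> 'a) \<Rightarrow> bool" where
  "perfect_matching G f \<longleftrightarrow> (\<forall>v\<in>pverts G. f v \<noteq> v \<and> f v \<in> pverts G \<and> (v, f v) \<in> parcs G \<and> f (f v) = v)"

definition matching_rel :: "'a pair_pre_digraph \<Rightarrow> 'a list set \<Rightarrow> bool" where
  "matching_rel G R \<longleftrightarrow> (\<forall>a\<in>pverts G. \<exists>b\<in>pverts G. a \<noteq> b \<and> [a, b] \<in> R) \<and>
     (\<forall>a\<in>pverts G. \<forall>b\<in>pverts G. [a, b] \<in> R \<longrightarrow> [b, a] \<in> R) \<and>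
     (\<forall>a\<in>pverts G. \<forall>b\<in>pverts G. [a, b] \<in> R \<longrightarrow> (\<forall>c\<in>pverts G. [a, c] \<in> R \<longrightarrow> b = c))"

lemma gso_sat_matching_sentence:
  "gso_sat G \<sigma> \<rho> matching_sentence \<longleftrightarrow> (\<exists>R\<subseteq>tuples 2 (pverts G). guarded G R \<and> matching_rel G R)"
  by (simp add: matching_sentence_def matching_rel_def numeral_2_eq_2)

lemma gso_models_matching_sentence:
  assumes "simple_graph G"
  shows "gso_models G matching_sentence \<longleftrightarrow> (\<exists>f. perfect_matching G f)"
proof -
  obtain v where v: "v \<in> pverts G" using assms by (auto simp: simple_graph_def)
  have "range (\<lambda>_ :: nat. v) \<subseteq> pverts G" using v by auto
  then have "gso_models G matching_sentence \<longleftrightarrow> (\<exists>R\<subseteq>tuples 2 (pverts G). guarded G R \<and> matching_rel G R)"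
    unfolding gso_models_def gso_sat_matching_sentence by blast
  also have "\<dots> \<longleftrightarrow> (\<exists>f. perfect_matching G f)"
  proof
    assume "\<exists>R\<subseteq>tuples 2 (pverts G). guarded G R \<and> matching_rel G R"
    then obtain R where R: "R \<subseteq> tuples 2 (pverts G)" "guarded G R"
      "\<forall>a\<in>pverts G. \<exists>b\<in>pverts G. a \<noteq> b \<and> [a, b] \<in> R"
      "\<forall>a\<in>pverts G. \<forall>b\<in>pverts G. [a, b] \<in> R \<longrightarrow> [b, a] \<in> R"
      "\<forall>a\<in>pverts G. \<forall>b\<in>pverts G. [a, b] \<in> R \<longrightarrow> (\<forall>c\<in>pverts G. [a, c] \<in> R \<longrightarrow> b = c)"
      unfolding matching_rel_def by (elim exE conjE)
    have cl: "clique_rel G 2 R" using guarded_iff[OF assms] R(1,2) by blast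
    have "\<forall>a\<in>pverts G. \<exists>b. b \<in> pverts G \<and> a \<noteq> b \<and> [a, b] \<in> R" using R(3) by blast
    then obtain f where f: "\<And>a. a \<in> pverts G \<Longrightarrow> f a \<in> pverts G \<and> a \<noteq> f a \<and> [a, f a] \<in> R"
      using bchoice[of "pverts G" "\<lambda>a b. b \<in> pverts G \<and> a \<noteq> b \<and> [a, b] \<in> R"] by blast
    have "(a, f a) \<in> parcs G" if "a \<in> pverts G" for a
      using cl f[OF that] unfolding clique_rel_def by fastforce
    moreover have "f (f a) = a" if "a \<in> pverts G" for a
      using R(4,5) f[OF that] f[of "f a"] that by blast
    moreover have "f a \<noteq> a" if "a \<in> pverts G" for a using f[OF that] by auto
    ultimately show "\<exists>f. perfect_matching G f"
      using f unfolding perfect_matching_def by (intro exI[of _ f]) auto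
  next
    assume "\<exists>f. perfect_matching G f"
    then obtain f where f: "perfect_matching G f" by blast
    interpret pair_bidirected_digraph G using assms by (simp add: simple_graph_def)
    have fV: "f a \<noteq> a \<and> f a \<in> pverts G \<and> (a, f a) \<in> parcs G \<and> f (f a) = a" if "a \<in> pverts G" for a
      using f that unfolding perfect_matching_def by blast
    define R where "R = {[v, f v] |v. v \<in> pverts G}"
    have "clique_rel G 2 R"
      using fV graph_symmetric unfolding clique_rel_def R_def by auto
    then have "R \<subseteq> tuples 2 (pverts G)" "guarded G R" using guarded_iff[OF assms, of R 2] by simp_all
    moreover have mem: "[a, b] \<in> R \<longleftrightarrow> a \<in> pverts G \<and> b = f a" for a b
      by (auto simp: R_def)
    ultimately show "\<exists>R\<subseteq>tuples 2 (pverts G). guarded G R \<and> matching_rel G R"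
      unfolding matching_rel_def by (intro exI[of _ R] conjI) (simp_all add: mem fV, metis fV)
  qed
  finally show ?thesis .
qed

lemma perfect_matching_even:
  assumes "finite V" "\<And>v. v \<in> V \<Longrightarrow> f v \<noteq> v \<and> f v \<in> V \<and> f (f v) = v"
  shows "even (card V)"
  using assms
proof (induction V rule: finite_psubset_induct)
  case (psubset V)
  show ?case
  proof (cases "V = {}")
    case False
    then obtain v where v: "v \<in> V" by blast
    let ?U = "V - {v, f v}"
    have "f u \<noteq> u \<and> f u \<in> ?U \<and> f (f u) = u" if "u \<in> ?U" for u
      using psubset.prems[of u] psubset.prems[OF v] that by auto
    moreover have "?U \<subset> V" using v by blast
    ultimately have "even (card ?U)" using psubset.IH by blast
    moreover have "card ?U = card V - card {v, f v}"
      using v psubset.prems[OF v] by (intro card_Diff_subset) auto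
    moreover have "card {v, f v} = 2" using psubset.prems[OF v] by auto
    moreover have "card {v, f v} \<le> card V" using v psubset.prems[OF v] psubset.hyps by (intro card_mono) auto
    ultimately show ?thesis by simp
  qed simp
qed

section \<open>Unbounded tree depth separates the logics\<close>

lemma long_path:
  assumes "simple_graph G" "\<not> tree_depth G \<le> enat n"
  shows "\<exists>ps. path (parcs G) ps \<and> set ps \<subseteq> pverts G \<and> n < length ps"
proof (rule ccontr)
  assume short: "\<nexists>ps. path (parcs G) ps \<and> set ps \<subseteq> pverts G \<and> n < length ps"
  interpret pair_bidirected_digraph G using assms(1) by (simp add: simple_graph_def)
  have sym: "sym (parcs G)" using pair_sym_arcs by (simp add: symmetric_def)
  have "tree_depth (induced G (pverts G)) \<le> enat n"
  proof (rule tree_depth_comps_le[OF sym])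
    show "pverts G \<noteq> {}" using assms(1) by (simp add: simple_graph_def)
    fix D assume "D \<in> comps (parcs G) (pverts G)"
    then obtain x where x: "x \<in> pverts G" "D = component (parcs G) (pverts G) x" by (auto simp: comps_def)
    show "tree_depth (induced G D) \<le> enat n"
      unfolding x(2)
    proof (rule tree_depth_path_le[OF sym x(1)])
      fix ps assume ps: "path (parcs G) (x # ps)" "set ps \<subseteq> component (parcs G) (pverts G) x"
      then have "set (x # ps) \<subseteq> pverts G" using component_subset[OF x(1)] x(1) by auto
      then show "length ps < n" using short ps(1) by (metis length_Cons not_less_eq)
    qed
  qed
  then show False using assms(2) induced_pverts[OF assms(1)] by simp
qed

theorem same_power_bounded_tree_depth:
  fixes \<C> :: "'a pair_pre_digraph set"
  assumes simple: "\<And>G. G \<in> \<C> \<Longrightarrow> simple_graph G" and closed: "closed_under_induced_subgraphs \<C>"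
    and GSO_FO: "at_most_expressive \<C> GSO FO"
  shows "bounded_tree_depth \<C>"
proof (rule ccontr)
  assume unbounded: "\<not> bounded_tree_depth \<C>"
  have "so_free matching_sentence = {}" "so_free_rel matching_sentence = {}"
    by (auto simp: matching_sentence_def)
  then have "matching_sentence \<in> fst (GSO :: ('a pair_pre_digraph, so) logic)" by (simp add: GSO_def)
  then obtain \<psi> where \<psi>: "fo_free \<psi> = {}"
    and eq: "{S \<in> \<C>. gso_models S matching_sentence} = {S \<in> \<C>. fo_models S \<psi>}"
    using GSO_FO unfolding at_most_expressive_def by (auto simp: FO_def GSO_def)
  obtain k where k: "0 < k" "\<forall>p\<in>patterns. \<forall>s s'. (\<forall>x. s x < 2 * k) \<longrightarrow> (\<forall>x. s' x < 2 * k - 1) \<longrightarrow>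
    fo_sat (pattern_graph p (2 * k)) s \<psi> \<longrightarrow> fo_sat (pattern_graph p (2 * k - 1)) s' \<psi>"
    using patterns_indistinguishable[OF \<psi>] by (elim exE conjE)
  have "0 < 2 * k" using k(1) by simp
  from traceable_patterns[OF this] obtain N where N: "\<forall>adj :: nat \<Rightarrow> nat \<Rightarrow> bool.
    (\<forall>a b. adj a b \<longrightarrow> adj b a) \<and> (\<forall>i. Suc i < N \<longrightarrow> adj i (Suc i)) \<longrightarrow>
    (\<exists>p\<in>patterns. \<exists>v. realizes adj {..<N} (2 * k) p v)" by (rule exE)
  obtain G where G: "G \<in> \<C>" "\<not> tree_depth G \<le> enat N"
    using unbounded unfolding bounded_tree_depth_def by blast
  interpret pair_bidirected_digraph G using simple[OF G(1)] by (simp add: simple_graph_def)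
  have irr: "(x, x) \<notin> parcs G" for x using pair_no_loops[of "(x, x)"] by auto
  obtain ps where ps: "path (parcs G) ps" "set ps \<subseteq> pverts G" "N < length ps"
    using long_path[OF simple[OF G(1)] G(2)] by blast
  define adj where "adj i j \<longleftrightarrow> (ps ! i, ps ! j) \<in> parcs G" for i j
  have "adj i (Suc i)" if "Suc i < N" for i
    using ps(1,3) that successively_nth[of "\<lambda>x y. (x, y) \<in> parcs G" ps i] by (simp add: adj_def path_def)
  moreover have "adj a b \<longrightarrow> adj b a" for a b using graph_symmetric by (simp add: adj_def)
  ultimately obtain p v where p: "p \<in> patterns" and v: "realizes adj {..<N} (2 * k) p v"
    using N by blast
  define w where "w i = ps ! v i" for i
  have vlt: "v i < length ps" if "i < 2 * k" for i
    using v that ps(3) by (force simp: realizes_def)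
  have injw: "inj_on w {..<2 * k}"
    using v vlt ps(1) by (auto simp: realizes_def inj_on_def w_def path_def nth_eq_iff_index_eq)
  have w: "realizes (\<lambda>x y. (x, y) \<in> parcs G) (pverts G) (2 * k) p w"
    using v injw vlt ps(2) by (auto simp: realizes_def w_def adj_def subset_iff)
  have wV: "w ` {..<n} \<subseteq> pverts G" if "n \<le> 2 * k" for n using w that by (auto simp: realizes_def)
  define H where "H n = induced G (w ` {..<n})" for n
  have HC: "H n \<in> \<C>" if "0 < n" "n \<le> 2 * k" for n
  proof -
    have "w 0 \<in> w ` {..<n}" using that(1) by simp
    then have "w ` {..<n} \<noteq> {}" by blast
    then show ?thesis
      using closed[unfolded closed_under_induced_subgraphs_def, THEN bspec, OF G(1), THEN spec, of "w ` {..<n}"]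
        wV[OF that(2)] unfolding H_def by simp
  qed
  have sat: "fo_models (H n) \<psi> \<longleftrightarrow> fo_sat (pattern_graph p n) (\<lambda>_. 0) \<psi>" if n: "0 < n" "n \<le> 2 * k" for n
  proof -
    have "fo_sat (H n) \<sigma> \<psi> \<longleftrightarrow> fo_sat (H n) (w \<circ> (\<lambda>_. 0)) \<psi>" for \<sigma>
      by (rule fo_sat_cong) (simp add: \<psi>)
    moreover have "range (w \<circ> (\<lambda>_ :: nat. 0)) \<subseteq> pverts (H n)" using n by (auto simp: H_def)
    ultimately have "fo_models (H n) \<psi> \<longleftrightarrow> fo_sat (H n) (w \<circ> (\<lambda>_. 0)) \<psi>" unfolding fo_models_def by blast
    also have "\<dots> \<longleftrightarrow> fo_sat (pattern_graph p n) (\<lambda>_. 0) \<psi>"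
      unfolding H_def by (rule fo_sat_pattern_graph[OF w n(2) irr]) (use n in simp)
    finally show ?thesis .
  qed
  have simpleH: "simple_graph (H n)" if "0 < n" "n \<le> 2 * k" for n using simple HC that by blast
  have consec: "p i (Suc i)" "p (Suc i) i" if "even i" for i
    using p by (auto simp: patterns_def path_pattern_def clique_pattern_def biclique_pattern_def)
  \<comment> \<open>\<open>g\<close> exchanges \<open>2 * j\<close> and \<open>2 * j + 1\<close>. It
    stays below the even number \<open>2 * k\<close>, and such pairs are adjacent in every
    pattern.\<close>
  define g where "g i = (if even i then Suc i else i - 1)" for i :: nat
  have g: "g i < 2 * k" "g i \<noteq> i" "g (g i) = i" if "i < 2 * k" for i
    using that by (auto simp: g_def elim!: evenE oddE)
  have gp: "p i (g i)" for i using consec[of i] consec[of "i - 1"] by (cases "even i") (auto simp: g_def)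
  define f where "f x = w (g (the_inv_into {..<2 * k} w x))" for x
  have fw: "f (w i) = w (g i)" if "i < 2 * k" for i
    using that injw by (simp add: f_def the_inv_into_f_f)
  have "perfect_matching (H (2 * k)) f"
    unfolding perfect_matching_def
  proof
    fix x assume "x \<in> pverts (H (2 * k))"
    then obtain i where i: "i < 2 * k" "x = w i" by (auto simp: H_def)
    have fx: "f x = w (g i)" using fw i by simp
    have "w (g i) \<noteq> w i" using injw g[OF i(1)] i(1) by (auto dest: inj_onD)
    moreover have "(w i, w (g i)) \<in> parcs G"
      using w g(1,2)[OF i(1)] i(1) gp[of i] by (simp add: realizes_def)
    moreover have "f (f x) = x" using fx fw[OF g(1)[OF i(1)]] g(3)[OF i(1)] i(2) by simp
    ultimately show "f x \<noteq> x \<and> f x \<in> pverts (H (2 * k)) \<and> (x, f x) \<in> parcs (H (2 * k)) \<and> f (f x) = x"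
      unfolding fx using i g(1)[OF i(1)] by (auto simp: H_def induced_def)
  qed
  then have "gso_models (H (2 * k)) matching_sentence"
    using gso_models_matching_sentence[OF simpleH] k(1) by auto
  then have "fo_models (H (2 * k)) \<psi>" using eq HC k(1) by auto
  then have "fo_sat (pattern_graph p (2 * k)) (\<lambda>_. 0) \<psi>" using sat k(1) by simp
  then have "fo_sat (pattern_graph p (2 * k - 1)) (\<lambda>_. 0) \<psi>"
    by (rule k(2)[rule_format, OF p, rotated 2]) (use k(1) in simp_all)
  then have "fo_models (H (2 * k - 1)) \<psi>" using sat k(1) by simp
  then have "gso_models (H (2 * k - 1)) matching_sentence" using eq HC[of "2 * k - 1"] k(1) by auto
  then obtain h where h: "perfect_matching (H (2 * k - 1)) h"
    using gso_models_matching_sentence[OF simpleH[of "2 * k - 1"]] k(1) by auto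
  have "even (card (pverts (H (2 * k - 1))))"
    by (rule perfect_matching_even) (use h in \<open>auto simp: perfect_matching_def H_def\<close>)
  moreover have "card (pverts (H (2 * k - 1))) = 2 * k - 1"
    using inj_on_subset[OF injw, of "{..<2 * k - 1}"] by (simp add: H_def card_image)
  ultimately show False using k(1) by simp
qed

theorem theorem3:
  fixes \<C> :: "'a pair_pre_digraph set"
  assumes "\<And>G. G \<in> \<C> \<Longrightarrow> simple_graph G"
    and "closed_under_induced_subgraphs \<C>"
  shows "same_expressive_power \<C> FO GSO \<longleftrightarrow> bounded_tree_depth \<C>"
proof
  assume "same_expressive_power \<C> FO GSO"
  then show "bounded_tree_depth \<C>"
    using same_power_bounded_tree_depth[OF assms] by (simp add: same_expressive_power_def)
next
  assume "bounded_tree_depth \<C>"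
  then show "same_expressive_power \<C> FO GSO"
    using FO_at_most_GSO bounded_tree_depth_same_power[OF assms(1)]
    by (auto simp: same_expressive_power_def bounded_tree_depth_def)
qed

end
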